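(* The adapted $(p,\infty)$-Wasserstein distance $\mathcal{AW}_p^\infty$ is a metric (on $\mathcal{P}_p(\mathbb{R}^N)$) satisfying $\mathcal{AW}_p\le N^{1/p}\,\mathcal{AW}_p^\infty$, i.e. $\mathcal{AW}_p(\mu,\nu)\le N^{1/p}\,\mathcal{AW}_p^\infty(\mu,\nu)$ for all $\mu,\nu\in\mathcal{P}_p(\mathbb{R}^N)$.
   Context: Fix $N\in\mathbb{N}$ and $p\in[1,\infty)$. For $x\in\mathbb{R}^k$ let $\|x\|=(\sum_{t=1}^k|x_t|^p)^{1/p}$ and $x_{s:t}=(x_s,\dots,x_t)$. $\mathcal{P}(\mathbb{R}^k)$ is the set of Borel probability measures and $\mathcal{P}_p(\mathbb{R}^k)$ those with finite $p$-th moment; $\Pi(\mu,\nu)$ is the set of couplings of $\mu$ and $\nu$. For $\mu\in\mathcal{P}_p(\mathbb{R}^N)$ write the disintegration $\mu=\mu^1\otimes\mu_{x_1}\otimes\dots\otimes\mu_{x_{1:N-1}}$, where $\mu^1$ is the first marginal and $\mu_{x_{1:t}}$ is the conditional distribution of the $(t+1)$-st coordinate given that the first $t$ coordinates equal $x_{1:t}$. A coupling $\gamma\in\Pi(\mu,\nu)$, disintegrated as $\gamma=\gamma^1\otimes\gamma_{x_1,y_1}\otimes\dots\otimes\gamma_{x_{1:N-1},y_{1:N-1}}$ (with $\gamma^1$ the law of $(x_1,y_1)$ and $\gamma_{x_{1:t},y_{1:t}}$ the conditional law of $(x_{t+1},y_{t+1})$ given $(x_{1:t},y_{1:t})$), is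 bicausal if $\gamma^1\in\Pi(\mu^1,\nu^1)$ and $\gamma_{x_{1:t},y_{1:t}}\in\Pi(\mu_{x_{1:t}},\nu_{y_{1:t}})$ for $\gamma$-a.e. $(x,y)$, $t=1,\dots,N-1$. The set of these is $\Pi_{\mathrm{bc}}(\mu,\nu)$. The adapted Wasserstein distance is given by $\mathcal{AW}_p(\mu,\nu)^p:=\inf_{\gamma\in\Pi_{\mathrm{bc}}(\mu,\nu)}\int\|x-y\|^p\,\gamma(dx,dy)$. For $\pi\in\mathcal{P}(\mathbb{R}^2)$ set $\mathcal{C}_p(\pi)=(\int|x_1-y_1|^p\,\pi(dx_1,dy_1))^{1/p}$. Define recursively functionals $\mathcal{F}_{t,p}:\mathcal{P}_p(\mathbb{R}^{N-t}\times\mathbb{R}^{N-t})\to\mathbb{R}$, $t=0,1,\dots,N$, by $\mathcal{F}_{N,p}:=0$ and $\mathcal{F}_{t,p}(\gamma):=\mathcal{C}_p(\gamma^1)\vee\|\mathcal{F}_{t+1,p}(\bar\gamma_{x_1,y_1})\|_{L^\infty(\gamma^1)}$, where $\gamma^1$ is the law of the first coordinate pair $(x_1,y_1)$ under $\gamma$ and $\bar\gamma_{x_1,y_1}$ is the conditional law of all remaining coordinate pairs given $(x_1,y_1)$. The adapted $(p,\infty)$-Wasserstein distance is $\mathcal{AW}_p^\infty(\mu,\nu):=\inf_{\gamma\in\Pi_{\mathrm{bc}}(\mu,\nu)}\mathcal{F}_{0,p}(\gamma)$.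
   Formalization: "Metric" is proved as an extended metric (value ∞ allowed): for N=2, μ the law of (G,G) with G Gaussian and ν the Dirac mass at 0, the adapted (p,∞)-distance is ∞, so a finite-valued metric on all of P_p(R^N) does not exist. *)

theory Defs
  imports "HOL-Probability.Probability"
begin

text \<open>
  A point of \<open>\<real>\<^sup>I\<close>, for a finite set \<open>I\<close> of times, is an extensional function on \<open>I\<close>.
  Times are numbered from \<open>1\<close>, so \<open>\<real>\<^sup>N\<close> is \<open>Rsp {1..N}\<close>, the segment \<open>x\<^sub>s\<^sub>:\<^sub>t\<close> is
  \<open>restrict x {s..t}\<close>, and \<open>\<real>\<^sup>N\<^sup>-\<^sup>t\<close> is realised as \<open>Rsp {t+1..N}\<close>, keeping the original
  time labels instead of shifting them.
\<close>

abbreviation Rsp :: "nat set \<Rightarrow> (nat \<Rightarrow> real) measure" where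
  "Rsp I \<equiv> Pi\<^sub>M I (\<lambda>_. borel)"

definition pnorm :: "real \<Rightarrow> nat set \<Rightarrow> (nat \<Rightarrow> real) \<Rightarrow> real" where
  "pnorm p I x = (\<Sum>t\<in>I. \<bar>x t\<bar> powr p) powr (1 / p)"

text \<open>The \<open>p\<close>-th root on \<open>[0, \<infinity>]\<close>, for \<open>p > 0\<close>.\<close>

definition enn_root :: "real \<Rightarrow> ennreal \<Rightarrow> ennreal" where
  "enn_root p a = (if a = \<infinity> then \<infinity> else ennreal (enn2real a powr (1 / p)))"

definition Pp :: "real \<Rightarrow> nat \<Rightarrow> (nat \<Rightarrow> real) measure set" where
  "Pp p N = {\<mu> \<in> space (prob_algebra (Rsp {1..N})).
     (\<integral>\<^sup>+ x. ennreal (pnorm p {1..N} x powr p) \<partial>\<mu>) < \<infinity>}"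

definition couplings :: "'a measure \<Rightarrow> 'b measure \<Rightarrow> ('a \<times> 'b) measure set" where
  "couplings \<mu> \<nu> = {\<gamma> \<in> space (prob_algebra (\<mu> \<Otimes>\<^sub>M \<nu>)). distr \<gamma> \<mu> fst = \<mu> \<and> distr \<gamma> \<nu> snd = \<nu>}"

text \<open>
  \<open>K\<close> is a regular conditional distribution of \<open>Y\<close> given \<open>X\<close> under \<open>M\<close>:
  the law of \<open>(X, Y)\<close> is the law of \<open>X\<close> composed with the probability kernel \<open>K\<close>.
\<close>

definition is_cond_law ::
    "'w measure \<Rightarrow> 'a measure \<Rightarrow> ('w \<Rightarrow> 'a) \<Rightarrow> 'b measure \<Rightarrow> ('w \<Rightarrow> 'b) \<Rightarrow> ('a \<Rightarrow> 'b measure) \<Rightarrow> bool"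
  where
  "is_cond_law M S X T Y K \<longleftrightarrow>
     K \<in> S \<rightarrow>\<^sub>M prob_algebra T \<and>
     distr M (S \<Otimes>\<^sub>M T) (\<lambda>w. (X w, Y w)) =
       distr M S X \<bind> (\<lambda>a. distr (K a) (S \<Otimes>\<^sub>M T) (\<lambda>b. (a, b)))"

text \<open>
  A fixed version of the conditional law. It is applied only with \<open>S\<close> and \<open>T\<close> finite products of
  real lines, where a version exists and any two versions agree almost everywhere for the law of
  \<open>X\<close>; nothing below depends on the choice.
\<close>

definition cond_law ::
    "'w measure \<Rightarrow> 'a measure \<Rightarrow> ('w \<Rightarrow> 'a) \<Rightarrow> 'b measure \<Rightarrow> ('w \<Rightarrow> 'b) \<Rightarrow> 'a \<Rightarrow> 'b measure" where
  "cond_law M S X T Y = (SOME K. is_cond_law M S X T Y K)"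

text \<open>\<open>\<mu>\<close> conditioned on the path \<open>x\<^sub>1\<^sub>:\<^sub>t\<close>: the law of coordinate \<open>t + 1\<close>.\<close>

definition next_law :: "(nat \<Rightarrow> real) measure \<Rightarrow> nat \<Rightarrow> (nat \<Rightarrow> real) \<Rightarrow> real measure" where
  "next_law \<mu> t =
     cond_law \<mu> (Rsp {1..t}) (\<lambda>x. restrict x {1..t}) borel (\<lambda>x. x (t + 1))"

definition next_pair_law ::
    "((nat \<Rightarrow> real) \<times> (nat \<Rightarrow> real)) measure \<Rightarrow> nat \<Rightarrow>
       (nat \<Rightarrow> real) \<times> (nat \<Rightarrow> real) \<Rightarrow> (real \<times> real) measure" where
  "next_pair_law \<gamma> t =
     cond_law \<gamma>
       (Rsp {1..t} \<Otimes>\<^sub>M Rsp {1..t}) (\<lambda>(x, y). (restrict x {1..t}, restrict y {1..t}))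
       (borel \<Otimes>\<^sub>M borel) (\<lambda>(x, y). (x (t + 1), y (t + 1)))"

definition pair_marginal ::
    "((nat \<Rightarrow> real) \<times> (nat \<Rightarrow> real)) measure \<Rightarrow> nat \<Rightarrow> (real \<times> real) measure" where
  "pair_marginal \<gamma> s = distr \<gamma> (borel \<Otimes>\<^sub>M borel) (\<lambda>(x, y). (x s, y s))"

definition bicausal_couplings ::
    "nat \<Rightarrow> (nat \<Rightarrow> real) measure \<Rightarrow> (nat \<Rightarrow> real) measure \<Rightarrow>
       ((nat \<Rightarrow> real) \<times> (nat \<Rightarrow> real)) measure set" where
  "bicausal_couplings N \<mu> \<nu> =
     {\<gamma> \<in> couplings \<mu> \<nu>.
        pair_marginal \<gamma> 1 \<in> couplings (distr \<mu> borel (\<lambda>x. x 1)) (distr \<nu> borel (\<lambda>y. y 1)) \<and>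
        (\<forall>t\<in>{1..<N}. AE (x, y) in \<gamma>.
           next_pair_law \<gamma> t (restrict x {1..t}, restrict y {1..t})
             \<in> couplings (next_law \<mu> t (restrict x {1..t})) (next_law \<nu> t (restrict y {1..t})))}"

definition AW ::
    "real \<Rightarrow> nat \<Rightarrow> (nat \<Rightarrow> real) measure \<Rightarrow> (nat \<Rightarrow> real) measure \<Rightarrow> ennreal" where
  "AW p N \<mu> \<nu> =
     enn_root p (INF \<gamma>\<in>bicausal_couplings N \<mu> \<nu>.
       \<integral>\<^sup>+ (x, y). ennreal (pnorm p {1..N} (\<lambda>t. x t - y t) powr p) \<partial>\<gamma>)"

definition Cp :: "real \<Rightarrow> (real \<times> real) measure \<Rightarrow> ennreal" where
  "Cp p \<pi> = enn_root p (\<integral>\<^sup>+ (a, b). ennreal (\<bar>a - b\<bar> powr p) \<partial>\<pi>)"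

text \<open>
  The \<open>L\<^sup>\<infinity>\<close> norm of a \<open>[0, \<infinity>]\<close>-valued function. It equals \<open>esssup M f\<close> whenever \<open>f\<close> is measurable;
  unlike \<open>esssup\<close>, it does not jump to \<open>\<infinity>\<close> if measurability fails on a null set only.
\<close>

definition Linf_norm :: "'a measure \<Rightarrow> ('a \<Rightarrow> ennreal) \<Rightarrow> ennreal" where
  "Linf_norm M f = Inf {c. AE z in M. f z \<le> c}"

text \<open>
  The law, under \<open>\<gamma>\<close> on \<open>\<real>\<^sup>N\<^sup>-\<^sup>t \<times> \<real>\<^sup>N\<^sup>-\<^sup>t\<close>, of all remaining coordinate pairs given the first one.
  With the time labels kept, the first pair carries the label \<open>t + 1\<close>.
\<close>

definition rest_law ::
    "nat \<Rightarrow> nat \<Rightarrow> ((nat \<Rightarrow> real) \<times> (nat \<Rightarrow> real)) measure \<Rightarrow>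
       real \<times> real \<Rightarrow> ((nat \<Rightarrow> real) \<times> (nat \<Rightarrow> real)) measure" where
  "rest_law N t \<gamma> =
     cond_law \<gamma>
       (borel \<Otimes>\<^sub>M borel) (\<lambda>(x, y). (x (t + 1), y (t + 1)))
       (Rsp {t + 2..N} \<Otimes>\<^sub>M Rsp {t + 2..N})
       (\<lambda>(x, y). (restrict x {t + 2..N}, restrict y {t + 2..N}))"

function Ft ::
    "real \<Rightarrow> nat \<Rightarrow> nat \<Rightarrow> ((nat \<Rightarrow> real) \<times> (nat \<Rightarrow> real)) measure \<Rightarrow> ennreal" where
  "Ft p N t \<gamma> =
     (if t < N
      then max (Cp p (pair_marginal \<gamma> (t + 1)))
               (Linf_norm (pair_marginal \<gamma> (t + 1)) (\<lambda>z. Ft p N (t + 1) (rest_law N t \<gamma> z)))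
      else 0)"
  by pat_completeness auto
termination by (relation "Wellfounded.measure (\<lambda>(p, N, t, \<gamma>). N - t)") auto

declare Ft.simps [simp del]

definition AWinf ::
    "real \<Rightarrow> nat \<Rightarrow> (nat \<Rightarrow> real) measure \<Rightarrow> (nat \<Rightarrow> real) measure \<Rightarrow> ennreal" where
  "AWinf p N \<mu> \<nu> = (INF \<gamma>\<in>bicausal_couplings N \<mu> \<nu>. Ft p N 0 \<gamma>)"

text \<open>
  A metric that may take the value \<open>\<infinity>\<close>. For \<open>AWinf\<close> this cannot be avoided on all of \<open>Pp p N\<close>:
  for \<open>N = 2\<close>, \<open>\<mu>\<close> the law of \<open>(G, G)\<close> with \<open>G\<close> standard Gaussian, and \<open>\<nu>\<close> the Dirac measure at \<open>0\<close>,
  the only coupling has second-step cost \<open>\<bar>x\<^sub>1\<bar>\<close>, whose essential supremum is \<open>\<infinity>\<close>.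
\<close>

definition ext_metric_on :: "'a set \<Rightarrow> ('a \<Rightarrow> 'a \<Rightarrow> ennreal) \<Rightarrow> bool" where
  "ext_metric_on S d \<longleftrightarrow>
     (\<forall>x\<in>S. \<forall>y\<in>S. d x y = 0 \<longleftrightarrow> x = y) \<and>
     (\<forall>x\<in>S. \<forall>y\<in>S. d x y = d y x) \<and>
     (\<forall>x\<in>S. \<forall>y\<in>S. \<forall>z\<in>S. d x z \<le> d x y + d y z)"

end

theory Submission
  imports Defs
begin

text \<open>
  Everything is reduced to two statements about a coupling \<open>\<gamma>\<close> in which no kernel of \<open>\<gamma>\<close> occurs.

  First, unfolding the recursion, \<open>Ft p N 0 \<gamma> \<le> c\<close> says that for each time \<open>t\<close> the conditional mean of
  \<open>\<bar>x\<^sub>t\<^sub>+\<^sub>1 - y\<^sub>t\<^sub>+\<^sub>1\<bar>\<^sup>p\<close> given the past \<open>(x\<^sub>1\<^sub>:\<^sub>t, y\<^sub>1\<^sub>:\<^sub>t)\<close> is at most \<open>c\<^sup>p\<close> (\<open>Ft_le_iff\<close>), that is,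
  \<open>\<integral>\<^sub>A \<bar>x\<^sub>t\<^sub>+\<^sub>1 - y\<^sub>t\<^sub>+\<^sub>1\<bar>\<^sup>p d\<gamma> \<le> c\<^sup>p \<gamma>(A)\<close> for all events \<open>A\<close> of the past. Second, \<open>\<gamma>\<close> is bicausal iff for
  each \<open>t\<close> the law of \<open>x\<^sub>t\<^sub>+\<^sub>1\<close> given \<open>(x\<^sub>1\<^sub>:\<^sub>t, y\<^sub>1\<^sub>:\<^sub>t)\<close> is \<open>\<mu>\<close> conditioned on \<open>x\<^sub>1\<^sub>:\<^sub>t\<close>, and likewise with the
  roles exchanged (\<open>bicausal_iff\<close>): given its own past, the next step of one path is independent
  of the past of the other.

  With these descriptions the bound on \<open>AW\<close> is the case where \<open>A\<close> is the whole space, summed over \<open>t\<close>;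
  symmetry is the exchange of the two paths; and the diagonal coupling gives \<open>AWinf p N \<mu> \<mu> = 0\<close>.
  If the distance of \<open>\<mu>\<close> and \<open>\<nu>\<close> is \<open>0\<close>, there are couplings of arbitrarily small cost, so the distribution function
  of \<open>\<mu>\<close> is bounded by every right shift of that of \<open>\<nu>\<close>, and conversely; hence \<open>\<mu> = \<nu>\<close>.

  For the triangle inequality, couplings of \<open>(\<mu>, \<nu>)\<close> and \<open>(\<nu>, \<eta>)\<close> are glued to a law of a triple
  \<open>(x, y, z)\<close> with \<open>x\<close> and \<open>z\<close> independent given \<open>y\<close>. Causality of \<open>(y, z)\<close> implies that \<open>z\<^sub>1\<^sub>:\<^sub>t\<close> depends on
  the whole path \<open>y\<close> through \<open>y\<^sub>1\<^sub>:\<^sub>t\<close> only (\<open>causal_past\<close>). Therefore adding \<open>z\<^sub>1\<^sub>:\<^sub>t\<close> to the past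
  \<open>(x\<^sub>1\<^sub>:\<^sub>t, y\<^sub>1\<^sub>:\<^sub>t)\<close> changes no conditional law of \<open>(x\<^sub>t\<^sub>+\<^sub>1, y\<^sub>t\<^sub>+\<^sub>1)\<close> (\<open>markov_triple_step\<close>). Consequently
  \<open>(x, z)\<close> is again bicausal, the bounds for \<open>(x, y)\<close> and \<open>(y, z)\<close> hold conditionally on
  \<open>(x\<^sub>1\<^sub>:\<^sub>t, z\<^sub>1\<^sub>:\<^sub>t)\<close>, and Minkowski's inequality on each event of that past adds them. All these conditional
  independences are instances of one symmetry, \<open>is_cond_law_exchange\<close>.

  The definitions refer to conditional laws, so it is also necessary that these exist on finite
  products of real lines and are unique almost everywhere. Existence on \<open>\<real>\<close> comes from
  conditional distribution functions at rational points (\<open>ex_cond_law_bounded\<close>), existence on products from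
  composing kernels (\<open>is_cond_law_chain\<close>).
\<close>

section \<open>The calculus of conditional laws\<close>

lemma is_cond_law_kernel: "is_cond_law M S X T Y K \<Longrightarrow> K \<in> S \<rightarrow>\<^sub>M prob_algebra T"
  by (simp add: is_cond_law_def)

lemma measurable_pair_kernel:
  assumes K: "K \<in> S \<rightarrow>\<^sub>M prob_algebra T"
  shows "(\<lambda>a. distr (K a) (S \<Otimes>\<^sub>M T) (\<lambda>b. (a, b))) \<in> S \<rightarrow>\<^sub>M prob_algebra (S \<Otimes>\<^sub>M T)"
  using K by measurable

text \<open>
  The defining identity of the two laws on \<open>S \<Otimes>\<^sub>M T\<close>, read as an iterated integral. Unlike the definition it
  permits functions of \<open>X\<close> and \<open>Y\<close> to be integrated without leaving \<open>M\<close>.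
\<close>

lemma is_cond_law_nn_integral:
  assumes M: "prob_space M" and X: "X \<in> M \<rightarrow>\<^sub>M S" and Y: "Y \<in> M \<rightarrow>\<^sub>M T"
    and c: "is_cond_law M S X T Y K" and f: "f \<in> borel_measurable (S \<Otimes>\<^sub>M T)"
  shows "(\<integral>\<^sup>+w. f (X w, Y w) \<partial>M) = (\<integral>\<^sup>+w. \<integral>\<^sup>+b. f (X w, b) \<partial>K (X w) \<partial>M)"
proof -
  note [measurable] = X Y f
  have K[measurable]: "K \<in> S \<rightarrow>\<^sub>M prob_algebra T"
    and eq: "distr M (S \<Otimes>\<^sub>M T) (\<lambda>w. (X w, Y w)) =
       distr M S X \<bind> (\<lambda>a. distr (K a) (S \<Otimes>\<^sub>M T) (\<lambda>b. (a, b)))"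
    using c by (auto simp: is_cond_law_def)
  have sK: "sets (K a) = sets T" if "a \<in> space S" for a
    using measurable_space[OF K that] by (simp add: space_prob_algebra)
  have *: "(\<lambda>a. distr (K a) (S \<Otimes>\<^sub>M T) (Pair a)) \<in> distr M S X \<rightarrow>\<^sub>M subprob_algebra (S \<Otimes>\<^sub>M T)"
    using measurable_pair_kernel[OF K] by (simp add: measurable_prob_algebraD)
  have m: "(\<lambda>a. \<integral>\<^sup>+b. f (a, b) \<partial>K a) \<in> borel_measurable S"
    by (rule nn_integral_measurable_subprob_algebra2[where N=T]) (auto simp: measurable_prob_algebraD)
  have "(\<integral>\<^sup>+w. f (X w, Y w) \<partial>M) = (\<integral>\<^sup>+z. f z \<partial>distr M (S \<Otimes>\<^sub>M T) (\<lambda>w. (X w, Y w)))"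
    by (subst nn_integral_distr) auto
  also have "\<dots> = (\<integral>\<^sup>+a. \<integral>\<^sup>+z. f z \<partial>distr (K a) (S \<Otimes>\<^sub>M T) (Pair a) \<partial>distr M S X)"
    unfolding eq by (rule nn_integral_bind[OF f *])
  also have "\<dots> = (\<integral>\<^sup>+a. \<integral>\<^sup>+b. f (a, b) \<partial>K a \<partial>distr M S X)"
  proof (rule nn_integral_cong)
    fix a assume "a \<in> space (distr M S X)"
    then have a: "a \<in> space S" by simp
    have "Pair a \<in> K a \<rightarrow>\<^sub>M S \<Otimes>\<^sub>M T"
      using a by (simp add: measurable_cong_sets[OF sK[OF a] refl])
    then show "(\<integral>\<^sup>+z. f z \<partial>distr (K a) (S \<Otimes>\<^sub>M T) (Pair a)) = (\<integral>\<^sup>+b. f (a, b) \<partial>K a)"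
      by (simp add: nn_integral_distr)
  qed
  also have "\<dots> = (\<integral>\<^sup>+w. \<integral>\<^sup>+b. f (X w, b) \<partial>K (X w) \<partial>M)"
    using m by (simp add: nn_integral_distr)
  finally show ?thesis .
qed

lemma kernel_nn_integral_measurable:
  assumes K: "K \<in> S \<rightarrow>\<^sub>M prob_algebra T" and f: "f \<in> borel_measurable (S \<Otimes>\<^sub>M T)"
  shows "(\<lambda>a. \<integral>\<^sup>+b. f (a, b) \<partial>K a) \<in> borel_measurable S"
  using f by (intro nn_integral_measurable_subprob_algebra2[where N=T]) (auto simp: measurable_prob_algebraD[OF K])

lemma kernel_emeasure_measurable:
  assumes K: "K \<in> S \<rightarrow>\<^sub>M prob_algebra T" and B: "B \<in> sets T"
  shows "(\<lambda>a. emeasure (K a) B) \<in> borel_measurable S"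
  using B measurable_prob_algebraD[OF K] by simp

lemma kernel_at:
  assumes "K \<in> S \<rightarrow>\<^sub>M prob_algebra T" "a \<in> space S"
  shows "prob_space (K a)" "sets (K a) = sets T" "space (K a) = space T"
  using measurable_space[OF assms] sets_eq_imp_space_eq by (auto simp: space_prob_algebra)

lemma is_cond_law_emeasure:
  assumes M: "prob_space M" and X: "X \<in> M \<rightarrow>\<^sub>M S" and Y: "Y \<in> M \<rightarrow>\<^sub>M T"
    and c: "is_cond_law M S X T Y K" and h: "h \<in> borel_measurable S" and B: "B \<in> sets T"
  shows "(\<integral>\<^sup>+w. h (X w) * indicator B (Y w) \<partial>M) = (\<integral>\<^sup>+w. h (X w) * emeasure (K (X w)) B \<partial>M)"
proof -
  note [measurable] = h B
  note K = is_cond_law_kernel[OF c]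
  have "(\<integral>\<^sup>+w. h (X w) * indicator B (Y w) \<partial>M) =
    (\<integral>\<^sup>+w. \<integral>\<^sup>+b. h (X w) * indicator B b \<partial>K (X w) \<partial>M)"
    using is_cond_law_nn_integral[OF M X Y c, of "\<lambda>(a, b). h a * indicator B b"] by simp
  also have "\<dots> = (\<integral>\<^sup>+w. h (X w) * emeasure (K (X w)) B \<partial>M)"
  proof (rule nn_integral_cong)
    fix w assume "w \<in> space M"
    then have w: "X w \<in> space S" using X by (rule measurable_space[rotated])
    then have "B \<in> sets (K (X w))" using B kernel_at[OF K] by simp
    then show "(\<integral>\<^sup>+b. h (X w) * indicator B b \<partial>K (X w)) = h (X w) * emeasure (K (X w)) B"
      by (subst nn_integral_cmult) auto
  qed
  finally show ?thesis .
qed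

lemma Int_stable_times:
  assumes "Int_stable E" "Int_stable G"
  shows "Int_stable {a \<times> b | a b. a \<in> E \<and> b \<in> G}"
proof (rule Int_stableI)
  fix P Q assume "P \<in> {a \<times> b | a b. a \<in> E \<and> b \<in> G}" "Q \<in> {a \<times> b | a b. a \<in> E \<and> b \<in> G}"
  then obtain a b c d where PQ: "P = a \<times> b" "Q = c \<times> d" and *: "a \<in> E" "b \<in> G" "c \<in> E" "d \<in> G" by auto
  then have "P \<inter> Q = (a \<inter> c) \<times> (b \<inter> d)" by auto
  with * show "P \<inter> Q \<in> {a \<times> b | a b. a \<in> E \<and> b \<in> G}"
    using assms unfolding Int_stable_def by blast
qed

text \<open>
  Rectangles over two generators that are stable under intersection form such a generator of the product, so the
  defining identity need only be tested there. The freedom in the generators matters when \<open>S\<close> or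
  \<open>T\<close> is itself a product (take rectangles) or the real line (take half-lines).
\<close>

lemma is_cond_lawI:
  assumes M: "prob_space M" and X: "X \<in> M \<rightarrow>\<^sub>M S" and Y: "Y \<in> M \<rightarrow>\<^sub>M T"
    and K: "K \<in> S \<rightarrow>\<^sub>M prob_algebra T"
    and E: "Int_stable E" "E \<subseteq> Pow (space S)" "space S \<in> E" "sets S = sigma_sets (space S) E"
    and G: "Int_stable G" "G \<subseteq> Pow (space T)" "space T \<in> G" "sets T = sigma_sets (space T) G"
    and eq: "\<And>A B. A \<in> E \<Longrightarrow> B \<in> G \<Longrightarrow>
      (\<integral>\<^sup>+w. indicator A (X w) * indicator B (Y w) \<partial>M)
        = (\<integral>\<^sup>+w. indicator A (X w) * emeasure (K (X w)) B \<partial>M)"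
  shows "is_cond_law M S X T Y K"
  unfolding is_cond_law_def
proof (intro conjI K)
  note [measurable] = X Y K
  interpret M: prob_space M by fact
  let ?L = "distr M (S \<Otimes>\<^sub>M T) (\<lambda>w. (X w, Y w))"
  let ?k = "\<lambda>a. distr (K a) (S \<Otimes>\<^sub>M T) (\<lambda>b. (a, b))"
  let ?R = "distr M S X \<bind> ?k"
  have L: "prob_space ?L" by (rule M.prob_space_distr) simp
  have k: "?k \<in> S \<rightarrow>\<^sub>M prob_algebra (S \<Otimes>\<^sub>M T)" by (rule measurable_pair_kernel[OF K])
  have dX: "distr M S X \<in> space (prob_algebra S)"
    by (simp add: space_prob_algebra M.prob_space_distr)
  let ?P = "{a \<times> b | a b. a \<in> E \<and> b \<in> G}"
  have PP: "sets (S \<Otimes>\<^sub>M T) = sigma_sets (space S \<times> space T) ?P"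
    using E(2) G(2) by (subst sets_pair_eq[of E S "{space S}" G T "{space T}"]) (auto simp: E(3,4) G(3,4) intro!: sets_measure_of)
  show "?L = ?R"
  proof (rule measure_eqI_generator_eq_countable[where E="?P" and \<Omega>="space S \<times> space T" and A="{space S \<times> space T}"])
    show "Int_stable ?P"
      using E(1) G(1) by (rule Int_stable_times)
    show "?P \<subseteq> Pow (space S \<times> space T)" using E(2) G(2) by auto
    show "sets ?L = sigma_sets (space S \<times> space T) ?P" using PP by simp
    show "sets ?R = sigma_sets (space S \<times> space T) ?P" using sets_bind'[OF dX k] PP by simp
    show "{space S \<times> space T} \<subseteq> ?P" using E(3) G(3) by auto
    show "emeasure ?L a \<noteq> \<infinity>" for a using finite_measure.emeasure_finite[OF prob_space.finite_measure[OF L]] by simp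
    fix Z assume "Z \<in> ?P"
    then obtain A B where Z: "Z = A \<times> B" and AB: "A \<in> E" "B \<in> G" by auto
    have [measurable]: "A \<in> sets S" "B \<in> sets T" using AB E(4) G(4) by auto
    have [measurable]: "(\<lambda>a. emeasure (K a) B) \<in> borel_measurable S"
      by (rule kernel_emeasure_measurable[OF K]) simp
    have "emeasure ?L Z = (\<integral>\<^sup>+z. indicator Z z \<partial>?L)" using Z by simp
    also have "\<dots> = (\<integral>\<^sup>+w. indicator A (X w) * indicator B (Y w) \<partial>M)"
      unfolding Z by (subst nn_integral_distr) (auto simp: indicator_times)
    also have "\<dots> = (\<integral>\<^sup>+w. indicator A (X w) * emeasure (K (X w)) B \<partial>M)"
      by (rule eq[OF AB])
    also have "\<dots> = (\<integral>\<^sup>+a. indicator A a * emeasure (K a) B \<partial>distr M S X)"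
      by (subst nn_integral_distr) auto
    also have "\<dots> = (\<integral>\<^sup>+a. emeasure (?k a) Z \<partial>distr M S X)"
    proof (rule nn_integral_cong)
      fix a assume "a \<in> space (distr M S X)"
      then have a: "a \<in> space S" by simp
      have "Pair a \<in> K a \<rightarrow>\<^sub>M S \<Otimes>\<^sub>M T"
        using a by (simp add: measurable_cong_sets[OF kernel_at(2)[OF K a] refl])
      then have "emeasure (?k a) Z = emeasure (K a) (Pair a -` Z \<inter> space (K a))"
        unfolding Z by (subst emeasure_distr) auto
      also have "Pair a -` Z \<inter> space (K a) = (if a \<in> A then B else {})"
        unfolding Z kernel_at(3)[OF K a] using sets.sets_into_space[OF \<open>B \<in> sets T\<close>] by auto
      finally show "indicator A a * emeasure (K a) B = emeasure (?k a) Z" by simp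
    qed
    also have "\<dots> = emeasure ?R Z"
      using Z by (subst emeasure_bind_prob_algebra[OF dX k]) auto
    finally show "emeasure ?L Z = emeasure ?R Z" .
  qed auto
qed


lemma sets_generator:
  "Int_stable (sets S)" "sets S \<subseteq> Pow (space S)" "space S \<in> sets S" "sets S = sigma_sets (space S) (sets S)"
  using sets.sigma_sets_eq[of S] sets.space_closed[of S] by (auto simp: sets.Int_stable)

lemma rectangle_generator:
  defines "E S T \<equiv> {a \<times> b | a b. a \<in> sets S \<and> b \<in> sets T}"
  shows "Int_stable (E S T)" "E S T \<subseteq> Pow (space (S \<Otimes>\<^sub>M T))" "space (S \<Otimes>\<^sub>M T) \<in> E S T"
    "sets (S \<Otimes>\<^sub>M T) = sigma_sets (space (S \<Otimes>\<^sub>M T)) (E S T)"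
  unfolding E_def
  by (rule Int_stable_pair_measure_generator)
     (auto dest: sets.sets_into_space simp: space_pair_measure sets_pair_measure)

lemma is_cond_lawI_sets:
  assumes "prob_space M" "X \<in> M \<rightarrow>\<^sub>M S" "Y \<in> M \<rightarrow>\<^sub>M T" "K \<in> S \<rightarrow>\<^sub>M prob_algebra T"
    and "\<And>A B. A \<in> sets S \<Longrightarrow> B \<in> sets T \<Longrightarrow>
      (\<integral>\<^sup>+w. indicator A (X w) * indicator B (Y w) \<partial>M)
        = (\<integral>\<^sup>+w. indicator A (X w) * emeasure (K (X w)) B \<partial>M)"
  shows "is_cond_law M S X T Y K"
  by (rule is_cond_lawI[OF assms(1-4) sets_generator sets_generator assms(5)])

text \<open>
  The tower property in the case where the kernel only depends on the coarser information \<open>f (X w)\<close>.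
\<close>

lemma is_cond_law_coarsen:
  assumes M: "prob_space M" and X: "X \<in> M \<rightarrow>\<^sub>M S" and Y: "Y \<in> M \<rightarrow>\<^sub>M T"
    and f: "f \<in> S \<rightarrow>\<^sub>M S'" and K: "K \<in> S' \<rightarrow>\<^sub>M prob_algebra T"
    and c: "is_cond_law M S X T Y (\<lambda>a. K (f a))"
  shows "is_cond_law M S' (\<lambda>w. f (X w)) T Y K"
proof (rule is_cond_lawI_sets[OF M _ Y K])
  note [measurable] = X f
  show "(\<lambda>w. f (X w)) \<in> M \<rightarrow>\<^sub>M S'" by simp
  fix A B assume [measurable]: "A \<in> sets S'" and B: "B \<in> sets T"
  have "(\<lambda>a. indicator A (f a) :: ennreal) \<in> borel_measurable S" by measurable
  from is_cond_law_emeasure[OF M X Y c this B]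
  show "(\<integral>\<^sup>+w. indicator A (f (X w)) * indicator B (Y w) \<partial>M)
    = (\<integral>\<^sup>+w. indicator A (f (X w)) * emeasure (K (f (X w))) B \<partial>M)" .
qed

lemma is_cond_law_push:
  assumes M: "prob_space M" and X: "X \<in> M \<rightarrow>\<^sub>M S" and Y: "Y \<in> M \<rightarrow>\<^sub>M T"
    and g: "g \<in> T \<rightarrow>\<^sub>M T'" and c: "is_cond_law M S X T Y K"
  shows "is_cond_law M S X T' (\<lambda>w. g (Y w)) (\<lambda>a. distr (K a) T' g)"
proof (rule is_cond_lawI_sets[OF M X])
  note [measurable] = Y g
  note K[measurable] = is_cond_law_kernel[OF c]
  show "(\<lambda>w. g (Y w)) \<in> M \<rightarrow>\<^sub>M T'" by simp
  show "(\<lambda>a. distr (K a) T' g) \<in> S \<rightarrow>\<^sub>M prob_algebra T'" by measurable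
  fix A B assume A: "A \<in> sets S" and [measurable]: "B \<in> sets T'"
  have "(\<integral>\<^sup>+w. indicator A (X w) * indicator B (g (Y w)) \<partial>M) =
     (\<integral>\<^sup>+w. indicator A (X w) * indicator (g -` B \<inter> space T) (Y w) \<partial>M)"
    using measurable_space[OF Y] by (intro nn_integral_cong) (auto simp: indicator_def)
  also have "\<dots> = (\<integral>\<^sup>+w. indicator A (X w) * emeasure (K (X w)) (g -` B \<inter> space T) \<partial>M)"
    using A by (intro is_cond_law_emeasure[OF M X Y c]) auto
  also have "\<dots> = (\<integral>\<^sup>+w. indicator A (X w) * emeasure (distr (K (X w)) T' g) B \<partial>M)"
  proof (rule nn_integral_cong)
    fix w assume "w \<in> space M"
    then have w: "X w \<in> space S" using X by (rule measurable_space[rotated])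
    have "g \<in> K (X w) \<rightarrow>\<^sub>M T'" using g by (simp add: measurable_cong_sets[OF kernel_at(2)[OF K w] refl])
    then show "indicator A (X w) * emeasure (K (X w)) (g -` B \<inter> space T) =
      indicator A (X w) * emeasure (distr (K (X w)) T' g) B"
      by (simp add: emeasure_distr kernel_at(3)[OF K w])
  qed
  finally show "(\<integral>\<^sup>+w. indicator A (X w) * indicator B (g (Y w)) \<partial>M) =
    (\<integral>\<^sup>+w. indicator A (X w) * emeasure (distr (K (X w)) T' g) B \<partial>M)" .
qed

lemma is_cond_law_distr:
  assumes f: "f \<in> M \<rightarrow>\<^sub>M M'" and X: "X \<in> M' \<rightarrow>\<^sub>M S" and Y: "Y \<in> M' \<rightarrow>\<^sub>M T"
  shows "is_cond_law (distr M M' f) S X T Y K \<longleftrightarrow> is_cond_law M S (\<lambda>w. X (f w)) T (\<lambda>w. Y (f w)) K"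
  using assms by (simp add: is_cond_law_def distr_distr comp_def)

text \<open>
  Symmetry of conditional independence. That the law of \<open>Y\<close> given \<open>(X, Z)\<close> depends on \<open>X\<close> alone means
  that \<open>Y\<close> and \<open>Z\<close> are independent given \<open>X\<close>, and then the law of \<open>Z\<close> given \<open>(X, Y)\<close> depends
  on \<open>X\<close> alone as well: both integrate \<open>A \<times> B \<times> C\<close> to the mean of
  \<open>1\<^sub>A(X) n(X, B) k(X, C)\<close>.
\<close>

lemma is_cond_law_exchange:
  assumes M: "prob_space M" and X: "X \<in> M \<rightarrow>\<^sub>M S" and Y: "Y \<in> M \<rightarrow>\<^sub>M T" and Z: "Z \<in> M \<rightarrow>\<^sub>M U"
    and k: "is_cond_law M S X U Z k"
    and n: "n \<in> S \<rightarrow>\<^sub>M prob_algebra T"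
    and XZ: "is_cond_law M (S \<Otimes>\<^sub>M U) (\<lambda>w. (X w, Z w)) T Y (\<lambda>(a, c). n a)"
  shows "is_cond_law M (S \<Otimes>\<^sub>M T) (\<lambda>w. (X w, Y w)) U Z (\<lambda>(a, b). k a)"
proof (rule is_cond_lawI[OF M _ Z _ rectangle_generator sets_generator])
  note [measurable] = X Y Z n
  note K[measurable] = is_cond_law_kernel[OF k]
  let ?E = "{a \<times> b | a b. a \<in> sets S \<and> b \<in> sets T}"
  show "(\<lambda>w. (X w, Y w)) \<in> M \<rightarrow>\<^sub>M S \<Otimes>\<^sub>M T" by simp
  show "(\<lambda>(a, b). k a) \<in> S \<Otimes>\<^sub>M T \<rightarrow>\<^sub>M prob_algebra U" by measurable
  fix R C assume "R \<in> ?E" and C[measurable]: "C \<in> sets U"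
  then obtain A B where R: "R = A \<times> B" and A[measurable]: "A \<in> sets S" and B[measurable]: "B \<in> sets T" by auto
  have [measurable]: "(\<lambda>a. emeasure (n a) B) \<in> borel_measurable S" "(\<lambda>a. emeasure (k a) C) \<in> borel_measurable S"
    by (rule kernel_emeasure_measurable[OF n B], rule kernel_emeasure_measurable[OF K C])
  have XZm: "(\<lambda>w. (X w, Z w)) \<in> M \<rightarrow>\<^sub>M S \<Otimes>\<^sub>M U" by simp
  have "(\<integral>\<^sup>+w. indicator R (X w, Y w) * indicator C (Z w) \<partial>M) =
     (\<integral>\<^sup>+w. (\<lambda>(a, c). indicator A a * indicator C c) (X w, Z w) * indicator B (Y w) \<partial>M)"
    by (simp add: R indicator_times mult_ac)
  also have "\<dots> = (\<integral>\<^sup>+w. (\<lambda>(a, c). indicator A a * indicator C c) (X w, Z w) * emeasure (n (X w)) B \<partial>M)"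
    by (subst is_cond_law_emeasure[OF M XZm Y XZ _ B]) (simp_all add: split_beta')
  also have "\<dots> = (\<integral>\<^sup>+w. (\<lambda>a. indicator A a * emeasure (n a) B) (X w) * indicator C (Z w) \<partial>M)"
    by (simp add: mult_ac)
  also have "\<dots> = (\<integral>\<^sup>+w. (\<lambda>a. indicator A a * emeasure (n a) B) (X w) * emeasure (k (X w)) C \<partial>M)"
    by (rule is_cond_law_emeasure[OF M X Z k _ C]) simp
  also have "\<dots> = (\<integral>\<^sup>+w. (\<lambda>(a, c). indicator A a * emeasure (k a) C) (X w, Z w) * emeasure (n (X w)) B \<partial>M)"
    by (simp add: mult_ac)
  also have "\<dots> = (\<integral>\<^sup>+w. (\<lambda>(a, c). indicator A a * emeasure (k a) C) (X w, Z w) * indicator B (Y w) \<partial>M)"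
    by (subst is_cond_law_emeasure[OF M XZm Y XZ _ B]) (simp_all add: split_beta')
  also have "\<dots> = (\<integral>\<^sup>+w. indicator R (X w, Y w) * emeasure ((\<lambda>(a, b). k a) (X w, Y w)) C \<partial>M)"
    by (simp add: R indicator_times mult_ac)
  finally show "(\<integral>\<^sup>+w. indicator R (X w, Y w) * indicator C (Z w) \<partial>M) =
    (\<integral>\<^sup>+w. indicator R (X w, Y w) * emeasure ((\<lambda>(a, b). k a) (X w, Y w)) C \<partial>M)" .
qed

text \<open>
  Composition of a law of \<open>Y\<close> given \<open>X\<close> with a law of \<open>Z\<close> given \<open>(X, Y)\<close>. It serves both to build conditional
  laws on products and to compare an iterated conditioning with a single one.
\<close>

lemma is_cond_law_chain:
  assumes M: "prob_space M" and X: "X \<in> M \<rightarrow>\<^sub>M S" and Y: "Y \<in> M \<rightarrow>\<^sub>M T" and Z: "Z \<in> M \<rightarrow>\<^sub>M U"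
    and k: "is_cond_law M S X T Y K"
    and l: "is_cond_law M (S \<Otimes>\<^sub>M T) (\<lambda>w. (X w, Y w)) U Z L"
  shows "is_cond_law M S X (T \<Otimes>\<^sub>M U) (\<lambda>w. (Y w, Z w))
    (\<lambda>a. K a \<bind> (\<lambda>b. distr (L (a, b)) (T \<Otimes>\<^sub>M U) (\<lambda>c. (b, c))))"
proof (rule is_cond_lawI[OF M X _ _ sets_generator rectangle_generator])
  note [measurable] = X Y Z
  note K[measurable] = is_cond_law_kernel[OF k]
  note L[measurable] = is_cond_law_kernel[OF l]
  let ?E = "{a \<times> b | a b. a \<in> sets T \<and> b \<in> sets U}"
  let ?k = "\<lambda>a. K a \<bind> (\<lambda>b. distr (L (a, b)) (T \<Otimes>\<^sub>M U) (\<lambda>c. (b, c)))"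
  show "(\<lambda>w. (Y w, Z w)) \<in> M \<rightarrow>\<^sub>M T \<Otimes>\<^sub>M U" by simp
  show "?k \<in> S \<rightarrow>\<^sub>M prob_algebra (T \<Otimes>\<^sub>M U)" by measurable
  fix A R assume A[measurable]: "A \<in> sets S" and "R \<in> ?E"
  then obtain B C where R: "R = B \<times> C" and B[measurable]: "B \<in> sets T" and C[measurable]: "C \<in> sets U" by auto
  have [measurable]: "(\<lambda>z. emeasure (L z) C) \<in> borel_measurable (S \<Otimes>\<^sub>M T)"
    by (rule kernel_emeasure_measurable[OF L C])
  have XYm: "(\<lambda>w. (X w, Y w)) \<in> M \<rightarrow>\<^sub>M S \<Otimes>\<^sub>M T" by simp
  have "(\<integral>\<^sup>+w. indicator A (X w) * indicator R (Y w, Z w) \<partial>M) =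
     (\<integral>\<^sup>+w. (\<lambda>(a, b). indicator A a * indicator B b) (X w, Y w) * indicator C (Z w) \<partial>M)"
    by (simp add: R indicator_times mult_ac)
  also have "\<dots> = (\<integral>\<^sup>+w. (\<lambda>(a, b). indicator A a * indicator B b) (X w, Y w) * emeasure (L (X w, Y w)) C \<partial>M)"
    by (rule is_cond_law_emeasure[OF M XYm Z l _ C]) (simp_all add: split_beta')
  also have "\<dots> = (\<integral>\<^sup>+w. \<integral>\<^sup>+b. (\<lambda>(a, b). indicator A a * indicator B b * emeasure (L (a, b)) C) (X w, b) \<partial>K (X w) \<partial>M)"
    by (subst is_cond_law_nn_integral[OF M X Y k, symmetric]) (simp_all add: split_beta')
  also have "\<dots> = (\<integral>\<^sup>+w. indicator A (X w) * emeasure (?k (X w)) R \<partial>M)"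
  proof (rule nn_integral_cong)
    fix w assume "w \<in> space M"
    then have w: "X w \<in> space S" using X by (rule measurable_space[rotated])
    have Lw: "(\<lambda>b. L (X w, b)) \<in> T \<rightarrow>\<^sub>M prob_algebra U" using w by simp
    have lb: "(\<lambda>b. distr (L (X w, b)) (T \<Otimes>\<^sub>M U) (\<lambda>c. (b, c))) \<in> T \<rightarrow>\<^sub>M prob_algebra (T \<Otimes>\<^sub>M U)"
      by (rule measurable_pair_kernel[OF Lw])
    have "emeasure (?k (X w)) R = (\<integral>\<^sup>+b. emeasure (distr (L (X w, b)) (T \<Otimes>\<^sub>M U) (\<lambda>c. (b, c))) R \<partial>K (X w))"
      by (rule emeasure_bind_prob_algebra[OF measurable_space[OF K w] lb]) (simp add: R)
    also have "\<dots> = (\<integral>\<^sup>+b. indicator B b * emeasure (L (X w, b)) C \<partial>K (X w))"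
    proof (rule nn_integral_cong)
      fix b assume "b \<in> space (K (X w))"
      then have b: "b \<in> space T" by (simp add: kernel_at(3)[OF K w])
      have "Pair b \<in> L (X w, b) \<rightarrow>\<^sub>M T \<Otimes>\<^sub>M U"
        using b by (simp add: measurable_cong_sets[OF kernel_at(2)[OF Lw b] refl])
      moreover have "Pair b -` R \<inter> space (L (X w, b)) = (if b \<in> B then C else {})"
        unfolding R kernel_at(3)[OF Lw b] using sets.sets_into_space[OF C] by auto
      ultimately show "emeasure (distr (L (X w, b)) (T \<Otimes>\<^sub>M U) (\<lambda>c. (b, c))) R = indicator B b * emeasure (L (X w, b)) C"
        by (subst emeasure_distr) (auto simp: R)
    qed
    finally show "(\<integral>\<^sup>+b. (\<lambda>(a, b). indicator A a * indicator B b * emeasure (L (a, b)) C) (X w, b) \<partial>K (X w))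
      = indicator A (X w) * emeasure (?k (X w)) R"
      by (auto simp: indicator_def)
  qed
  finally show "(\<integral>\<^sup>+w. indicator A (X w) * indicator R (Y w, Z w) \<partial>M) =
    (\<integral>\<^sup>+w. indicator A (X w) * emeasure (?k (X w)) R \<partial>M)" .
qed

section \<open>Uniqueness of conditional laws\<close>

text \<open>
  Countability turns ``for each set of the generator, almost everywhere'' into ``almost
  everywhere, for each set of the generator'', and stability under intersection makes probability measures that agree on
  the generator equal. Together they give uniqueness of kernels.
\<close>

definition countably_generated :: "'a measure \<Rightarrow> bool" where
  "countably_generated T \<longleftrightarrow> (\<exists>E. countable E \<and> Int_stable E \<and> E \<subseteq> Pow (space T) \<and> space T \<in> E \<and>
     sets T = sigma_sets (space T) E)"

lemma is_cond_law_unique: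
  assumes M: "prob_space M" and X: "X \<in> M \<rightarrow>\<^sub>M S" and Y: "Y \<in> M \<rightarrow>\<^sub>M T"
    and T: "countably_generated T"
    and c: "is_cond_law M S X T Y K" and c': "is_cond_law M S X T Y K'"
  shows "AE a in distr M S X. K a = K' a"
proof -
  note [measurable] = X Y
  interpret M: prob_space M by fact
  interpret D: prob_space "distr M S X" by (rule M.prob_space_distr) simp
  note K = is_cond_law_kernel[OF c] and K' = is_cond_law_kernel[OF c']
  obtain E where E: "countable E" "Int_stable E" "E \<subseteq> Pow (space T)" "space T \<in> E"
    "sets T = sigma_sets (space T) E"
    using T by (auto simp: countably_generated_def)
  have "AE a in distr M S X. emeasure (K a) B = emeasure (K' a) B" if "B \<in> E" for B
  proof (rule D.density_unique_finite_measure)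
    have B: "B \<in> sets T" using that E(5) by auto
    have m: "(\<lambda>a. emeasure (K a) B) \<in> borel_measurable S" "(\<lambda>a. emeasure (K' a) B) \<in> borel_measurable S"
      by (rule kernel_emeasure_measurable[OF K B], rule kernel_emeasure_measurable[OF K' B])
    note [measurable] = m
    show "(\<lambda>a. emeasure (K a) B) \<in> borel_measurable (distr M S X)"
      "(\<lambda>a. emeasure (K' a) B) \<in> borel_measurable (distr M S X)" by simp_all
    fix A assume "A \<in> sets (distr M S X)"
    then have A[measurable]: "A \<in> sets S" by simp
    have i: "(indicator A :: _ \<Rightarrow> ennreal) \<in> borel_measurable S" by simp
    show "(\<integral>\<^sup>+x. emeasure (K x) B * indicator A x \<partial>distr M S X) = (\<integral>\<^sup>+x. emeasure (K' x) B * indicator A x \<partial>distr M S X)"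
      using is_cond_law_emeasure[OF M X Y c i B] is_cond_law_emeasure[OF M X Y c' i B]
      by (simp add: nn_integral_distr mult.commute)
  qed auto
  then have "AE a in distr M S X. \<forall>B\<in>E. emeasure (K a) B = emeasure (K' a) B"
    using E(1) by (simp add: AE_ball_countable)
  moreover have "AE a in distr M S X. a \<in> space S" using AE_space[of "distr M S X"] by simp
  ultimately show ?thesis
  proof eventually_elim
    case (elim a)
    note ka = kernel_at[OF K elim(2)] kernel_at[OF K' elim(2)]
    show ?case
    proof (rule measure_eqI_generator_eq_countable[OF E(2,3), where A="{space T}"])
      show "emeasure (K a) b \<noteq> \<infinity>" for b
        using finite_measure.emeasure_finite[OF prob_space.finite_measure[OF ka(1)]] by simp
    qed (use elim(1) ka E in auto)
  qed
qed

lemma is_cond_law_AE_cong: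
  assumes M: "prob_space M" and X: "X \<in> M \<rightarrow>\<^sub>M S" and Y: "Y \<in> M \<rightarrow>\<^sub>M T"
    and c: "is_cond_law M S X T Y K" and K': "K' \<in> S \<rightarrow>\<^sub>M prob_algebra T"
    and ae: "AE w in M. K (X w) = K' (X w)"
  shows "is_cond_law M S X T Y K'"
proof (rule is_cond_lawI_sets[OF M X Y K'])
  fix A B assume [measurable]: "A \<in> sets S" and B: "B \<in> sets T"
  have i: "(indicator A :: _ \<Rightarrow> ennreal) \<in> borel_measurable S" by simp
  have "(\<integral>\<^sup>+w. indicator A (X w) * indicator B (Y w) \<partial>M) = (\<integral>\<^sup>+w. indicator A (X w) * emeasure (K (X w)) B \<partial>M)"
    by (rule is_cond_law_emeasure[OF M X Y c i B])
  also have "\<dots> = (\<integral>\<^sup>+w. indicator A (X w) * emeasure (K' (X w)) B \<partial>M)"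
    using ae by (intro nn_integral_cong_AE) auto
  finally show "(\<integral>\<^sup>+w. indicator A (X w) * indicator B (Y w) \<partial>M) = (\<integral>\<^sup>+w. indicator A (X w) * emeasure (K' (X w)) B \<partial>M)" .
qed

text \<open>
  Conditioning first on \<open>X\<close> and then, under the resulting law, on \<open>V\<close> is the same as
  conditioning on the pair. Both sides provide a conditional law of \<open>(V, g)\<close> given \<open>X\<close>, one
  by pushing \<open>K\<close> forward and one by composition with \<open>L\<close>, so uniqueness applies.
\<close>

lemma AE_is_cond_law_conditioned:
  assumes M: "prob_space M" and X: "X \<in> M \<rightarrow>\<^sub>M S" and Y: "Y \<in> M \<rightarrow>\<^sub>M T"
    and V: "V \<in> T \<rightarrow>\<^sub>M W" and g: "g \<in> T \<rightarrow>\<^sub>M U" and cg: "countably_generated (W \<Otimes>\<^sub>M U)"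
    and k: "is_cond_law M S X T Y K"
    and l: "is_cond_law M (S \<Otimes>\<^sub>M W) (\<lambda>w. (X w, V (Y w))) U (\<lambda>w. g (Y w)) L"
  shows "AE a in distr M S X. is_cond_law (K a) W V U g (\<lambda>v. L (a, v))"
proof -
  note [measurable] = X Y V g
  have VY: "(\<lambda>w. V (Y w)) \<in> M \<rightarrow>\<^sub>M W" and gY: "(\<lambda>w. g (Y w)) \<in> M \<rightarrow>\<^sub>M U" by simp_all
  have Vg: "(\<lambda>t. (V t, g t)) \<in> T \<rightarrow>\<^sub>M W \<Otimes>\<^sub>M U" and VgY: "(\<lambda>w. (V (Y w), g (Y w))) \<in> M \<rightarrow>\<^sub>M W \<Otimes>\<^sub>M U" by simp_all
  have "AE a in distr M S X. distr (K a) (W \<Otimes>\<^sub>M U) (\<lambda>t. (V t, g t)) =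
     distr (K a) W V \<bind> (\<lambda>b. distr (L (a, b)) (W \<Otimes>\<^sub>M U) (\<lambda>c. (b, c)))"
    using is_cond_law_unique[OF M X VgY cg is_cond_law_push[OF M X Y Vg k]
        is_cond_law_chain[OF M X VY gY is_cond_law_push[OF M X Y V k] l]] by simp
  moreover have "AE a in distr M S X. a \<in> space S" using AE_space[of "distr M S X"] by simp
  ultimately show ?thesis
  proof eventually_elim
    case (elim a)
    have "(\<lambda>v. L (a, v)) \<in> W \<rightarrow>\<^sub>M prob_algebra U"
      using is_cond_law_kernel[OF l] elim(2) by measurable
    with elim(1) show ?case by (simp add: is_cond_law_def)
  qed
qed

section \<open>Countably generated spaces\<close>

lemma countably_generated_borel_real: "countably_generated (borel :: real measure)"
  unfolding countably_generated_def
proof (intro exI[of _ "insert UNIV (range (\<lambda>q. {..real_of_rat q}))"] conjI)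
  let ?E = "insert UNIV (range (\<lambda>q. {..real_of_rat q}))"
  show "Int_stable ?E"
  proof (rule Int_stableI)
    fix A B assume "A \<in> ?E" "B \<in> ?E"
    moreover have "{..real_of_rat q} \<inter> {..real_of_rat r} = {..real_of_rat (min q r)}" for q r
      by (auto simp: min_def of_rat_less_eq intro: order_trans)
    ultimately show "A \<inter> B \<in> ?E" by auto
  qed
  show "sets borel = sigma_sets (space borel) ?E"
  proof (rule antisym)
    have "range lessThan \<subseteq> sigma_sets (UNIV :: real set) ?E"
    proof safe
      fix a :: real
      interpret sigma_algebra "UNIV :: real set" "sigma_sets UNIV ?E"
        by (rule sigma_algebra_sigma_sets) simp
      have "{..<a} = (\<Union>q\<in>{q. real_of_rat q < a}. {..real_of_rat q})"
        by (auto dest: of_rat_dense) (metis of_rat_dense less_imp_le)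
      also have "\<dots> \<in> sigma_sets UNIV ?E"
        by (intro countable_UN'') auto
      finally show "{..<a} \<in> sigma_sets UNIV ?E" .
    qed
    then have "sigma_sets UNIV (range lessThan) \<subseteq> sigma_sets (UNIV :: real set) ?E"
      by (rule sigma_sets_mono)
    then show "sets (borel :: real measure) \<subseteq> sigma_sets (space borel) ?E"
      by (subst borel_Iio) (simp add: sets_measure_of)
    show "sigma_sets (space borel) ?E \<subseteq> sets (borel :: real measure)"
      using sets.sigma_sets_subset[of ?E "borel :: real measure"] by (simp add: image_subset_iff)
  qed
qed auto

lemma countably_generated_pair:
  assumes "countably_generated S" "countably_generated T"
  shows "countably_generated (S \<Otimes>\<^sub>M T)"
proof -
  obtain E where E: "countable E" "Int_stable E" "E \<subseteq> Pow (space S)" "space S \<in> E"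
    "sets S = sigma_sets (space S) E"
    using assms by (auto simp: countably_generated_def)
  obtain G where G: "countable G" "Int_stable G" "G \<subseteq> Pow (space T)" "space T \<in> G"
    "sets T = sigma_sets (space T) G"
    using assms by (auto simp: countably_generated_def)
  let ?P = "{a \<times> b | a b. a \<in> E \<and> b \<in> G}"
  have P: "?P = (\<lambda>(a, b). a \<times> b) ` (E \<times> G)" by auto
  have PP: "?P \<subseteq> Pow (space S \<times> space T)" using E(3) G(3) by auto
  have "sets (S \<Otimes>\<^sub>M T) = sigma_sets (space S \<times> space T) ?P"
    using PP by (subst sets_pair_eq[of E S "{space S}" G T "{space T}"]) (auto simp: E(3,4,5) G(3,4,5) intro!: sets_measure_of)
  moreover have "countable ?P" unfolding P using E(1) G(1) by auto
  moreover have "space S \<times> space T \<in> ?P" using E(4) G(4) by auto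
  ultimately show ?thesis
    unfolding countably_generated_def space_pair_measure
    using Int_stable_times[OF E(2) G(2)] PP by blast
qed

lemma PiE_generators_Pow:
  assumes "\<And>i. i \<in> I \<Longrightarrow> E i \<subseteq> Pow (\<Omega> i)"
  shows "{Pi\<^sub>E I F | F. \<forall>i\<in>I. F i \<in> E i} \<subseteq> Pow (Pi\<^sub>E I \<Omega>)"
proof
  fix A assume "A \<in> {Pi\<^sub>E I F | F. \<forall>i\<in>I. F i \<in> E i}"
  then obtain F where A: "A = Pi\<^sub>E I F" and F: "\<And>i. i \<in> I \<Longrightarrow> F i \<in> E i" by auto
  have "F i \<subseteq> \<Omega> i" if "i \<in> I" for i using F[OF that] assms[OF that] by auto
  then show "A \<in> Pow (Pi\<^sub>E I \<Omega>)" unfolding A by (simp add: PiE_mono)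
qed

lemma sets_PiM_generated:
  assumes I: "finite I" and E: "\<And>i. i \<in> I \<Longrightarrow> E i \<subseteq> Pow (space (M i))"
    "\<And>i. i \<in> I \<Longrightarrow> space (M i) \<in> E i" "\<And>i. i \<in> I \<Longrightarrow> sets (M i) = sigma_sets (space (M i)) (E i)"
  shows "sets (Pi\<^sub>M I M) = sigma_sets (space (Pi\<^sub>M I M)) {Pi\<^sub>E I F | F. \<forall>i\<in>I. F i \<in> E i}"
proof -
  let ?P = "{{f\<in>(\<Pi>\<^sub>E i\<in>I. space (M i)). \<forall>i\<in>j. f i \<in> A i} | A j. j \<in> {I} \<and> A \<in> Pi j E}"
  have "sets (Pi\<^sub>M I M) = sets (\<Pi>\<^sub>M i\<in>I. sigma (space (M i)) (E i))"
    using E by (intro sets_PiM_cong) auto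
  also have "\<dots> = sets (sigma (\<Pi>\<^sub>E i\<in>I. space (M i)) ?P)"
  proof (rule sets_PiM_sigma)
    show "\<exists>S\<subseteq>E i. countable S \<and> space (M i) = \<Union>S" if "i \<in> I" for i
      using E(2)[OF that] by (intro exI[of _ "{space (M i)}"]) auto
  qed (use I E in auto)
  also have "?P = {Pi\<^sub>E I F | F. \<forall>i\<in>I. F i \<in> E i}"
  proof -
    have "{f\<in>(\<Pi>\<^sub>E i\<in>I. space (M i)). \<forall>i\<in>I. f i \<in> A i} = Pi\<^sub>E I A" if "A \<in> Pi I E" for A
    proof -
      have "A i \<subseteq> space (M i)" if "i \<in> I" for i
        using \<open>A \<in> Pi I E\<close> E(1) that by blast
      then show ?thesis by (auto simp: PiE_def Pi_def)
    qed
    then have "{{f\<in>(\<Pi>\<^sub>E i\<in>I. space (M i)). \<forall>i\<in>I. f i \<in> A i} | A. A \<in> Pi I E} = {Pi\<^sub>E I F | F. F \<in> Pi I E}"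
      by (intro Collect_cong ex_cong1) (auto simp only: singleton_iff)
    then show ?thesis by (simp add: Pi_iff)
  qed
  also have "sets (sigma (\<Pi>\<^sub>E i\<in>I. space (M i)) {Pi\<^sub>E I F | F. \<forall>i\<in>I. F i \<in> E i}) =
     sigma_sets (space (Pi\<^sub>M I M)) {Pi\<^sub>E I F | F. \<forall>i\<in>I. F i \<in> E i}"
    unfolding space_PiM by (intro sets_measure_of PiE_generators_Pow E(1))
  finally show ?thesis .
qed

lemma Int_stable_PiE:
  assumes "\<And>i. i \<in> I \<Longrightarrow> Int_stable (E i)"
  shows "Int_stable {Pi\<^sub>E I F | F. \<forall>i\<in>I. F i \<in> E i}"
proof (rule Int_stableI)
  let ?P = "{Pi\<^sub>E I F | F. \<forall>i\<in>I. F i \<in> E i}"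
  fix A B assume "A \<in> ?P" "B \<in> ?P"
  then obtain F G where AB: "A = Pi\<^sub>E I F" "B = Pi\<^sub>E I G" and *: "\<forall>i\<in>I. F i \<in> E i" "\<forall>i\<in>I. G i \<in> E i"
    by auto
  have "A \<inter> B = Pi\<^sub>E I (\<lambda>i. F i \<inter> G i)" unfolding AB by auto
  moreover have "\<forall>i\<in>I. F i \<inter> G i \<in> E i" using * assms unfolding Int_stable_def by blast
  ultimately show "A \<inter> B \<in> ?P" by blast
qed

lemma countably_generated_PiM:
  assumes I: "finite I" and M: "\<And>i. i \<in> I \<Longrightarrow> countably_generated (M i)"
  shows "countably_generated (Pi\<^sub>M I M)"
proof -
  obtain E where E: "\<And>i. i \<in> I \<Longrightarrow> countable (E i)" "\<And>i. i \<in> I \<Longrightarrow> Int_stable (E i)"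
    "\<And>i. i \<in> I \<Longrightarrow> E i \<subseteq> Pow (space (M i))" "\<And>i. i \<in> I \<Longrightarrow> space (M i) \<in> E i"
    "\<And>i. i \<in> I \<Longrightarrow> sets (M i) = sigma_sets (space (M i)) (E i)"
    using M unfolding countably_generated_def by metis
  let ?P = "{Pi\<^sub>E I F | F. \<forall>i\<in>I. F i \<in> E i}"
  have "sets (Pi\<^sub>M I M) = sigma_sets (space (Pi\<^sub>M I M)) ?P"
    by (rule sets_PiM_generated[OF I E(3,4,5)])
  moreover have "countable ?P"
  proof -
    have "?P \<subseteq> (\<lambda>F. Pi\<^sub>E I F) ` (Pi\<^sub>E I E)"
    proof safe
      fix F assume F: "\<forall>i\<in>I. F i \<in> E i"
      have "Pi\<^sub>E I F = Pi\<^sub>E I (restrict F I)" by (rule PiE_cong) simp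
      moreover have "restrict F I \<in> Pi\<^sub>E I E" using F by simp
      ultimately show "Pi\<^sub>E I F \<in> (\<lambda>F. Pi\<^sub>E I F) ` (Pi\<^sub>E I E)" by (rule image_eqI)
    qed
    then show ?thesis
      by (rule countable_subset) (use I E in \<open>auto intro!: countable_image countable_PiE\<close>)
  qed
  moreover have "space (Pi\<^sub>M I M) \<in> ?P" using E(4) by (auto simp: space_PiM)
  moreover have "?P \<subseteq> Pow (space (Pi\<^sub>M I M))" unfolding space_PiM by (intro PiE_generators_Pow E(3))
  moreover have "Int_stable ?P" by (rule Int_stable_PiE[OF E(2)])
  ultimately show ?thesis unfolding countably_generated_def by blast
qed

lemma countably_generated_Rsp: "finite I \<Longrightarrow> countably_generated (Rsp I)"
  by (rule countably_generated_PiM) (auto intro: countably_generated_borel_real)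

section \<open>Existence of conditional laws\<close>

lemma AE_le_of_set_nn_integral_le:
  fixes f g :: "'a \<Rightarrow> ennreal"
  assumes [measurable]: "f \<in> borel_measurable M" "g \<in> borel_measurable M"
    and fin: "(\<integral>\<^sup>+x. g x \<partial>M) < \<infinity>"
    and le: "\<And>A. A \<in> sets M \<Longrightarrow> (\<integral>\<^sup>+x. f x * indicator A x \<partial>M) \<le> (\<integral>\<^sup>+x. g x * indicator A x \<partial>M)"
  shows "AE x in M. f x \<le> g x"
proof -
  let ?A = "{x \<in> space M. g x < f x}"
  have "(\<integral>\<^sup>+x. g x * indicator ?A x \<partial>M) \<le> (\<integral>\<^sup>+x. g x \<partial>M)"
    by (intro nn_integral_mono) (auto simp: indicator_def)
  then have gA: "(\<integral>\<^sup>+x. g x * indicator ?A x \<partial>M) \<noteq> \<infinity>" using fin by auto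
  have "(\<integral>\<^sup>+x. f x * indicator ?A x - g x * indicator ?A x \<partial>M) =
     (\<integral>\<^sup>+x. f x * indicator ?A x \<partial>M) - (\<integral>\<^sup>+x. g x * indicator ?A x \<partial>M)"
    by (rule nn_integral_diff) (use gA in \<open>auto simp: indicator_def less_imp_le\<close>)
  also have "\<dots> = 0" using le[of ?A] gA by (intro diff_eq_0_ennreal) (auto simp: top.not_eq_extremum intro: le_less_trans)
  finally have "AE x in M. f x * indicator ?A x - g x * indicator ?A x = 0"
    by (subst (asm) nn_integral_0_iff_AE) auto
  with AE_space show ?thesis
  proof eventually_elim
    case (elim x)
    show ?case
    proof (rule ccontr)
      assume "\<not> f x \<le> g x"
      then have "g x < f x" by simp
      with elim have "f x - g x = 0" by simp
      moreover have "0 < f x - g x" using \<open>g x < f x\<close> by (simp add: diff_gt_0_iff_gt_ennreal)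
      ultimately show False by simp
    qed
  qed
qed

lemma sets_borel_atMost: "sets (borel :: real measure) = sigma_sets UNIV (insert UNIV (range atMost))"
proof (rule antisym)
  have "sigma_sets UNIV (range atMost) \<subseteq> sigma_sets (UNIV :: real set) (insert UNIV (range atMost))"
    by (rule sigma_sets_mono') auto
  then show "sets (borel :: real measure) \<subseteq> sigma_sets UNIV (insert UNIV (range atMost))"
    by (subst borel_eq_atMost) (simp add: sets_measure_of)
  show "sigma_sets UNIV (insert UNIV (range atMost)) \<subseteq> sets (borel :: real measure)"
    using sets.sigma_sets_subset[of "insert UNIV (range atMost)" "borel :: real measure"] by (simp add: image_subset_iff)
qed

lemma Int_stable_atMost: "Int_stable (insert UNIV (range atMost :: real set set))"
  by (auto simp: Int_stable_def)

lemma ex_conditional_probability_density: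
  assumes M: "prob_space M" and X: "X \<in> M \<rightarrow>\<^sub>M S" and Q: "Measurable.pred M Q"
  shows "\<exists>g\<in>borel_measurable S. \<forall>A\<in>sets S. (\<integral>\<^sup>+a. g a * indicator A a \<partial>distr M S X) =
    emeasure M {w \<in> space M. X w \<in> A \<and> Q w}"
proof -
  note [measurable] = X Q
  interpret M: prob_space M by fact
  interpret D: prob_space "distr M S X" by (rule M.prob_space_distr) simp
  let ?N = "distr (density M (\<lambda>w. indicator {w. Q w} w)) S X"
  have N: "emeasure ?N A = emeasure M {w \<in> space M. X w \<in> A \<and> Q w}" if "A \<in> sets S" for A
  proof -
    have "emeasure ?N A = (\<integral>\<^sup>+w. indicator {w. Q w} w * indicator (X -` A \<inter> space M) w \<partial>M)"
      using that by (simp add: emeasure_distr emeasure_density)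
    also have "\<dots> = (\<integral>\<^sup>+w. indicator {w \<in> space M. X w \<in> A \<and> Q w} w \<partial>M)"
      by (intro nn_integral_cong) (auto simp: indicator_def)
    finally show ?thesis using that by simp
  qed
  have "absolutely_continuous (distr M S X) ?N"
    unfolding absolutely_continuous_def
  proof
    fix A assume "A \<in> null_sets (distr M S X)"
    then have A[measurable]: "A \<in> sets S" and "emeasure M (X -` A \<inter> space M) = 0"
      by (auto simp: null_sets_def emeasure_distr)
    moreover have "emeasure M {w \<in> space M. X w \<in> A \<and> Q w} \<le> emeasure M (X -` A \<inter> space M)"
      by (intro emeasure_mono measurable_sets[OF X A]) auto
    ultimately have "emeasure M {w \<in> space M. X w \<in> A \<and> Q w} \<le> 0" by simp
    then show "A \<in> null_sets ?N" using N[OF A] A by (auto simp: null_sets_def)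
  qed
  from D.Radon_Nikodym[OF this]
  obtain g where g: "g \<in> borel_measurable (distr M S X)" and gd: "density (distr M S X) g = ?N" by auto
  show ?thesis
  proof (intro bexI[of _ g] ballI)
    show "g \<in> borel_measurable S" using g by simp
    fix A assume A: "A \<in> sets S"
    have "(\<integral>\<^sup>+a. g a * indicator A a \<partial>distr M S X) = emeasure (density (distr M S X) g) A"
      using g A by (subst emeasure_density) auto
    then show "(\<integral>\<^sup>+a. g a * indicator A a \<partial>distr M S X) = emeasure M {w \<in> space M. X w \<in> A \<and> Q w}"
      using N[OF A] gd by simp
  qed
qed

text \<open>
  The conditional law is built from its distribution function. Radon--Nikodym densities give the
  conditional probabilities of \<open>Y \<le> q\<close>; off one null set they are monotone in rational \<open>q\<close>, and
  their infima over rational \<open>q > x\<close> form a right-continuous distribution function \<open>F a\<close>. Boundedness of \<open>Y\<close> makes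
  its limits at infinity trivial.
\<close>

lemma ex_cond_law_bounded:
  assumes M: "prob_space M" and X: "X \<in> M \<rightarrow>\<^sub>M S" and Y: "Y \<in> M \<rightarrow>\<^sub>M (borel :: real measure)"
    and bd: "\<And>w. w \<in> space M \<Longrightarrow> -2 \<le> Y w \<and> Y w \<le> 2"
  shows "\<exists>K. is_cond_law M S X borel Y K"
proof -
  note [measurable] = X Y
  interpret M: prob_space M by fact
  let ?D = "distr M S X"
  interpret D: prob_space ?D by (rule M.prob_space_distr) simp
  let ?m = "\<lambda>A q. emeasure M {w \<in> space M. X w \<in> A \<and> Y w \<le> q}"
  have "\<exists>g\<in>borel_measurable S. \<forall>A\<in>sets S. (\<integral>\<^sup>+a. g a * indicator A a \<partial>?D) = ?m A q" for q
    by (rule ex_conditional_probability_density[OF M X]) simp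
  then have "\<forall>q. \<exists>g. g \<in> borel_measurable S \<and> (\<forall>A\<in>sets S. (\<integral>\<^sup>+a. g a * indicator A a \<partial>?D) = ?m A q)"
    by blast
  from choice[OF this] obtain g where g[measurable]: "\<And>q. g q \<in> borel_measurable S"
    and gm: "\<And>q A. A \<in> sets S \<Longrightarrow> (\<integral>\<^sup>+a. g q a * indicator A a \<partial>?D) = ?m A q"
    by auto
  have gfin: "(\<integral>\<^sup>+a. g q a \<partial>?D) < \<infinity>" for q
  proof -
    have "(\<integral>\<^sup>+a. g q a \<partial>?D) = (\<integral>\<^sup>+a. g q a * indicator (space S) a \<partial>?D)"
      by (intro nn_integral_cong) simp
    also have "\<dots> < \<infinity>" using M.emeasure_finite by (subst gm) (auto simp: less_top[symmetric])
    finally show ?thesis .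
  qed
  have gmono: "AE a in ?D. g q a \<le> g r a" if "q \<le> r" for q r
  proof (rule AE_le_of_set_nn_integral_le)
    fix A assume "A \<in> sets ?D"
    then have [measurable]: "A \<in> sets S" by simp
    have "?m A q \<le> ?m A r" using that by (intro emeasure_mono) auto
    then show "(\<integral>\<^sup>+x. g q x * indicator A x \<partial>?D) \<le> (\<integral>\<^sup>+x. g r x * indicator A x \<partial>?D)" by (simp add: gm)
  qed (use gfin in auto)
  have g1: "AE a in ?D. g q a = 1" if "2 \<le> q" for q
  proof (rule D.density_unique_finite_measure)
    fix A assume "A \<in> sets ?D"
    then have A[measurable]: "A \<in> sets S" by simp
    have "?m A q = emeasure ?D A"
      using bd that by (auto simp: emeasure_distr intro!: arg_cong[where f="emeasure M"] intro: order_trans)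
    then show "(\<integral>\<^sup>+x. g q x * indicator A x \<partial>?D) = (\<integral>\<^sup>+x. 1 * indicator A x \<partial>?D)" by (simp add: gm)
  qed auto
  have g0: "AE a in ?D. g q a = 0" if "q < -2" for q
  proof (rule D.density_unique_finite_measure)
    fix A assume "A \<in> sets ?D"
    then have A[measurable]: "A \<in> sets S" by simp
    have e: "{w \<in> space M. X w \<in> A \<and> Y w \<le> q} = {}"
      using bd that by force
    show "(\<integral>\<^sup>+x. g q x * indicator A x \<partial>?D) = (\<integral>\<^sup>+x. 0 * indicator A x \<partial>?D)" by (simp add: gm e)
  qed auto
  let ?r = "real_of_rat"
  have "AE a in ?D. \<forall>q r. (q \<le> r \<longrightarrow> g (?r q) a \<le> g (?r r) a) \<and> (2 \<le> ?r q \<longrightarrow> g (?r q) a = 1) \<and> (?r q < -2 \<longrightarrow> g (?r q) a = 0)"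
    unfolding AE_all_countable using gmono g1 g0
    by (intro allI AE_conjI) (auto simp: of_rat_less_eq)
  then obtain N where N: "N \<in> null_sets ?D"
    and good: "\<And>a. a \<in> space ?D - N \<Longrightarrow> \<forall>q r. (q \<le> r \<longrightarrow> g (?r q) a \<le> g (?r r) a) \<and> (2 \<le> ?r q \<longrightarrow> g (?r q) a = 1) \<and> (?r q < -2 \<longrightarrow> g (?r q) a = 0)"
    by (rule AE_E3) blast
  have Nm[measurable]: "N \<in> sets S" using N by auto
  \<comment> \<open>On the null set the densities are replaced by the distribution function of the point mass at 2.\<close>
  define h where "h q a = (if a \<in> N \<or> a \<notin> space S then (if 2 \<le> ?r q then 1 else 0) else enn2real (g (?r q) a))" for q a
  have g_le1: "g (?r q) a \<le> 1" if "a \<in> space S - N" for q a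
  proof -
    obtain r where r: "q \<le> r" "2 \<le> r" by (meson max.cobounded1 max.cobounded2)
    then have "2 \<le> ?r r" by (metis of_rat_less_eq of_rat_numeral_eq)
    then show ?thesis using good[of a] that r by (metis space_distr)
  qed
  have h_eq: "ennreal (h q a) = g (?r q) a" if "a \<in> space S - N" for q a
    using that g_le1[OF that, of q] by (auto simp: h_def intro!: ennreal_enn2real le_less_trans[OF _ ennreal_one_less_top])
  have h_meas[measurable]: "h q \<in> borel_measurable S" for q
    unfolding h_def by measurable
  have h_nonneg: "0 \<le> h q a" for q a by (simp add: h_def)
  have h_mono: "h q a \<le> h r a" if "q \<le> r" for q r a
  proof (cases "a \<in> space S - N")
    case True
    have "g (?r q) a \<le> g (?r r) a" using good[of a] True that by simp
    then show ?thesis using True g_le1[OF True, of r]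
      by (auto simp: h_def intro!: enn2real_mono le_less_trans[OF _ ennreal_one_less_top])
  next
    case False
    have "?r q \<le> ?r r" using that by (simp add: of_rat_less_eq)
    then show ?thesis using False by (auto simp: h_def)
  qed
  have h1: "h q a = 1" if "2 \<le> ?r q" for q a
    using good[of a] that by (auto simp: h_def)
  have h0: "h q a = 0" if "?r q < -2" for q a
    using good[of a] that by (auto simp: h_def)
  \<comment> \<open>Infima over larger rational points make the function right-continuous while keeping it monotone.\<close>
  define F where "F a x = (INF q\<in>{q. x < ?r q}. h q a)" for a x
  have ne: "{q. x < ?r q} \<noteq> {}" for x using of_rat_dense[of x "x + 1"] by auto
  have bb: "bdd_below ((\<lambda>q. h q a) ` R)" for a R using h_nonneg by (intro bdd_belowI2[of _ 0])
  have F_le: "F a x \<le> h q a" if "x < ?r q" for a x q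
    unfolding F_def using that by (intro cINF_lower bb) simp
  have F_ge: "c \<le> F a x" if "\<And>q. x < ?r q \<Longrightarrow> c \<le> h q a" for c a x
    unfolding F_def using that by (intro cINF_greatest ne) simp
  have F_nonneg: "0 \<le> F a x" for a x by (rule F_ge) (rule h_nonneg)
  have F_mono: "F a x \<le> F a y" if "x \<le> y" for a x y
    using that by (intro F_ge F_le) simp
  have F_1: "F a x = 1" if "2 \<le> x" for a x
  proof (rule antisym)
    obtain q where "x < ?r q" using ne[of x] by auto
    then show "F a x \<le> 1" using F_le[of x q a] h1[of q a] that by simp
    show "1 \<le> F a x" using that h1 by (intro F_ge) (metis less_imp_le order_trans order_refl)
  qed
  have F_0: "F a x = 0" if "x < -2" for a x
  proof (rule antisym)
    obtain q where "x < ?r q" "?r q < -2" using of_rat_dense[OF \<open>x < -2\<close>] by auto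
    then show "F a x \<le> 0" using F_le[of x q a] h0[of q a] by simp
  qed (rule F_nonneg)
  have F_right: "continuous (at_right x) (F a)" for a x
    unfolding continuous_within
  proof (rule order_tendstoI)
    fix c assume "c < F a x"
    then show "eventually (\<lambda>y. c < F a y) (at_right x)"
      unfolding eventually_at_right_field
      by (intro exI[of _ "x + 1"]) (auto intro: less_le_trans[OF _ F_mono])
  next
    fix c assume "F a x < c"
    then obtain q where q: "x < ?r q" "h q a < c" using F_ge[of x c a] by force
    then show "eventually (\<lambda>y. F a y < c) (at_right x)"
      unfolding eventually_at_right_field
      by (intro exI[of _ "?r q"]) (auto intro: le_less_trans[OF F_le])
  qed
  have F_bot: "(F a \<longlongrightarrow> 0) at_bot" for a
    by (rule tendsto_eventually) (auto simp: eventually_at_bot_linorder F_0 intro!: exI[of _ "-3"])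
  have F_top: "(F a \<longlongrightarrow> 1) at_top" for a
    by (rule tendsto_eventually) (auto simp: eventually_at_top_linorder F_1 intro!: exI[of _ "2"])
  have F_meas[measurable]: "(\<lambda>a. F a x) \<in> borel_measurable S" for x
    unfolding F_def by (rule borel_measurable_cINF_real) auto
  define K where "K a = interval_measure (F a)" for a
  have Kp: "prob_space (K a)" "sets (K a) = sets borel" for a
    using real_distribution_interval_measure[OF F_mono F_right F_bot F_top, of a]
    by (auto simp: K_def real_distribution_def)
  have KF: "emeasure (K a) {..x} = ennreal (F a x)" for a x
    unfolding K_def by (rule emeasure_interval_measure_Iic[OF F_mono F_right F_bot])
  have K_UNIV: "emeasure (K a) UNIV = 1" for a
    using prob_space.emeasure_space_1[OF Kp(1)[of a]] sets_eq_imp_space_eq[OF Kp(2)[of a]] by simp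
  let ?G = "insert UNIV (range atMost) :: real set set"
  have Km: "K \<in> S \<rightarrow>\<^sub>M prob_algebra borel"
    by (rule measurable_prob_algebra_generated[OF sets_borel_atMost Int_stable_atMost])
       (auto simp: Kp KF K_UNIV)
  have int_F: "(\<integral>\<^sup>+a. ennreal (F a x) * indicator A a \<partial>?D) = ?m A x" if A[measurable]: "A \<in> sets S" for A x
  proof (rule antisym)
    have "\<exists>q. x < ?r q \<and> ?r q < x + 1 / real (Suc n)" for n
      by (rule of_rat_dense) simp
    then obtain q where q: "\<And>n. x < ?r (q n)" "\<And>n. ?r (q n) < x + 1 / real (Suc n)" by metis
    have qx: "(\<lambda>n. ?r (q n)) \<longlonglongrightarrow> x"
    proof (rule real_tendsto_sandwich[where f="\<lambda>_. x" and h="\<lambda>n. x + 1 / real (Suc n)"])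
      have "(\<lambda>n. x + 1 / real (Suc n)) \<longlonglongrightarrow> x + 0"
        by (intro tendsto_add tendsto_const LIMSEQ_Suc[OF lim_1_over_n])
      then show "(\<lambda>n. x + 1 / real (Suc n)) \<longlonglongrightarrow> x" by simp
      show "eventually (\<lambda>n. x \<le> ?r (q n)) sequentially"
        using q(1) by (intro always_eventually) (auto intro: less_imp_le)
      show "eventually (\<lambda>n. ?r (q n) \<le> x + 1 / real (Suc n)) sequentially"
        using q(2) by (intro always_eventually allI less_imp_le)
    qed simp
    have "(\<integral>\<^sup>+a. ennreal (F a x) * indicator A a \<partial>?D) \<le> ?m A (?r (q n))" for n
    proof -
      have "(\<integral>\<^sup>+a. ennreal (F a x) * indicator A a \<partial>?D) \<le> (\<integral>\<^sup>+a. ennreal (h (q n) a) * indicator A a \<partial>?D)"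
        by (intro nn_integral_mono mult_right_mono ennreal_leI F_le q) auto
      also have "\<dots> = (\<integral>\<^sup>+a. g (?r (q n)) a * indicator A a \<partial>?D)"
        using h_eq by (intro nn_integral_cong_AE AE_I'[OF N]) force
      finally show ?thesis by (simp add: gm)
    qed
    moreover have "(\<lambda>n. \<integral>\<^sup>+w. indicator {w \<in> space M. X w \<in> A \<and> Y w \<le> ?r (q n)} w \<partial>M) \<longlonglongrightarrow>
       (\<integral>\<^sup>+w. indicator {w \<in> space M. X w \<in> A \<and> Y w \<le> x} w \<partial>M)"
    proof (rule nn_integral_dominated_convergence[where w="\<lambda>_. 1"])
      show "AE w in M. (\<lambda>n. indicator {w \<in> space M. X w \<in> A \<and> Y w \<le> ?r (q n)} w :: ennreal) \<longlonglongrightarrow>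
        indicator {w \<in> space M. X w \<in> A \<and> Y w \<le> x} w"
      proof (rule AE_I2)
        fix w
        have "eventually (\<lambda>n. Y w \<le> ?r (q n) \<longleftrightarrow> Y w \<le> x) sequentially"
        proof (cases "Y w \<le> x")
          case True
          then show ?thesis using q(1) by (intro always_eventually) (meson less_imp_le order_trans)
        next
          case False
          then show ?thesis using order_tendstoD(2)[OF qx, of "Y w"] by (auto elim: eventually_mono)
        qed
        then show "(\<lambda>n. indicator {w \<in> space M. X w \<in> A \<and> Y w \<le> ?r (q n)} w :: ennreal) \<longlonglongrightarrow>
          indicator {w \<in> space M. X w \<in> A \<and> Y w \<le> x} w"
          by (intro tendsto_eventually) (auto elim!: eventually_mono simp: indicator_def)
      qed
    qed (auto simp: M.emeasure_space_1 indicator_def)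
    then have "(\<lambda>n. ?m A (?r (q n))) \<longlonglongrightarrow> ?m A x" by simp
    ultimately show "(\<integral>\<^sup>+a. ennreal (F a x) * indicator A a \<partial>?D) \<le> ?m A x"
      by (intro LIMSEQ_le_const) auto
  next
    have "AE a in ?D. \<forall>q. x < ?r q \<longrightarrow> g x a \<le> g (?r q) a"
      unfolding AE_all_countable using gmono by (auto simp: less_imp_le)
    moreover have "AE a in ?D. a \<in> space S - N"
      using AE_not_in[OF N] AE_space[of ?D] by eventually_elim simp
    ultimately have "AE a in ?D. g x a \<le> ennreal (F a x)"
    proof eventually_elim
      case (elim a)
      obtain q where "x < ?r q" using ne[of x] by auto
      then have "g x a \<le> 1" using elim(1) g_le1[OF elim(2)] order_trans by blast
      then have gx: "g x a = ennreal (enn2real (g x a))"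
        by (simp add: le_less_trans[OF _ ennreal_one_less_top])
      have "enn2real (g x a) \<le> F a x"
      proof (rule F_ge)
        fix q assume "x < ?r q"
        then have "ennreal (enn2real (g x a)) \<le> ennreal (h q a)" using elim gx h_eq by metis
        then show "enn2real (g x a) \<le> h q a" using h_nonneg by simp
      qed
      then show ?case using gx by (metis ennreal_leI)
    qed
    then show "?m A x \<le> (\<integral>\<^sup>+a. ennreal (F a x) * indicator A a \<partial>?D)"
      unfolding gm[OF A, symmetric] by (intro nn_integral_mono_AE) (auto elim!: eventually_mono intro: mult_right_mono)
  qed
  have "is_cond_law M S X borel Y K"
  proof (rule is_cond_lawI[OF M X Y Km sets_generator, where G="?G"])
    show "sets borel = sigma_sets (space borel) ?G" using sets_borel_atMost by simp
    fix A B assume A[measurable]: "A \<in> sets S" and "B \<in> ?G"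
    then consider "B = UNIV" | x where "B = {..x}" by auto
    then show "(\<integral>\<^sup>+w. indicator A (X w) * indicator B (Y w) \<partial>M) = (\<integral>\<^sup>+w. indicator A (X w) * emeasure (K (X w)) B \<partial>M)"
    proof cases
      case 1 then show ?thesis by (simp add: K_UNIV)
    next
      case (2 x)
      have "(\<integral>\<^sup>+w. indicator A (X w) * indicator B (Y w) \<partial>M) = (\<integral>\<^sup>+w. indicator {w \<in> space M. X w \<in> A \<and> Y w \<le> x} w \<partial>M)"
        by (intro nn_integral_cong) (auto simp: 2 indicator_def)
      also have "\<dots> = (\<integral>\<^sup>+a. ennreal (F a x) * indicator A a \<partial>?D)" using int_F[OF A, of x] by simp
      also have "\<dots> = (\<integral>\<^sup>+w. indicator A (X w) * emeasure (K (X w)) B \<partial>M)"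
        by (subst nn_integral_distr) (auto simp: 2 KF mult.commute)
      finally show ?thesis .
    qed
  qed (use Int_stable_atMost in auto)
  then show ?thesis by blast
qed

text \<open>
  The inverse tangent maps the line into a bounded interval, and pushing forward by the tangent undoes it.
\<close>

lemma ex_cond_law_real:
  assumes M: "prob_space M" and X: "X \<in> M \<rightarrow>\<^sub>M S" and Y: "Y \<in> M \<rightarrow>\<^sub>M (borel :: real measure)"
  shows "\<exists>K. is_cond_law M S X borel Y K"
proof -
  note [measurable] = Y
  have aY: "(\<lambda>w. arctan (Y w)) \<in> M \<rightarrow>\<^sub>M borel" by simp
  have "-2 \<le> arctan y \<and> arctan y \<le> 2" for y
    using arctan_bounded[of y] pi_less_4 by auto
  then obtain K where K: "is_cond_law M S X borel (\<lambda>w. arctan (Y w)) K"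
    using ex_cond_law_bounded[OF M X aY] by auto
  have "(tan :: real \<Rightarrow> real) \<in> borel \<rightarrow>\<^sub>M borel" unfolding tan_def by measurable
  from is_cond_law_push[OF M X aY this K] show ?thesis by (auto simp: tan_arctan)
qed

lemma ex_cond_law_pair:
  assumes M: "prob_space M" and X: "X \<in> M \<rightarrow>\<^sub>M S" and Y: "Y \<in> M \<rightarrow>\<^sub>M T \<Otimes>\<^sub>M U"
    and k: "\<exists>K. is_cond_law M S X T (\<lambda>w. fst (Y w)) K"
    and l: "\<exists>L. is_cond_law M (S \<Otimes>\<^sub>M T) (\<lambda>w. (X w, fst (Y w))) U (\<lambda>w. snd (Y w)) L"
  shows "\<exists>K. is_cond_law M S X (T \<Otimes>\<^sub>M U) Y K"
proof -
  note [measurable] = Y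
  have Y': "(\<lambda>w. fst (Y w)) \<in> M \<rightarrow>\<^sub>M T" "(\<lambda>w. snd (Y w)) \<in> M \<rightarrow>\<^sub>M U" by simp_all
  obtain K L where "is_cond_law M S X T (\<lambda>w. fst (Y w)) K"
    "is_cond_law M (S \<Otimes>\<^sub>M T) (\<lambda>w. (X w, fst (Y w))) U (\<lambda>w. snd (Y w)) L" using k l by auto
  from is_cond_law_chain[OF M X Y' this] show ?thesis by auto
qed

text \<open>
  One coordinate is added at a time: the last one is conditioned on \<open>X\<close> together with the earlier
  ones, and the two kernels are composed.
\<close>

lemma ex_cond_law_Rsp:
  assumes I: "finite I" and M: "prob_space M" and X: "X \<in> M \<rightarrow>\<^sub>M S" and Y: "Y \<in> M \<rightarrow>\<^sub>M Rsp I"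
  shows "\<exists>K. is_cond_law M S X (Rsp I) Y K"
  using I Y
proof (induction I arbitrary: Y)
  case empty
  let ?u = "\<lambda>_::nat. undefined :: real"
  have u: "?u \<in> space (Rsp {})" by (simp add: space_PiM)
  have "is_cond_law M S X (Rsp {}) Y (\<lambda>a. return (Rsp {}) ?u)"
  proof (rule is_cond_lawI_sets[OF M X empty])
    show "(\<lambda>a. return (Rsp {}) ?u) \<in> S \<rightarrow>\<^sub>M prob_algebra (Rsp {})"
      by (rule measurable_const) (simp add: space_prob_algebra prob_space_return[OF u])
    fix A B assume "A \<in> sets S" and B: "B \<in> sets (Rsp {})"
    show "(\<integral>\<^sup>+w. indicator A (X w) * indicator B (Y w) \<partial>M) =
      (\<integral>\<^sup>+w. indicator A (X w) * emeasure (return (Rsp {}) ?u) B \<partial>M)"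
    proof (rule nn_integral_cong)
      fix w assume "w \<in> space M"
      then have "Y w = ?u" using measurable_space[OF empty] by (auto simp: space_PiM)
      then show "indicator A (X w) * indicator B (Y w) = indicator A (X w) * emeasure (return (Rsp {}) ?u) B"
        using B by simp
    qed
  qed
  then show ?case by blast
next
  case (insert i I)
  note [measurable] = X insert.prems
  have r[measurable]: "(\<lambda>w. restrict (Y w) I) \<in> M \<rightarrow>\<^sub>M Rsp I"
    by (rule measurable_compose[OF insert.prems measurable_restrict_subset]) auto
  have c[measurable]: "(\<lambda>w. Y w i) \<in> M \<rightarrow>\<^sub>M borel"
    by (rule measurable_compose[OF insert.prems measurable_component_singleton]) auto
  obtain K where K: "is_cond_law M S X (Rsp I) (\<lambda>w. restrict (Y w) I) K" using insert.IH[OF r] by blast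
  have rc: "(\<lambda>w. (restrict (Y w) I, Y w i)) \<in> M \<rightarrow>\<^sub>M Rsp I \<Otimes>\<^sub>M borel" by simp
  have "(\<lambda>w. (X w, restrict (Y w) I)) \<in> M \<rightarrow>\<^sub>M S \<Otimes>\<^sub>M Rsp I" by simp
  from ex_cond_law_real[OF M this c]
  obtain K' where "is_cond_law M S X (Rsp I \<Otimes>\<^sub>M borel) (\<lambda>w. (restrict (Y w) I, Y w i)) K'"
    using is_cond_law_chain[OF M X r c K] by blast
  note is_cond_law_push[OF M X rc measurable_add_dim this]
  then have "is_cond_law M S X (Rsp (insert i I)) (\<lambda>w. (restrict (Y w) I)(i := Y w i))
     (\<lambda>a. distr (K' a) (Rsp (insert i I)) (\<lambda>(f, y). f(i := y)))" by simp
  also have "?this \<longleftrightarrow> is_cond_law M S X (Rsp (insert i I)) Y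
     (\<lambda>a. distr (K' a) (Rsp (insert i I)) (\<lambda>(f, y). f(i := y)))"
  proof -
    have "(restrict (Y w) I)(i := Y w i) = Y w" if "w \<in> space M" for w
      using measurable_space[OF insert.prems that]
      by (auto simp: space_PiM PiE_iff extensional_def fun_eq_iff)
    then show ?thesis unfolding is_cond_law_def by (simp cong: distr_cong)
  qed
  finally show ?case by blast
qed

lemma ex_cond_law_Rsp_pair:
  assumes I: "finite I" "finite J" and M: "prob_space M" and X: "X \<in> M \<rightarrow>\<^sub>M S"
    and Y: "Y \<in> M \<rightarrow>\<^sub>M Rsp I \<Otimes>\<^sub>M Rsp J"
  shows "\<exists>K. is_cond_law M S X (Rsp I \<Otimes>\<^sub>M Rsp J) Y K"
proof -
  note [measurable] = X Y
  show ?thesis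
    by (intro ex_cond_law_pair[OF M X Y] ex_cond_law_Rsp I M) simp_all
qed

lemma ex_cond_law_real_pair:
  assumes M: "prob_space M" and X: "X \<in> M \<rightarrow>\<^sub>M S" and Y: "Y \<in> M \<rightarrow>\<^sub>M (borel :: real measure) \<Otimes>\<^sub>M (borel :: real measure)"
  shows "\<exists>K. is_cond_law M S X ((borel :: real measure) \<Otimes>\<^sub>M (borel :: real measure)) Y K"
proof -
  note [measurable] = X Y
  show ?thesis
    by (intro ex_cond_law_pair[OF M X Y] ex_cond_law_real M) simp_all
qed

lemma is_cond_law_cond_law:
  "\<exists>K. is_cond_law M S X T Y K \<Longrightarrow> is_cond_law M S X T Y (cond_law M S X T Y)"
  unfolding cond_law_def by (rule someI_ex[of "is_cond_law M S X T Y"])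

section \<open>Bounds on conditional means\<close>

text \<open>
  The conditional mean of \<open>f\<close> given \<open>X\<close> is almost surely at most \<open>C\<close>. Testing against events instead of a
  kernel makes passing to less information and adding two bounds immediate.
\<close>

definition cond_mean_le :: "'w measure \<Rightarrow> 'a measure \<Rightarrow> ('w \<Rightarrow> 'a) \<Rightarrow> ('w \<Rightarrow> ennreal) \<Rightarrow> ennreal \<Rightarrow> bool" where
  "cond_mean_le M S X f C \<longleftrightarrow>
     (\<forall>A\<in>sets S. (\<integral>\<^sup>+w. indicator A (X w) * f w \<partial>M) \<le> C * (\<integral>\<^sup>+w. indicator A (X w) \<partial>M))"

lemma cond_mean_le_coarsen:
  assumes X: "X \<in> M \<rightarrow>\<^sub>M S" and g: "g \<in> S \<rightarrow>\<^sub>M S'" and c: "cond_mean_le M S X f C"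
    and eq: "\<And>w. w \<in> space M \<Longrightarrow> X' w = g (X w)"
  shows "cond_mean_le M S' X' f C"
  unfolding cond_mean_le_def
proof
  fix A assume A: "A \<in> sets S'"
  have i: "indicator A (X' w) = (indicator (g -` A \<inter> space S) (X w) :: ennreal)" if "w \<in> space M" for w
    using measurable_space[OF X that] eq[OF that] by (auto simp: indicator_def)
  have "g -` A \<inter> space S \<in> sets S" using g A by (rule measurable_sets)
  with c have "(\<integral>\<^sup>+w. indicator (g -` A \<inter> space S) (X w) * f w \<partial>M) \<le> C * (\<integral>\<^sup>+w. indicator (g -` A \<inter> space S) (X w) \<partial>M)"
    by (auto simp: cond_mean_le_def)
  then show "(\<integral>\<^sup>+w. indicator A (X' w) * f w \<partial>M) \<le> C * (\<integral>\<^sup>+w. indicator A (X' w) \<partial>M)"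
    using i by (simp cong: nn_integral_cong)
qed

lemma cond_mean_le_distr:
  assumes f: "f \<in> M \<rightarrow>\<^sub>M M'" and X: "X \<in> M' \<rightarrow>\<^sub>M S" and h: "h \<in> borel_measurable M'"
  shows "cond_mean_le (distr M M' f) S X h C \<longleftrightarrow> cond_mean_le M S (\<lambda>w. X (f w)) (\<lambda>w. h (f w)) C"
  using assms by (auto simp: cond_mean_le_def nn_integral_distr)

lemma cond_mean_le_iff_AE:
  assumes M: "prob_space M" and X: "X \<in> M \<rightarrow>\<^sub>M S" and Y: "Y \<in> M \<rightarrow>\<^sub>M T"
    and c: "is_cond_law M S X T Y K" and f: "f \<in> borel_measurable T" and C: "C < \<infinity>"
  shows "cond_mean_le M S X (\<lambda>w. f (Y w)) C \<longleftrightarrow> (AE a in distr M S X. (\<integral>\<^sup>+b. f b \<partial>K a) \<le> C)"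
proof -
  note [measurable] = X Y f
  interpret M: prob_space M by fact
  interpret D: prob_space "distr M S X" by (rule M.prob_space_distr) simp
  note K = is_cond_law_kernel[OF c]
  have m[measurable]: "(\<lambda>a. \<integral>\<^sup>+b. f b \<partial>K a) \<in> borel_measurable S"
    using kernel_nn_integral_measurable[OF K, of "\<lambda>z. f (snd z)"] by simp
  have eq: "(\<integral>\<^sup>+w. indicator A (X w) * f (Y w) \<partial>M) = (\<integral>\<^sup>+a. (\<integral>\<^sup>+b. f b \<partial>K a) * indicator A a \<partial>distr M S X)"
    if [measurable]: "A \<in> sets S" for A
  proof -
    have "(\<integral>\<^sup>+w. indicator A (X w) * f (Y w) \<partial>M) = (\<integral>\<^sup>+w. \<integral>\<^sup>+b. indicator A (X w) * f b \<partial>K (X w) \<partial>M)"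
      using is_cond_law_nn_integral[OF M X Y c, of "\<lambda>(a, b). indicator A a * f b"] by simp
    also have "\<dots> = (\<integral>\<^sup>+w. (\<integral>\<^sup>+b. f b \<partial>K (X w)) * indicator A (X w) \<partial>M)"
      by (intro nn_integral_cong) (auto simp: indicator_def)
    finally show ?thesis by (simp add: nn_integral_distr)
  qed
  have C_eq: "C * (\<integral>\<^sup>+w. indicator A (X w) \<partial>M) = (\<integral>\<^sup>+a. C * indicator A a \<partial>distr M S X)"
    if [measurable]: "A \<in> sets S" for A
  proof -
    have "(\<integral>\<^sup>+w. indicator A (X w) \<partial>M) = (\<integral>\<^sup>+a. indicator A a \<partial>distr M S X)"
      by (subst nn_integral_distr) auto
    then show ?thesis by (simp add: nn_integral_cmult)
  qed
  show ?thesis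
  proof
    assume "cond_mean_le M S X (\<lambda>w. f (Y w)) C"
    then show "AE a in distr M S X. (\<integral>\<^sup>+b. f b \<partial>K a) \<le> C"
      using C by (intro AE_le_of_set_nn_integral_le)
        (auto simp: cond_mean_le_def eq[symmetric] C_eq[symmetric] D.emeasure_space_1[simplified])
  next
    assume "AE a in distr M S X. (\<integral>\<^sup>+b. f b \<partial>K a) \<le> C"
    then show "cond_mean_le M S X (\<lambda>w. f (Y w)) C"
      unfolding cond_mean_le_def
      by (auto simp: eq C_eq intro!: nn_integral_mono_AE elim!: eventually_mono intro: mult_right_mono)
  qed
qed

text \<open>
  A bound on the mean of \<open>f\<close> given \<open>(X, V)\<close> may be checked after conditioning on \<open>X\<close>. The quantifier over
  all events inside ``almost every \<open>a\<close>'' is uncountable; the conditional law \<open>L\<close> of \<open>g\<close>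
  removes it, because it serves under \<open>M\<close> and under almost every \<open>K a\<close>.
\<close>

lemma cond_mean_le_conditioned_iff:
  assumes M: "prob_space M" and X: "X \<in> M \<rightarrow>\<^sub>M S" and Y: "Y \<in> M \<rightarrow>\<^sub>M T"
    and V: "V \<in> T \<rightarrow>\<^sub>M W" and g: "g \<in> T \<rightarrow>\<^sub>M U" and cg: "countably_generated (W \<Otimes>\<^sub>M U)"
    and k: "is_cond_law M S X T Y K"
    and l: "\<exists>L. is_cond_law M (S \<Otimes>\<^sub>M W) (\<lambda>w. (X w, V (Y w))) U (\<lambda>w. g (Y w)) L"
    and f: "f \<in> borel_measurable U" and C: "C < \<infinity>"
  shows "cond_mean_le M (S \<Otimes>\<^sub>M W) (\<lambda>w. (X w, V (Y w))) (\<lambda>w. f (g (Y w))) C \<longleftrightarrow>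
    (AE a in distr M S X. cond_mean_le (K a) W V (\<lambda>t. f (g t)) C)"
proof -
  note [measurable] = X Y V g f
  interpret M: prob_space M by fact
  obtain L where L: "is_cond_law M (S \<Otimes>\<^sub>M W) (\<lambda>w. (X w, V (Y w))) U (\<lambda>w. g (Y w)) L" using l by auto
  note Lm = is_cond_law_kernel[OF L] and K = is_cond_law_kernel[OF k]
  have XV: "(\<lambda>w. (X w, V (Y w))) \<in> M \<rightarrow>\<^sub>M S \<Otimes>\<^sub>M W" and gY: "(\<lambda>w. g (Y w)) \<in> M \<rightarrow>\<^sub>M U" by simp_all
  have m[measurable]: "(\<lambda>z. \<integral>\<^sup>+u. f u \<partial>L z) \<in> borel_measurable (S \<Otimes>\<^sub>M W)"
    using kernel_nn_integral_measurable[OF Lm, of "\<lambda>z. f (snd z)"] by simp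
  note KV = is_cond_law_push[OF M X Y V k]
  have KVeq: "distr M (S \<Otimes>\<^sub>M W) (\<lambda>w. (X w, V (Y w))) =
      distr M S X \<bind> (\<lambda>a. distr (distr (K a) W V) (S \<Otimes>\<^sub>M W) (\<lambda>b. (a, b)))"
    using KV unfolding is_cond_law_def by blast
  have space: "AE a in distr M S X. a \<in> space S" using AE_space[of "distr M S X"] by simp
  have "cond_mean_le M (S \<Otimes>\<^sub>M W) (\<lambda>w. (X w, V (Y w))) (\<lambda>w. f (g (Y w))) C \<longleftrightarrow>
     (AE z in distr M (S \<Otimes>\<^sub>M W) (\<lambda>w. (X w, V (Y w))). (\<integral>\<^sup>+u. f u \<partial>L z) \<le> C)"
    by (rule cond_mean_le_iff_AE[OF M XV gY L f C])
  also have "\<dots> \<longleftrightarrow> (AE z in distr M S X \<bind> (\<lambda>a. distr (distr (K a) W V) (S \<Otimes>\<^sub>M W) (\<lambda>b. (a, b))). (\<integral>\<^sup>+u. f u \<partial>L z) \<le> C)"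
    unfolding KVeq ..
  also have "\<dots> \<longleftrightarrow> (AE a in distr M S X. AE z in distr (distr (K a) W V) (S \<Otimes>\<^sub>M W) (\<lambda>b. (a, b)). (\<integral>\<^sup>+u. f u \<partial>L z) \<le> C)"
    using measurable_pair_kernel[OF is_cond_law_kernel[OF KV]]
    by (intro AE_bind[where B="S \<Otimes>\<^sub>M W"]) (auto simp: measurable_prob_algebraD)
  also have "\<dots> \<longleftrightarrow> (AE a in distr M S X. AE v in distr (K a) W V. (\<integral>\<^sup>+u. f u \<partial>L (a, v)) \<le> C)"
  proof (rule AE_cong)
    fix a assume "a \<in> space (distr M S X)"
    then have a: "a \<in> space S" by simp
    then show "(AE z in distr (distr (K a) W V) (S \<Otimes>\<^sub>M W) (\<lambda>b. (a, b)). (\<integral>\<^sup>+u. f u \<partial>L z) \<le> C) \<longleftrightarrow>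
      (AE v in distr (K a) W V. (\<integral>\<^sup>+u. f u \<partial>L (a, v)) \<le> C)"
      by (subst AE_distr_iff) auto
  qed
  also have "\<dots> \<longleftrightarrow> (AE a in distr M S X. cond_mean_le (K a) W V (\<lambda>t. f (g t)) C)"
  proof -
    have "AE a in distr M S X. (AE v in distr (K a) W V. (\<integral>\<^sup>+u. f u \<partial>L (a, v)) \<le> C) \<longleftrightarrow>
      cond_mean_le (K a) W V (\<lambda>t. f (g t)) C"
      using AE_is_cond_law_conditioned[OF M X Y V g cg k L] space
    proof eventually_elim
      case (elim a)
      note s = kernel_at[OF K elim(2)]
      have "V \<in> K a \<rightarrow>\<^sub>M W" "g \<in> K a \<rightarrow>\<^sub>M U"
        using V g by (simp_all add: measurable_cong_sets[OF s(2) refl])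
      from cond_mean_le_iff_AE[OF s(1) this elim(1) f C] show ?case by simp
    qed
    then show ?thesis by (rule eventually_subst)
  qed
  finally show ?thesis .
qed

section \<open>The recursive functional\<close>

lemma enn_root_le_iff:
  assumes "0 < p" "0 \<le> c"
  shows "enn_root p a \<le> ennreal c \<longleftrightarrow> a \<le> ennreal (c powr p)"
proof (cases a)
  case (real r)
  have "r powr (1 / p) \<le> c \<longleftrightarrow> r \<le> c powr p"
  proof
    assume "r powr (1 / p) \<le> c"
    then have "(r powr (1 / p)) powr p \<le> c powr p" using assms by (intro powr_mono2) auto
    then show "r \<le> c powr p" using assms real by (simp add: powr_powr)
  next
    assume "r \<le> c powr p"
    then have "r powr (1 / p) \<le> (c powr p) powr (1 / p)" using assms real by (intro powr_mono2) auto
    then show "r powr (1 / p) \<le> c" using assms by (simp add: powr_powr)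
  qed
  then show ?thesis using real assms by (simp add: enn_root_def)
next
  case top
  then show ?thesis by (simp add: enn_root_def top_unique)
qed

text \<open>
  The infimum of the essential bounds is itself one, as a countable intersection of sets of full measure.
\<close>

lemma Linf_norm_le_iff:
  assumes "0 \<le> c"
  shows "Linf_norm M f \<le> ennreal c \<longleftrightarrow> (AE z in M. f z \<le> ennreal c)"
proof
  assume "AE z in M. f z \<le> ennreal c"
  then show "Linf_norm M f \<le> ennreal c" unfolding Linf_norm_def by (intro Inf_lower) simp
next
  assume le: "Linf_norm M f \<le> ennreal c"
  have "AE z in M. f z \<le> ennreal c + ennreal (1 / real (Suc n))" for n
  proof -
    have "Linf_norm M f < ennreal c + ennreal (1 / real (Suc n))"
      using le by (rule le_less_trans)
        (use assms in \<open>simp add: ennreal_plus[symmetric] ennreal_less_iff del: ennreal_plus\<close>)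
    then obtain d where "AE z in M. f z \<le> d" and d: "d < ennreal c + ennreal (1 / real (Suc n))"
      by (auto simp: Linf_norm_def Inf_less_iff)
    then show ?thesis by (auto elim!: eventually_mono)
  qed
  then have "AE z in M. \<forall>n. f z \<le> ennreal c + ennreal (1 / real (Suc n))" by (simp add: AE_all_countable)
  then show "AE z in M. f z \<le> ennreal c"
  proof eventually_elim
    case (elim z)
    show ?case
    proof (rule ennreal_le_epsilon)
      fix e :: real assume "0 < e"
      then obtain n where "1 / real (Suc n) < e" using nat_approx_posE by blast
      then show "f z \<le> ennreal c + ennreal e"
        using elim by (meson add_left_mono ennreal_leI less_imp_le order_trans)
    qed
  qed
qed

definition seg :: "nat set \<Rightarrow> (nat \<Rightarrow> real) \<times> (nat \<Rightarrow> real) \<Rightarrow> (nat \<Rightarrow> real) \<times> (nat \<Rightarrow> real)" where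
  "seg I = (\<lambda>(x, y). (restrict x I, restrict y I))"

definition pair_at :: "nat \<Rightarrow> (nat \<Rightarrow> real) \<times> (nat \<Rightarrow> real) \<Rightarrow> real \<times> real" where
  "pair_at s = (\<lambda>(x, y). (x s, y s))"

definition gap :: "real \<Rightarrow> real \<times> real \<Rightarrow> ennreal" where
  "gap p = (\<lambda>(a, b). ennreal (\<bar>a - b\<bar> powr p))"

abbreviation Rsp2 :: "nat set \<Rightarrow> ((nat \<Rightarrow> real) \<times> (nat \<Rightarrow> real)) measure" where
  "Rsp2 I \<equiv> Rsp I \<Otimes>\<^sub>M Rsp I"

lemma restrict_measurable: "J \<subseteq> I \<Longrightarrow> (\<lambda>x. restrict x J) \<in> Rsp I \<rightarrow>\<^sub>M Rsp J"
  by (rule measurable_restrict_subset)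

lemma seg_measurable:
  assumes "J \<subseteq> I" shows "seg J \<in> Rsp2 I \<rightarrow>\<^sub>M Rsp2 J"
proof -
  note [measurable] = restrict_measurable[OF assms]
  show ?thesis unfolding seg_def by measurable
qed

lemma pair_at_measurable:
  assumes "s \<in> I" shows "pair_at s \<in> Rsp2 I \<rightarrow>\<^sub>M borel \<Otimes>\<^sub>M borel"
proof -
  have [measurable]: "(\<lambda>x. x s) \<in> Rsp I \<rightarrow>\<^sub>M borel"
    using assms by (rule measurable_component_singleton)
  show ?thesis unfolding pair_at_def by measurable
qed

lemma gap_measurable[measurable]: "gap p \<in> borel_measurable (borel \<Otimes>\<^sub>M borel)"
  unfolding gap_def by measurable

text \<open>
  The first pair of values together with the later ones carries the same information as the segment
  that contains all of them.
\<close>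

lemma cond_mean_le_seg_step:
  assumes g: "sets \<gamma> = sets (Rsp2 {t + 1..N})" and s: "t < s" "s \<le> N"
  shows "cond_mean_le \<gamma> ((borel \<Otimes>\<^sub>M borel) \<Otimes>\<^sub>M (Rsp2 {t + 2..s}))
       (\<lambda>w. (pair_at (t + 1) w, seg {t + 2..s} w)) f C \<longleftrightarrow>
     cond_mean_le \<gamma> (Rsp2 {t + 1..s}) (seg {t + 1..s}) f C"
    (is "cond_mean_le \<gamma> ?S ?X f C \<longleftrightarrow> cond_mean_le \<gamma> ?T ?Y f C")
proof
  have e: "{t + 1..s} = {t + 2..s} \<union> {t + 1}" using s by auto
  let ?f = "\<lambda>((a, b), (x, y)). (x(t + 1 := a), y(t + 1 := b)) :: (nat \<Rightarrow> real) \<times> (nat \<Rightarrow> real)"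
  have Y: "?Y \<in> \<gamma> \<rightarrow>\<^sub>M ?T"
    using s by (subst measurable_cong_sets[OF g refl]) (auto intro!: seg_measurable)
  have "pair_at (t + 1) \<in> \<gamma> \<rightarrow>\<^sub>M borel \<Otimes>\<^sub>M borel" "seg {t + 2..s} \<in> \<gamma> \<rightarrow>\<^sub>M Rsp2 {t + 2..s}"
    using s by (auto simp: measurable_cong_sets[OF g refl] intro!: seg_measurable pair_at_measurable)
  then have X: "?X \<in> \<gamma> \<rightarrow>\<^sub>M ?S" by measurable
  {
    assume *: "cond_mean_le \<gamma> ?S ?X f C"
    show "cond_mean_le \<gamma> ?T ?Y f C"
    proof (rule cond_mean_le_coarsen[OF X _ *])
      have "(\<lambda>z. (fst (snd z))(t + 1 := fst (fst z))) \<in> ?S \<rightarrow>\<^sub>M Rsp {t + 1..s}"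
        by (rule measurable_fun_upd[OF e]) auto
      moreover have "(\<lambda>z. (snd (snd z))(t + 1 := snd (fst z))) \<in> ?S \<rightarrow>\<^sub>M Rsp {t + 1..s}"
        by (rule measurable_fun_upd[OF e]) auto
      ultimately show "?f \<in> ?S \<rightarrow>\<^sub>M ?T" by (simp add: split_beta')
      fix w assume "w \<in> space \<gamma>"
      show "seg {t + 1..s} w = ?f (pair_at (t + 1) w, seg {t + 2..s} w)"
        unfolding e by (auto simp: seg_def pair_at_def fun_eq_iff split: prod.split)
    qed
  next
    assume *: "cond_mean_le \<gamma> ?T ?Y f C"
    show "cond_mean_le \<gamma> ?S ?X f C"
    proof (rule cond_mean_le_coarsen[OF Y _ *])
      show "(\<lambda>w. (pair_at (t + 1) w, seg {t + 2..s} w)) \<in> ?T \<rightarrow>\<^sub>M ?S"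
        using s by (intro measurable_Pair seg_measurable pair_at_measurable) auto
      fix w assume "w \<in> space \<gamma>"
      show "(pair_at (t + 1) w, seg {t + 2..s} w) = (pair_at (t + 1) (seg {t + 1..s} w), seg {t + 2..s} (seg {t + 1..s} w))"
        using s by (auto simp: seg_def pair_at_def fun_eq_iff split: prod.split)
    qed
  }
qed

lemma cond_mean_le_seg_empty:
  assumes "prob_space \<gamma>" and f: "f \<in> borel_measurable \<gamma>"
  shows "cond_mean_le \<gamma> (Rsp2 {}) (seg {}) f C \<longleftrightarrow> (\<integral>\<^sup>+w. f w \<partial>\<gamma>) \<le> C"
proof -
  interpret prob_space \<gamma> by fact
  let ?u = "(\<lambda>_::nat. undefined :: real, \<lambda>_::nat. undefined :: real)"
  have u: "seg {} w = ?u" for w by (simp add: seg_def restrict_def split: prod.split)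
  have "?u \<in> space (Rsp2 {})" by (simp add: space_pair_measure space_PiM)
  then have "\<exists>A\<in>sets (Rsp2 {}). ?u \<in> A" by blast
  then show ?thesis
    unfolding cond_mean_le_def u
    by (auto simp: indicator_def emeasure_space_1)
qed

lemma rest_law_is_cond_law:
  assumes g: "\<gamma> \<in> space (prob_algebra (Rsp2 {t + 1..N}))" and t: "t < N"
  shows "is_cond_law \<gamma> (borel \<Otimes>\<^sub>M borel) (pair_at (t + 1)) (Rsp2 {t + 2..N}) (seg {t + 2..N})
     (rest_law N t \<gamma>)"
proof -
  have s: "sets \<gamma> = sets (Rsp2 {t + 1..N})" and p: "prob_space \<gamma>"
    using g by (auto simp: space_prob_algebra)
  have "\<exists>K. is_cond_law \<gamma> (borel \<Otimes>\<^sub>M borel) (pair_at (t + 1)) (Rsp2 {t + 2..N}) (seg {t + 2..N}) K"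
    by (rule ex_cond_law_Rsp_pair)
       (use t p in \<open>auto simp: measurable_cong_sets[OF s refl] intro!: seg_measurable pair_at_measurable\<close>)
  from is_cond_law_cond_law[OF this] show ?thesis
    unfolding rest_law_def pair_at_def seg_def .
qed

text \<open>
  The recursion unfolded: the cost term of step \<open>t\<close> is the bound at \<open>s = t\<close>, where the past is
  empty, and the essential supremum of the functionals of the conditional laws contributes the bounds at the
  later times, since a bound given the full past can be tested after conditioning on the first pair.
\<close>

lemma Ft_le_iff:
  assumes "0 < p" "0 \<le> c" "t \<le> N"
    and "\<gamma> \<in> space (prob_algebra (Rsp2 {t + 1..N}))"
  shows "Ft p N t \<gamma> \<le> ennreal c \<longleftrightarrow>
    (\<forall>s\<in>{t..<N}. cond_mean_le \<gamma> (Rsp2 {t + 1..s}) (seg {t + 1..s})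
       (\<lambda>w. gap p (pair_at (s + 1) w)) (ennreal (c powr p)))"
  using assms(3,4)
proof (induction "N - t" arbitrary: t \<gamma>)
  case 0
  then show ?case by (simp add: Ft.simps)
next
  case (Suc d)
  let ?C = "ennreal (c powr p)"
  let ?S = "borel \<Otimes>\<^sub>M borel :: (real \<times> real) measure" and ?T = "Rsp2 {t + 2..N}"
  let ?K = "rest_law N t \<gamma>" and ?D = "pair_marginal \<gamma> (t + 1)"
  let ?P = "\<lambda>t \<gamma> s. cond_mean_le \<gamma> (Rsp2 {t + 1..s}) (seg {t + 1..s})
       (\<lambda>w. gap p (pair_at (s + 1) w)) ?C"
  have t: "t < N" using Suc(2) by simp
  have s: "sets \<gamma> = sets (Rsp2 {t + 1..N})" and pr: "prob_space \<gamma>"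
    using Suc.prems(2) by (auto simp: space_prob_algebra)
  have t2: "t + 1 + 1 = t + 2" by simp
  have X: "pair_at (t + 1) \<in> \<gamma> \<rightarrow>\<^sub>M ?S" and Y: "seg {t + 2..N} \<in> \<gamma> \<rightarrow>\<^sub>M ?T"
    using t by (auto simp: measurable_cong_sets[OF s refl] intro!: seg_measurable pair_at_measurable)
  have k: "is_cond_law \<gamma> ?S (pair_at (t + 1)) ?T (seg {t + 2..N}) ?K"
    by (rule rest_law_is_cond_law[OF Suc.prems(2) t])
  have D: "?D = distr \<gamma> ?S (pair_at (t + 1))" by (simp add: pair_marginal_def pair_at_def)
  have "Ft p N t \<gamma> \<le> ennreal c \<longleftrightarrow> Cp p ?D \<le> ennreal c \<and> Linf_norm ?D (\<lambda>z. Ft p N (t + 1) (?K z)) \<le> ennreal c"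
    using t by (subst Ft.simps) simp
  also have "Cp p ?D \<le> ennreal c \<longleftrightarrow> ?P t \<gamma> t"
  proof -
    have "Cp p ?D = enn_root p (\<integral>\<^sup>+z. gap p z \<partial>?D)" by (simp add: Cp_def gap_def split_beta')
    also have "(\<integral>\<^sup>+z. gap p z \<partial>?D) = (\<integral>\<^sup>+w. gap p (pair_at (t + 1) w) \<partial>\<gamma>)"
      unfolding D using X by (subst nn_integral_distr) auto
    finally show ?thesis
      using cond_mean_le_seg_empty[OF pr measurable_compose[OF X gap_measurable], of p ?C]
      by (simp add: enn_root_le_iff assms)
  qed
  also have "Linf_norm ?D (\<lambda>z. Ft p N (t + 1) (?K z)) \<le> ennreal c \<longleftrightarrow> (\<forall>s\<in>{t + 1..<N}. ?P t \<gamma> s)"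
  proof -
    have "Linf_norm ?D (\<lambda>z. Ft p N (t + 1) (?K z)) \<le> ennreal c \<longleftrightarrow> (AE z in ?D. Ft p N (t + 1) (?K z) \<le> ennreal c)"
      by (rule Linf_norm_le_iff[OF assms(2)])
    also have "\<dots> \<longleftrightarrow> (AE z in ?D. \<forall>s\<in>{t + 1..<N}. ?P (t + 1) (?K z) s)"
    proof (rule AE_cong)
      fix z assume "z \<in> space ?D"
      then have "z \<in> space ?S" unfolding D by simp
      then have "?K z \<in> space (prob_algebra ?T)"
        using is_cond_law_kernel[OF k] by (rule measurable_space[rotated])
      then show "Ft p N (t + 1) (?K z) \<le> ennreal c \<longleftrightarrow> (\<forall>s\<in>{t + 1..<N}. ?P (t + 1) (?K z) s)"
        using Suc(2) t by (intro Suc(1)) (auto simp: t2)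
    qed
    also have "\<dots> \<longleftrightarrow> (\<forall>s\<in>{t + 1..<N}. AE z in ?D. ?P (t + 1) (?K z) s)"
      by (simp add: AE_ball_countable)
    also have "\<dots> \<longleftrightarrow> (\<forall>s\<in>{t + 1..<N}. ?P t \<gamma> s)"
    proof (intro ball_cong refl)
      fix s' assume s': "s' \<in> {t + 1..<N}"
      let ?W = "Rsp2 {t + 2..s'}"
      have V: "seg {t + 2..s'} \<in> ?T \<rightarrow>\<^sub>M ?W" and g: "pair_at (s' + 1) \<in> ?T \<rightarrow>\<^sub>M ?S"
        using s' by (auto intro!: seg_measurable pair_at_measurable)
      have cg: "countably_generated (?W \<Otimes>\<^sub>M ?S)"
        by (intro countably_generated_pair countably_generated_Rsp countably_generated_borel_real) auto
      have XV: "(\<lambda>w. (pair_at (t + 1) w, seg {t + 2..s'} (seg {t + 2..N} w))) \<in> \<gamma> \<rightarrow>\<^sub>M ?S \<Otimes>\<^sub>M ?W"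
        by (intro measurable_Pair X measurable_compose[OF Y V])
      have l: "\<exists>L. is_cond_law \<gamma> (?S \<Otimes>\<^sub>M ?W) (\<lambda>w. (pair_at (t + 1) w, seg {t + 2..s'} (seg {t + 2..N} w))) ?S
          (\<lambda>w. pair_at (s' + 1) (seg {t + 2..N} w)) L"
        by (rule ex_cond_law_real_pair[OF pr XV measurable_compose[OF Y g]])
      have "(AE z in ?D. ?P (t + 1) (?K z) s') \<longleftrightarrow>
         cond_mean_le \<gamma> (?S \<Otimes>\<^sub>M ?W) (\<lambda>w. (pair_at (t + 1) w, seg {t + 2..s'} (seg {t + 2..N} w)))
           (\<lambda>w. gap p (pair_at (s' + 1) (seg {t + 2..N} w))) ?C"
        unfolding D t2
        by (rule cond_mean_le_conditioned_iff[OF pr X Y V g cg k l gap_measurable, symmetric]) simp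
      also have "(\<lambda>w. (pair_at (t + 1) w, seg {t + 2..s'} (seg {t + 2..N} w))) = (\<lambda>w. (pair_at (t + 1) w, seg {t + 2..s'} w))"
        using s' by (auto simp: seg_def fun_eq_iff)
      also have "(\<lambda>w. gap p (pair_at (s' + 1) (seg {t + 2..N} w))) = (\<lambda>w. gap p (pair_at (s' + 1) w))"
        using s' by (auto simp: seg_def pair_at_def fun_eq_iff)
      also have "cond_mean_le \<gamma> (?S \<Otimes>\<^sub>M ?W) (\<lambda>w. (pair_at (t + 1) w, seg {t + 2..s'} w)) (\<lambda>w. gap p (pair_at (s' + 1) w)) ?C \<longleftrightarrow> ?P t \<gamma> s'"
        using s' by (intro cond_mean_le_seg_step[OF s]) auto
      finally show "(AE z in ?D. ?P (t + 1) (?K z) s') \<longleftrightarrow> ?P t \<gamma> s'" .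
    qed
    finally show ?thesis .
  qed
  also have "?P t \<gamma> t \<and> (\<forall>s\<in>{t + 1..<N}. ?P t \<gamma> s) \<longleftrightarrow> (\<forall>s\<in>{t..<N}. ?P t \<gamma> s)"
  proof -
    have "{t..<N} = insert t {t + 1..<N}" using t by auto
    then show ?thesis by simp
  qed
  finally show ?case .
qed

section \<open>Bicausal couplings\<close>

text \<open>
  The simplifier shall leave the lower bound \<open>1\<close> of the time intervals as the definitions have it.
\<close>

declare One_nat_def [simp del]

text \<open>
  Given the past of both paths, the first path moves according to \<open>\<mu>\<close> and its own past. Including
  \<open>t = 0\<close>, where this is the marginal condition, spares a case distinction later.
\<close>

definition causal :: "nat \<Rightarrow> (nat \<Rightarrow> real) measure \<Rightarrow> ((nat \<Rightarrow> real) \<times> (nat \<Rightarrow> real)) measure \<Rightarrow> bool" where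
  "causal N \<mu> \<gamma> \<longleftrightarrow> (\<forall>t<N. is_cond_law \<gamma> (Rsp2 {1..t}) (seg {1..t})
     borel (\<lambda>w. fst w (t + 1)) (\<lambda>(x, y). next_law \<mu> t x))"

abbreviation swap_law :: "nat \<Rightarrow> ((nat \<Rightarrow> real) \<times> (nat \<Rightarrow> real)) measure \<Rightarrow> ((nat \<Rightarrow> real) \<times> (nat \<Rightarrow> real)) measure" where
  "swap_law N \<gamma> \<equiv> distr \<gamma> (Rsp2 {1..N}) prod.swap"

lemma coord_measurable: "i \<in> I \<Longrightarrow> (\<lambda>x. x i) \<in> Rsp I \<rightarrow>\<^sub>M borel"
  by (rule measurable_component_singleton)

lemma next_law_is_cond_law:
  assumes \<mu>: "\<mu> \<in> space (prob_algebra (Rsp {1..N}))" and t: "t < N"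
  shows "is_cond_law \<mu> (Rsp {1..t}) (\<lambda>x. restrict x {1..t}) borel (\<lambda>x. x (t + 1)) (next_law \<mu> t)"
proof -
  have s: "sets \<mu> = sets (Rsp {1..N})" and p: "prob_space \<mu>" using \<mu> by (auto simp: space_prob_algebra)
  have "\<exists>K. is_cond_law \<mu> (Rsp {1..t}) (\<lambda>x. restrict x {1..t}) borel (\<lambda>x. x (t + 1)) K"
    by (rule ex_cond_law_real[OF p])
       (use t in \<open>auto simp: measurable_cong_sets[OF s refl] intro!: restrict_measurable coord_measurable\<close>)
  from is_cond_law_cond_law[OF this] show ?thesis unfolding next_law_def .
qed

lemma next_pair_law_is_cond_law:
  assumes g: "\<gamma> \<in> space (prob_algebra (Rsp2 {1..N}))" and t: "t < N"
  shows "is_cond_law \<gamma> (Rsp2 {1..t}) (seg {1..t}) (borel \<Otimes>\<^sub>M borel) (pair_at (t + 1)) (next_pair_law \<gamma> t)"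
proof -
  have s: "sets \<gamma> = sets (Rsp2 {1..N})" and p: "prob_space \<gamma>" using g by (auto simp: space_prob_algebra)
  have "\<exists>K. is_cond_law \<gamma> (Rsp2 {1..t}) (seg {1..t}) (borel \<Otimes>\<^sub>M borel) (pair_at (t + 1)) K"
    by (rule ex_cond_law_real_pair[OF p])
       (use t in \<open>auto simp: measurable_cong_sets[OF s refl] intro!: seg_measurable pair_at_measurable\<close>)
  from is_cond_law_cond_law[OF this] show ?thesis unfolding next_pair_law_def seg_def pair_at_def .
qed

lemma couplings_iff:
  assumes "sets \<mu> = sets A" "sets \<nu> = sets B"
  shows "\<gamma> \<in> couplings \<mu> \<nu> \<longleftrightarrow>
    \<gamma> \<in> space (prob_algebra (A \<Otimes>\<^sub>M B)) \<and> distr \<gamma> A fst = \<mu> \<and> distr \<gamma> B snd = \<nu>"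
proof -
  have "sets (\<mu> \<Otimes>\<^sub>M \<nu>) = sets (A \<Otimes>\<^sub>M B)" using assms by (rule sets_pair_measure_cong)
  moreover have "distr \<gamma> \<mu> fst = distr \<gamma> A fst" "distr \<gamma> \<nu> snd = distr \<gamma> B snd"
    using assms by (auto intro!: distr_cong)
  ultimately show ?thesis by (simp add: couplings_def space_prob_algebra)
qed

lemma swap_measurable: "prod.swap \<in> S \<Otimes>\<^sub>M T \<rightarrow>\<^sub>M T \<Otimes>\<^sub>M S"
proof -
  have eq: "prod.swap = (\<lambda>z::'a \<times> 'b. (snd z, fst z))" by auto
  show ?thesis unfolding eq by measurable
qed

lemma is_cond_law_swap:
  assumes g: "\<gamma> \<in> space (prob_algebra (Rsp2 {1..N}))" and t: "t < N"
    and k: "k \<in> Rsp {1..t} \<rightarrow>\<^sub>M prob_algebra borel"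
  shows "is_cond_law (swap_law N \<gamma>) (Rsp2 {1..t}) (seg {1..t}) borel (\<lambda>w. fst w (t + 1)) (\<lambda>(x, y). k x) \<longleftrightarrow>
    is_cond_law \<gamma> (Rsp2 {1..t}) (seg {1..t}) borel (\<lambda>w. snd w (t + 1)) (\<lambda>(x, y). k y)"
proof -
  let ?R = "Rsp {1..N}" and ?S = "Rsp2 {1..t}"
  have kf: "(\<lambda>z. k (fst z)) \<in> ?S \<rightarrow>\<^sub>M prob_algebra borel" and ks: "(\<lambda>z. k (snd z)) \<in> ?S \<rightarrow>\<^sub>M prob_algebra borel"
    by (rule measurable_compose[OF measurable_fst k], rule measurable_compose[OF measurable_snd k])
  have s: "sets \<gamma> = sets (?R \<Otimes>\<^sub>M ?R)" and p: "prob_space \<gamma>" using g by (auto simp: space_prob_algebra)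
  have sw: "prod.swap \<in> \<gamma> \<rightarrow>\<^sub>M ?R \<Otimes>\<^sub>M ?R"
    by (subst measurable_cong_sets[OF s refl]) (rule swap_measurable)
  have swS: "prod.swap \<in> ?S \<rightarrow>\<^sub>M ?S" by (rule swap_measurable)
  have seg: "seg {1..t} \<in> ?R \<Otimes>\<^sub>M ?R \<rightarrow>\<^sub>M ?S" using t by (intro seg_measurable) auto
  have c: "(\<lambda>x. x (t + 1)) \<in> ?R \<rightarrow>\<^sub>M borel" using t by (intro coord_measurable) auto
  have f1: "(\<lambda>w. fst w (t + 1)) \<in> ?R \<Otimes>\<^sub>M ?R \<rightarrow>\<^sub>M borel" by (rule measurable_compose[OF measurable_fst c])
  have f2: "(\<lambda>w. snd w (t + 1)) \<in> \<gamma> \<rightarrow>\<^sub>M borel"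
    by (subst measurable_cong_sets[OF s refl]) (rule measurable_compose[OF measurable_snd c])
  have seg1: "seg {1..t} \<in> \<gamma> \<rightarrow>\<^sub>M ?S" using seg by (subst measurable_cong_sets[OF s refl])
  have seg2: "(\<lambda>w. seg {1..t} (prod.swap w)) \<in> \<gamma> \<rightarrow>\<^sub>M ?S" by (rule measurable_compose[OF sw seg])
  have e: "prod.swap (seg {1..t} w) = seg {1..t} (prod.swap w)" "prod.swap (seg {1..t} (prod.swap w)) = seg {1..t} w" for w
    by (simp_all add: seg_def split: prod.split)
  have "is_cond_law (swap_law N \<gamma>) ?S (seg {1..t}) borel (\<lambda>w. fst w (t + 1)) (\<lambda>(x, y). k x) \<longleftrightarrow>
    is_cond_law \<gamma> ?S (\<lambda>w. seg {1..t} (prod.swap w)) borel (\<lambda>w. snd w (t + 1)) (\<lambda>(x, y). k x)"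
    using is_cond_law_distr[OF sw seg f1] by simp
  also have "\<dots> \<longleftrightarrow> is_cond_law \<gamma> ?S (seg {1..t}) borel (\<lambda>w. snd w (t + 1)) (\<lambda>(x, y). k y)"
  proof
    assume "is_cond_law \<gamma> ?S (\<lambda>w. seg {1..t} (prod.swap w)) borel (\<lambda>w. snd w (t + 1)) (\<lambda>(x, y). k x)"
    then have "is_cond_law \<gamma> ?S (\<lambda>w. prod.swap (seg {1..t} (prod.swap w))) borel (\<lambda>w. snd w (t + 1)) (\<lambda>(x, y). k y)"
      by (intro is_cond_law_coarsen[OF p seg2 f2 swS]) (simp_all add: split_beta' kf ks)
    then show "is_cond_law \<gamma> ?S (seg {1..t}) borel (\<lambda>w. snd w (t + 1)) (\<lambda>(x, y). k y)" by (simp only: e swap_swap)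
  next
    assume "is_cond_law \<gamma> ?S (seg {1..t}) borel (\<lambda>w. snd w (t + 1)) (\<lambda>(x, y). k y)"
    then have "is_cond_law \<gamma> ?S (\<lambda>w. prod.swap (seg {1..t} w)) borel (\<lambda>w. snd w (t + 1)) (\<lambda>(x, y). k x)"
      by (intro is_cond_law_coarsen[OF p seg1 f2 swS]) (simp_all add: split_beta' kf ks)
    then show "is_cond_law \<gamma> ?S (\<lambda>w. seg {1..t} (prod.swap w)) borel (\<lambda>w. snd w (t + 1)) (\<lambda>(x, y). k x)"
      by (simp only: e swap_swap)
  qed
  finally show ?thesis .
qed

lemma AE_eq_iff_is_cond_law:
  assumes M: "prob_space M" and X: "X \<in> M \<rightarrow>\<^sub>M S" and Y: "Y \<in> M \<rightarrow>\<^sub>M T" and T: "countably_generated T"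
    and K: "is_cond_law M S X T Y K" and K': "K' \<in> S \<rightarrow>\<^sub>M prob_algebra T"
  shows "(AE w in M. K (X w) = K' (X w)) \<longleftrightarrow> is_cond_law M S X T Y K'"
  using is_cond_law_AE_cong[OF M X Y K K'] AE_distrD[OF X is_cond_law_unique[OF M X Y T K]] by blast

text \<open>
  The marginals of a conditional law of the pair are conditional laws of its components. By uniqueness they agree
  almost everywhere with the prescribed kernels iff those kernels are conditional laws, too.
\<close>

lemma bicausal_step_iff:
  assumes \<mu>: "\<mu> \<in> space (prob_algebra (Rsp {1..N}))" and \<nu>: "\<nu> \<in> space (prob_algebra (Rsp {1..N}))"
    and g: "\<gamma> \<in> space (prob_algebra (Rsp2 {1..N}))" and t: "t < N"
  shows "(AE (x, y) in \<gamma>. next_pair_law \<gamma> t (restrict x {1..t}, restrict y {1..t})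
             \<in> couplings (next_law \<mu> t (restrict x {1..t})) (next_law \<nu> t (restrict y {1..t}))) \<longleftrightarrow>
     is_cond_law \<gamma> (Rsp2 {1..t}) (seg {1..t}) borel (\<lambda>w. fst w (t + 1)) (\<lambda>(x, y). next_law \<mu> t x) \<and>
     is_cond_law \<gamma> (Rsp2 {1..t}) (seg {1..t}) borel (\<lambda>w. snd w (t + 1)) (\<lambda>(x, y). next_law \<nu> t y)"
proof -
  let ?R = "Rsp {1..N}" and ?S = "Rsp2 {1..t}" and ?B = "borel :: real measure"
  let ?K = "next_pair_law \<gamma> t"
  have s: "sets \<gamma> = sets (?R \<Otimes>\<^sub>M ?R)" and p: "prob_space \<gamma>" using g by (auto simp: space_prob_algebra)
  have X: "seg {1..t} \<in> \<gamma> \<rightarrow>\<^sub>M ?S" and Y: "pair_at (t + 1) \<in> \<gamma> \<rightarrow>\<^sub>M ?B \<Otimes>\<^sub>M ?B"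
    using t by (auto simp: measurable_cong_sets[OF s refl] intro!: seg_measurable pair_at_measurable)
  note k\<mu>[measurable] = is_cond_law_kernel[OF next_law_is_cond_law[OF \<mu> t]]
  note k\<nu>[measurable] = is_cond_law_kernel[OF next_law_is_cond_law[OF \<nu> t]]
  note k = next_pair_law_is_cond_law[OF g t]
  have k1: "is_cond_law \<gamma> ?S (seg {1..t}) ?B (\<lambda>w. fst w (t + 1)) (\<lambda>a. distr (?K a) ?B fst)"
    using is_cond_law_push[OF p X Y measurable_fst k] by (simp add: pair_at_def split_beta')
  have k2: "is_cond_law \<gamma> ?S (seg {1..t}) ?B (\<lambda>w. snd w (t + 1)) (\<lambda>a. distr (?K a) ?B snd)"
    using is_cond_law_push[OF p X Y measurable_snd k] by (simp add: pair_at_def split_beta')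
  have f: "(\<lambda>w. fst w (t + 1)) \<in> \<gamma> \<rightarrow>\<^sub>M ?B" "(\<lambda>w. snd w (t + 1)) \<in> \<gamma> \<rightarrow>\<^sub>M ?B"
    using measurable_compose[OF Y measurable_fst] measurable_compose[OF Y measurable_snd]
    by (simp_all add: pair_at_def split_beta')
  have "(AE (x, y) in \<gamma>. ?K (restrict x {1..t}, restrict y {1..t})
             \<in> couplings (next_law \<mu> t (restrict x {1..t})) (next_law \<nu> t (restrict y {1..t}))) \<longleftrightarrow>
     (AE w in \<gamma>. distr (?K (seg {1..t} w)) ?B fst = (\<lambda>(x, y). next_law \<mu> t x) (seg {1..t} w) \<and>
       distr (?K (seg {1..t} w)) ?B snd = (\<lambda>(x, y). next_law \<nu> t y) (seg {1..t} w))"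
  proof (rule AE_cong)
    fix w assume w: "w \<in> space \<gamma>"
    obtain x y where xy: "w = (x, y)" by (cases w)
    have w': "seg {1..t} w \<in> space ?S" using X w by (rule measurable_space)
    then have "restrict x {1..t} \<in> space (Rsp {1..t})" "restrict y {1..t} \<in> space (Rsp {1..t})"
      by (auto simp: xy seg_def space_pair_measure)
    then have sB: "sets (next_law \<mu> t (restrict x {1..t})) = sets ?B" "sets (next_law \<nu> t (restrict y {1..t})) = sets ?B"
      using kernel_at(2)[OF k\<mu>] kernel_at(2)[OF k\<nu>] by auto
    have "?K (seg {1..t} w) \<in> space (prob_algebra (?B \<Otimes>\<^sub>M ?B))"
      using is_cond_law_kernel[OF k] w' by (rule measurable_space)
    then show "(case w of (x, y) \<Rightarrow> ?K (restrict x {1..t}, restrict y {1..t})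
             \<in> couplings (next_law \<mu> t (restrict x {1..t})) (next_law \<nu> t (restrict y {1..t}))) \<longleftrightarrow>
      distr (?K (seg {1..t} w)) ?B fst = (\<lambda>(x, y). next_law \<mu> t x) (seg {1..t} w) \<and>
       distr (?K (seg {1..t} w)) ?B snd = (\<lambda>(x, y). next_law \<nu> t y) (seg {1..t} w)"
      by (simp add: xy seg_def couplings_iff[OF sB])
  qed
  also have "\<dots> \<longleftrightarrow> (AE w in \<gamma>. distr (?K (seg {1..t} w)) ?B fst = (\<lambda>(x, y). next_law \<mu> t x) (seg {1..t} w)) \<and>
       (AE w in \<gamma>. distr (?K (seg {1..t} w)) ?B snd = (\<lambda>(x, y). next_law \<nu> t y) (seg {1..t} w))"
    by (rule AE_conj_iff)
  also have "(AE w in \<gamma>. distr (?K (seg {1..t} w)) ?B fst = (\<lambda>(x, y). next_law \<mu> t x) (seg {1..t} w)) \<longleftrightarrow>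
     is_cond_law \<gamma> ?S (seg {1..t}) ?B (\<lambda>w. fst w (t + 1)) (\<lambda>(x, y). next_law \<mu> t x)"
    by (rule AE_eq_iff_is_cond_law[OF p X f(1) countably_generated_borel_real k1]) measurable
  also have "(AE w in \<gamma>. distr (?K (seg {1..t} w)) ?B snd = (\<lambda>(x, y). next_law \<nu> t y) (seg {1..t} w)) \<longleftrightarrow>
     is_cond_law \<gamma> ?S (seg {1..t}) ?B (\<lambda>w. snd w (t + 1)) (\<lambda>(x, y). next_law \<nu> t y)"
    by (rule AE_eq_iff_is_cond_law[OF p X f(2) countably_generated_borel_real k2]) measurable
  finally show ?thesis .
qed

text \<open>
  At time \<open>0\<close> there is no past, so that the marginal of a coupling already gives the causality condition.
\<close>

lemma is_cond_law_time_zero: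
  assumes g: "\<gamma> \<in> space (prob_algebra (Rsp2 {1..N}))" and N: "0 < N"
    and \<mu>: "\<mu> \<in> space (prob_algebra (Rsp {1..N}))" and d: "distr \<gamma> (Rsp {1..N}) fst = \<mu>"
  shows "is_cond_law \<gamma> (Rsp2 {1..0}) (seg {1..0}) borel (\<lambda>w. fst w (0 + 1)) (\<lambda>(x, y). next_law \<mu> 0 x)"
proof -
  let ?R = "Rsp {1..N}" and ?S = "Rsp {1..0}"
  have s: "sets \<gamma> = sets (?R \<Otimes>\<^sub>M ?R)" and p: "prob_space \<gamma>" using g by (auto simp: space_prob_algebra)
  have f: "fst \<in> \<gamma> \<rightarrow>\<^sub>M ?R" by (subst measurable_cong_sets[OF s refl]) simp
  have r: "(\<lambda>x. restrict x {1..0}) \<in> ?R \<rightarrow>\<^sub>M ?S" and c: "(\<lambda>x. x (0 + 1)) \<in> ?R \<rightarrow>\<^sub>M borel"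
    using N by (auto intro!: restrict_measurable coord_measurable)
  note n = next_law_is_cond_law[OF \<mu> N]
  note [measurable] = is_cond_law_kernel[OF n]
  have m: "(\<lambda>(x, y). next_law \<mu> 0 x) \<in> ?S \<Otimes>\<^sub>M ?S \<rightarrow>\<^sub>M prob_algebra borel" by measurable
  have "is_cond_law \<gamma> ?S (\<lambda>w. restrict (fst w) {1..0}) borel (\<lambda>w. fst w (0 + 1)) (next_law \<mu> 0)"
    using n is_cond_law_distr[OF f r c] unfolding d by blast
  then have "is_cond_law \<gamma> (?S \<Otimes>\<^sub>M ?S) (\<lambda>w. (restrict (fst w) {1..0}, restrict (fst w) {1..0})) borel (\<lambda>w. fst w (0 + 1)) (\<lambda>(x, y). next_law \<mu> 0 x)"
    by (intro is_cond_law_coarsen[where f="\<lambda>u. (u, u)", OF p measurable_compose[OF f r] measurable_compose[OF f c] _ m])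
       (simp_all only: case_prod_conv measurable_Pair measurable_ident_sets)
  also have "(\<lambda>w. (restrict (fst w) {1..0}, restrict (fst w) {1..0})) = seg {1..0}"
    by (rule ext) (simp add: seg_def restrict_def split: prod.split)
  finally show ?thesis .
qed

lemma swap_law_prob:
  assumes g: "\<gamma> \<in> space (prob_algebra (Rsp2 {1..N}))"
  shows "swap_law N \<gamma> \<in> space (prob_algebra (Rsp2 {1..N}))"
    "distr (swap_law N \<gamma>) (Rsp {1..N}) fst = distr \<gamma> (Rsp {1..N}) snd"
    "distr (swap_law N \<gamma>) (Rsp {1..N}) snd = distr \<gamma> (Rsp {1..N}) fst"
    "swap_law N (swap_law N \<gamma>) = \<gamma>"
proof -
  let ?R = "Rsp {1..N}"
  have s: "sets \<gamma> = sets (?R \<Otimes>\<^sub>M ?R)" and p: "prob_space \<gamma>" using g by (auto simp: space_prob_algebra)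
  have sw: "prod.swap \<in> \<gamma> \<rightarrow>\<^sub>M ?R \<Otimes>\<^sub>M ?R"
    by (subst measurable_cong_sets[OF s refl]) (rule swap_measurable)
  have sw': "prod.swap \<in> ?R \<Otimes>\<^sub>M ?R \<rightarrow>\<^sub>M ?R \<Otimes>\<^sub>M ?R" by (rule swap_measurable)
  show "swap_law N \<gamma> \<in> space (prob_algebra (?R \<Otimes>\<^sub>M ?R))"
    using prob_space.prob_space_distr[OF p sw] by (simp add: space_prob_algebra)
  show "distr (swap_law N \<gamma>) ?R fst = distr \<gamma> ?R snd" "distr (swap_law N \<gamma>) ?R snd = distr \<gamma> ?R fst"
    using sw by (auto simp: distr_distr comp_def)
  show "swap_law N (swap_law N \<gamma>) = \<gamma>"
    using sw sw' distr_id2[OF s[symmetric]] by (simp add: distr_distr comp_def id_def)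
qed

text \<open>
  Causality of the second path is expressed by swapping the coupling, so that one-sided results suffice below.
\<close>

lemma bicausal_iff:
  assumes \<mu>: "\<mu> \<in> space (prob_algebra (Rsp {1..N}))" and \<nu>: "\<nu> \<in> space (prob_algebra (Rsp {1..N}))" and N: "1 \<le> N"
  shows "\<gamma> \<in> bicausal_couplings N \<mu> \<nu> \<longleftrightarrow>
    \<gamma> \<in> space (prob_algebra (Rsp2 {1..N})) \<and> distr \<gamma> (Rsp {1..N}) fst = \<mu> \<and> distr \<gamma> (Rsp {1..N}) snd = \<nu> \<and>
    causal N \<mu> \<gamma> \<and> causal N \<nu> (swap_law N \<gamma>)"
proof -
  let ?R = "Rsp {1..N}" and ?S = "\<lambda>t. Rsp2 {1..t}"
  let ?c1 = "\<lambda>t. is_cond_law \<gamma> (?S t) (seg {1..t}) borel (\<lambda>w. fst w (t + 1)) (\<lambda>(x, y). next_law \<mu> t x)"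
  let ?c2 = "\<lambda>t. is_cond_law \<gamma> (?S t) (seg {1..t}) borel (\<lambda>w. snd w (t + 1)) (\<lambda>(x, y). next_law \<nu> t y)"
  have s\<mu>: "sets \<mu> = sets ?R" and s\<nu>: "sets \<nu> = sets ?R" using \<mu> \<nu> by (auto simp: space_prob_algebra)
  note cpl = couplings_iff[OF s\<mu> s\<nu>]
  show ?thesis
  proof (cases "\<gamma> \<in> couplings \<mu> \<nu>")
    case False
    then show ?thesis by (auto simp: bicausal_couplings_def cpl)
  next
    case True
    then have g: "\<gamma> \<in> space (prob_algebra (?R \<Otimes>\<^sub>M ?R))" and d: "distr \<gamma> ?R fst = \<mu>" "distr \<gamma> ?R snd = \<nu>"
      by (auto simp: cpl)
    have s: "sets \<gamma> = sets (?R \<Otimes>\<^sub>M ?R)" and p: "prob_space \<gamma>" using g by (auto simp: space_prob_algebra)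
    have c: "(\<lambda>x. x 1) \<in> ?R \<rightarrow>\<^sub>M borel" using N by (intro coord_measurable) auto
    have f: "fst \<in> \<gamma> \<rightarrow>\<^sub>M ?R" "snd \<in> \<gamma> \<rightarrow>\<^sub>M ?R" by (auto simp: measurable_cong_sets[OF s refl])
    have at1: "pair_at 1 \<in> \<gamma> \<rightarrow>\<^sub>M borel \<Otimes>\<^sub>M borel"
      using N by (subst measurable_cong_sets[OF s refl]) (auto intro!: pair_at_measurable)
    have m1: "pair_marginal \<gamma> 1 = distr \<gamma> (borel \<Otimes>\<^sub>M borel) (pair_at 1)"
      by (simp add: pair_marginal_def pair_at_def)
    have "pair_marginal \<gamma> 1 \<in> couplings (distr \<mu> borel (\<lambda>x. x 1)) (distr \<nu> borel (\<lambda>y. y 1))"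
      unfolding couplings_iff[where A=borel and B=borel, OF sets_distr sets_distr]
    proof (intro conjI)
      show "pair_marginal \<gamma> 1 \<in> space (prob_algebra (borel \<Otimes>\<^sub>M borel))"
        unfolding m1 using prob_space.prob_space_distr[OF p at1] by (simp add: space_prob_algebra)
      show "distr (pair_marginal \<gamma> 1) borel fst = distr \<mu> borel (\<lambda>x. x 1)"
        "distr (pair_marginal \<gamma> 1) borel snd = distr \<nu> borel (\<lambda>x. x 1)"
        unfolding m1 d[symmetric] using at1 f c
        by (simp_all add: distr_distr comp_def pair_at_def split_beta')
    qed
    then have "\<gamma> \<in> bicausal_couplings N \<mu> \<nu> \<longleftrightarrow> (\<forall>t\<in>{1..<N}. ?c1 t \<and> ?c2 t)"
      using True bicausal_step_iff[OF \<mu> \<nu> g] by (simp add: bicausal_couplings_def)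
    also have "\<dots> \<longleftrightarrow> (\<forall>t<N. ?c1 t \<and> ?c2 t)"
    proof -
      have N0: "0 < N" using N by simp
      have c1: "?c1 0" by (rule is_cond_law_time_zero[OF g N0 \<mu> d(1)])
      have sw: "is_cond_law (swap_law N \<gamma>) (?S 0) (seg {1..0}) borel (\<lambda>w. fst w (0 + 1)) (\<lambda>(x, y). next_law \<nu> 0 x)"
        by (rule is_cond_law_time_zero[OF swap_law_prob(1)[OF g] N0 \<nu>]) (simp add: swap_law_prob(2)[OF g] d)
      have c2: "?c2 0"
        using sw is_cond_law_swap[OF g N0 is_cond_law_kernel[OF next_law_is_cond_law[OF \<nu> N0]]] by blast
      show ?thesis
      proof (intro iffI ballI allI impI)
        fix t assume *: "\<forall>t\<in>{1..<N}. ?c1 t \<and> ?c2 t" and t: "t < N"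
        show "?c1 t \<and> ?c2 t"
        proof (cases "t = 0")
          case True with c1 c2 show ?thesis by blast
        next
          case False
          with t have "t \<in> {1..<N}" by simp
          with * show ?thesis by blast
        qed
      next
        fix t assume *: "\<forall>t<N. ?c1 t \<and> ?c2 t" and t: "t \<in> {1..<N}"
        then have "t < N" by simp
        with * show "?c1 t \<and> ?c2 t" by blast
      qed
    qed
    also have "\<dots> \<longleftrightarrow> causal N \<mu> \<gamma> \<and> causal N \<nu> (swap_law N \<gamma>)"
    proof -
      have "?c2 t \<longleftrightarrow> is_cond_law (swap_law N \<gamma>) (?S t) (seg {1..t}) borel (\<lambda>w. fst w (t + 1)) (\<lambda>(x, y). next_law \<nu> t x)"
        if "t < N" for t
        using is_cond_law_swap[OF g that is_cond_law_kernel[OF next_law_is_cond_law[OF \<nu> that]]] by blast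
      then show ?thesis unfolding causal_def by blast
    qed
    finally show ?thesis using g d by blast
  qed
qed

section \<open>Gluing couplings\<close>

lemma causal_kernel:
  assumes "causal N \<mu> \<gamma>" "t < N"
  shows "next_law \<mu> t \<in> Rsp {1..t} \<rightarrow>\<^sub>M prob_algebra borel"
proof -
  have "(\<lambda>(x, y). next_law \<mu> t x) \<in> Rsp2 {1..t} \<rightarrow>\<^sub>M prob_algebra borel"
    using assms is_cond_law_kernel unfolding causal_def by blast
  from measurable_compose[OF _ this, of "\<lambda>x. (x, x)" "Rsp {1..t}"] show ?thesis by simp
qed

text \<open>
  Under a causal coupling the past of the second path depends on the whole first path only through the past of the
  latter. The first path is revealed step by step: each new step is independent of the second path's past
  given the steps before it, hence by \<open>is_cond_law_exchange\<close> revealing it does not change the law of that past.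
\<close>

lemma causal_past:
  assumes g: "\<gamma> \<in> space (prob_algebra (Rsp2 {1..N}))" and c: "causal N \<nu> \<gamma>" and t: "t \<le> N"
  shows "\<exists>k. k \<in> Rsp {1..t} \<rightarrow>\<^sub>M prob_algebra (Rsp {1..t}) \<and>
    is_cond_law \<gamma> (Rsp {1..N}) fst (Rsp {1..t}) (\<lambda>w. restrict (snd w) {1..t}) (\<lambda>a. k (restrict a {1..t}))"
proof -
  let ?R = "Rsp {1..N}"
  have s: "sets \<gamma> = sets (?R \<Otimes>\<^sub>M ?R)" and p: "prob_space \<gamma>" using g by (auto simp: space_prob_algebra)
  have fst: "fst \<in> \<gamma> \<rightarrow>\<^sub>M ?R" and snd: "snd \<in> \<gamma> \<rightarrow>\<^sub>M ?R" by (auto simp: measurable_cong_sets[OF s refl])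
  have X: "(\<lambda>w. restrict (fst w) {1..r}) \<in> \<gamma> \<rightarrow>\<^sub>M Rsp {1..r}" if "r \<le> N" for r
    using that by (intro measurable_compose[OF fst restrict_measurable]) auto
  have Z: "(\<lambda>w. restrict (snd w) {1..t}) \<in> \<gamma> \<rightarrow>\<^sub>M Rsp {1..t}"
    using t by (intro measurable_compose[OF snd restrict_measurable]) auto
  obtain k where k: "is_cond_law \<gamma> (Rsp {1..t}) (\<lambda>w. restrict (fst w) {1..t}) (Rsp {1..t}) (\<lambda>w. restrict (snd w) {1..t}) k"
    using ex_cond_law_Rsp[OF _ p X[OF t] Z] by blast
  note km = is_cond_law_kernel[OF k]
  have rt: "(\<lambda>a. restrict a {1..t}) \<in> Rsp {1..r} \<rightarrow>\<^sub>M Rsp {1..t}" if "t \<le> r" for r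
    using that by (intro restrict_measurable) auto
  have kr: "(\<lambda>a. k (restrict a {1..t})) \<in> Rsp {1..r} \<rightarrow>\<^sub>M prob_algebra (Rsp {1..t})" if "t \<le> r" for r
    by (rule measurable_compose[OF rt[OF that] km])
  have "r \<le> N \<Longrightarrow> is_cond_law \<gamma> (Rsp {1..r}) (\<lambda>w. restrict (fst w) {1..r}) (Rsp {1..t}) (\<lambda>w. restrict (snd w) {1..t})
     (\<lambda>a. k (restrict a {1..t}))" if "t \<le> r" for r
    using that
  proof (induction r rule: dec_induct)
    case base
    have "is_cond_law \<gamma> (Rsp {1..t}) (\<lambda>w. restrict (restrict (fst w) {1..t}) {1..t}) (Rsp {1..t}) (\<lambda>w. restrict (snd w) {1..t}) (\<lambda>a. k (restrict a {1..t}))"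
    proof (rule is_cond_law_coarsen[OF p X[OF t] Z rt[OF order_refl] kr[OF order_refl]])
      show "is_cond_law \<gamma> (Rsp {1..t}) (\<lambda>w. restrict (fst w) {1..t}) (Rsp {1..t}) (\<lambda>w. restrict (snd w) {1..t})
        (\<lambda>a. k (restrict (restrict a {1..t}) {1..t}))"
      proof (rule is_cond_law_AE_cong[OF p X[OF t] Z k])
        show "(\<lambda>a. k (restrict (restrict a {1..t}) {1..t})) \<in> Rsp {1..t} \<rightarrow>\<^sub>M prob_algebra (Rsp {1..t})"
          using kr[OF order_refl] by simp
      qed simp
    qed
    then show ?case by (simp only: restrict_restrict Int_absorb)
  next
    case (step r)
    then have r: "r < N" by simp
    note n = causal_kernel[OF c r]
    have Y: "(\<lambda>w. fst w (r + 1)) \<in> \<gamma> \<rightarrow>\<^sub>M borel"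
      using r by (intro measurable_compose[OF fst coord_measurable]) auto
    have seg: "seg {1..r} \<in> \<gamma> \<rightarrow>\<^sub>M Rsp2 {1..r}"
      using r by (subst measurable_cong_sets[OF s refl]) (auto intro!: seg_measurable)
    have IH: "is_cond_law \<gamma> (Rsp {1..r}) (\<lambda>w. restrict (fst w) {1..r}) (Rsp {1..t}) (\<lambda>w. restrict (snd w) {1..t})
      (\<lambda>a. k (restrict a {1..t}))" by (rule step.IH[OF less_imp_le[OF r]])
    \<comment> \<open>Causality at time r, with the past of the second path cut down to the times up to t.\<close>
    have XZ: "is_cond_law \<gamma> (Rsp {1..r} \<Otimes>\<^sub>M Rsp {1..t}) (\<lambda>w. (restrict (fst w) {1..r}, restrict (snd w) {1..t})) borel
        (\<lambda>w. fst w (r + 1)) (\<lambda>(a, c). next_law \<nu> r a)"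
    proof -
      note [measurable] = n rt[OF step.hyps(1)]
      have "is_cond_law \<gamma> (Rsp {1..r} \<Otimes>\<^sub>M Rsp {1..t}) (\<lambda>w. (\<lambda>(a, b). (a, restrict b {1..t})) (seg {1..r} w)) borel
        (\<lambda>w. fst w (r + 1)) (\<lambda>(a, c). next_law \<nu> r a)"
      proof (rule is_cond_law_coarsen[OF p seg Y])
        show "(\<lambda>(a, b). (a, restrict b {1..t})) \<in> Rsp2 {1..r} \<rightarrow>\<^sub>M Rsp {1..r} \<Otimes>\<^sub>M Rsp {1..t}"
          by measurable
        show "(\<lambda>(a, c). next_law \<nu> r a) \<in> Rsp {1..r} \<Otimes>\<^sub>M Rsp {1..t} \<rightarrow>\<^sub>M prob_algebra borel" by measurable
        have "is_cond_law \<gamma> (Rsp2 {1..r}) (seg {1..r}) borel (\<lambda>w. fst w (r + 1)) (\<lambda>(x, y). next_law \<nu> r x)"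
          using c r by (simp only: causal_def)
        then show "is_cond_law \<gamma> (Rsp2 {1..r}) (seg {1..r}) borel (\<lambda>w. fst w (r + 1))
           (\<lambda>v. (\<lambda>(a, c). next_law \<nu> r a) ((\<lambda>(a, b). (a, restrict b {1..t})) v))"
          by (simp only: split_beta' fst_conv)
      qed
      also have "(\<lambda>w. (\<lambda>(a, b). (a, restrict b {1..t})) (seg {1..r} w)) = (\<lambda>w. (restrict (fst w) {1..r}, restrict (snd w) {1..t}))"
        using step.hyps(1) by (auto simp: seg_def fun_eq_iff)
      finally show ?thesis .
    qed
    have e: "insert (r + 1) {1..r} = {1..Suc r}" by auto
    have upd: "(\<lambda>(a, b). a(r + 1 := b)) \<in> Rsp {1..r} \<Otimes>\<^sub>M borel \<rightarrow>\<^sub>M Rsp {1..Suc r}"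
      using measurable_add_dim[of "r + 1" "{1..r}" "\<lambda>_. borel :: real measure"] unfolding e .
    have XY: "(\<lambda>w. (restrict (fst w) {1..r}, fst w (r + 1))) \<in> \<gamma> \<rightarrow>\<^sub>M Rsp {1..r} \<Otimes>\<^sub>M borel"
      using r by (intro measurable_Pair X Y) auto
    have "is_cond_law \<gamma> (Rsp {1..r} \<Otimes>\<^sub>M borel) (\<lambda>w. (restrict (fst w) {1..r}, fst w (r + 1))) (Rsp {1..t})
       (\<lambda>w. restrict (snd w) {1..t}) (\<lambda>(a, b). k (restrict a {1..t}))"
      using r by (intro is_cond_law_exchange[OF p X Y Z IH n XZ]) auto
    also have "(\<lambda>(a, b). k (restrict a {1..t})) = (\<lambda>z. k (restrict ((\<lambda>(a, b). a(r + 1 := b)) z) {1..t}))"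
      using step.hyps(1) by (auto simp: fun_eq_iff intro!: arg_cong[where f=k])
    finally have 2: "is_cond_law \<gamma> (Rsp {1..r} \<Otimes>\<^sub>M borel) (\<lambda>w. (restrict (fst w) {1..r}, fst w (r + 1))) (Rsp {1..t})
       (\<lambda>w. restrict (snd w) {1..t}) (\<lambda>z. k (restrict ((\<lambda>(a, b). a(r + 1 := b)) z) {1..t}))" .
    have tr: "t \<le> Suc r" using step.hyps(1) by simp
    have "is_cond_law \<gamma> (Rsp {1..Suc r}) (\<lambda>w. (\<lambda>(a, b). a(r + 1 := b)) (restrict (fst w) {1..r}, fst w (r + 1))) (Rsp {1..t})
       (\<lambda>w. restrict (snd w) {1..t}) (\<lambda>a. k (restrict a {1..t}))"
      by (rule is_cond_law_coarsen[where f="\<lambda>(a, b). a(r + 1 := b)" and K="\<lambda>a. k (restrict a {1..t})",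
            OF p XY Z upd kr[OF tr] 2])
    also have "(\<lambda>w. (\<lambda>(a, b). a(r + 1 := b)) (restrict (fst w) {1..r}, fst w (r + 1))) = (\<lambda>w. restrict (fst w) {1..Suc r})"
      unfolding e[symmetric] by (auto simp: fun_eq_iff)
    finally show ?case .
  qed
  from this[OF t order_refl]
  have "is_cond_law \<gamma> ?R (\<lambda>w. restrict (fst w) {1..N}) (Rsp {1..t}) (\<lambda>w. restrict (snd w) {1..t}) (\<lambda>a. k (restrict a {1..t}))" .
  also have "?this \<longleftrightarrow> is_cond_law \<gamma> ?R fst (Rsp {1..t}) (\<lambda>w. restrict (snd w) {1..t}) (\<lambda>a. k (restrict a {1..t}))"
  proof -
    have "restrict (fst w) {1..N} = fst w" if "w \<in> space \<gamma>" for w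
      using measurable_space[OF fst that] by (auto simp: space_PiM PiE_iff intro: extensional_restrict)
    then show ?thesis unfolding is_cond_law_def by (simp cong: distr_cong)
  qed
  finally show ?thesis using km by blast
qed

text \<open>
  The path \<open>z\<close> is independent of \<open>x\<close> given \<open>y\<close>.
\<close>

definition markov_triple :: "nat \<Rightarrow> 'w measure \<Rightarrow> ('w \<Rightarrow> nat \<Rightarrow> real) \<Rightarrow> ('w \<Rightarrow> nat \<Rightarrow> real) \<Rightarrow> ('w \<Rightarrow> nat \<Rightarrow> real) \<Rightarrow> bool" where
  "markov_triple N M x y z \<longleftrightarrow> prob_space M \<and>
     x \<in> M \<rightarrow>\<^sub>M Rsp {1..N} \<and> y \<in> M \<rightarrow>\<^sub>M Rsp {1..N} \<and> z \<in> M \<rightarrow>\<^sub>M Rsp {1..N} \<and>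
     (\<exists>K\<in>Rsp {1..N} \<rightarrow>\<^sub>M prob_algebra (Rsp {1..N}).
        is_cond_law M (Rsp2 {1..N}) (\<lambda>w. (x w, y w)) (Rsp {1..N}) z (\<lambda>(a, b). K b))"

abbreviation pair_law :: "nat \<Rightarrow> 'w measure \<Rightarrow> ('w \<Rightarrow> nat \<Rightarrow> real) \<Rightarrow> ('w \<Rightarrow> nat \<Rightarrow> real) \<Rightarrow> ((nat \<Rightarrow> real) \<times> (nat \<Rightarrow> real)) measure" where
  "pair_law N M x y \<equiv> distr M (Rsp2 {1..N}) (\<lambda>w. (x w, y w))"

lemma markov_triple_sym:
  assumes "markov_triple N M x y z"
  shows "markov_triple N M z y x"
proof -
  let ?R = "Rsp {1..N}"
  from assms obtain K where p: "prob_space M"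
    and x[measurable]: "x \<in> M \<rightarrow>\<^sub>M ?R" and y[measurable]: "y \<in> M \<rightarrow>\<^sub>M ?R" and z[measurable]: "z \<in> M \<rightarrow>\<^sub>M ?R"
    and K[measurable]: "K \<in> ?R \<rightarrow>\<^sub>M prob_algebra ?R" and c: "is_cond_law M (?R \<Otimes>\<^sub>M ?R) (\<lambda>w. (x w, y w)) ?R z (\<lambda>(a, b). K b)"
    unfolding markov_triple_def by blast
  obtain K1 where K1: "is_cond_law M ?R y ?R x K1" using ex_cond_law_Rsp[OF _ p y x] by blast
  note [measurable] = is_cond_law_kernel[OF K1]
  have xy: "(\<lambda>w. (x w, y w)) \<in> M \<rightarrow>\<^sub>M ?R \<Otimes>\<^sub>M ?R" and yz: "(\<lambda>w. (y w, z w)) \<in> M \<rightarrow>\<^sub>M ?R \<Otimes>\<^sub>M ?R" by simp_all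
  have sw: "prod.swap \<in> ?R \<Otimes>\<^sub>M ?R \<rightarrow>\<^sub>M ?R \<Otimes>\<^sub>M ?R" by (rule swap_measurable)
  have "is_cond_law M (?R \<Otimes>\<^sub>M ?R) (\<lambda>w. prod.swap (x w, y w)) ?R z (\<lambda>(a, b). K a)"
    by (rule is_cond_law_coarsen[OF p xy z sw]) (use c in \<open>simp_all add: split_beta'\<close>)
  then have "is_cond_law M (?R \<Otimes>\<^sub>M ?R) (\<lambda>w. (y w, z w)) ?R x (\<lambda>(a, b). K1 a)"
    by (intro is_cond_law_exchange[OF p y z x K1 K]) simp
  then have "is_cond_law M (?R \<Otimes>\<^sub>M ?R) (\<lambda>w. prod.swap (y w, z w)) ?R x (\<lambda>(a, b). K1 b)"
    by (intro is_cond_law_coarsen[OF p yz x sw]) (simp_all add: split_beta')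
  then show ?thesis
    using p x y z is_cond_law_kernel[OF K1] unfolding markov_triple_def by auto
qed

text \<open>
  By the Markov property only \<open>y\<close> matters for \<open>z\<close>, and by causality only the past of \<open>y\<close> matters for the past of \<open>z\<close>.
\<close>

lemma markov_triple_past:
  assumes mt: "markov_triple N M x y z" and c: "causal N \<nu> (pair_law N M y z)" and t: "t \<le> N"
  shows "\<exists>k\<in>Rsp {1..t} \<rightarrow>\<^sub>M prob_algebra (Rsp {1..t}).
    is_cond_law M (Rsp2 {1..N}) (\<lambda>w. (x w, y w)) (Rsp {1..t}) (\<lambda>w. restrict (z w) {1..t})
      (\<lambda>(a, b). k (restrict b {1..t}))"
proof -
  let ?R = "Rsp {1..N}" and ?T = "Rsp {1..t}" and ?r = "\<lambda>x::nat \<Rightarrow> real. restrict x {1..t}"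
  from mt obtain K where p: "prob_space M"
    and x[measurable]: "x \<in> M \<rightarrow>\<^sub>M ?R" and y[measurable]: "y \<in> M \<rightarrow>\<^sub>M ?R" and z[measurable]: "z \<in> M \<rightarrow>\<^sub>M ?R"
    and K[measurable]: "K \<in> ?R \<rightarrow>\<^sub>M prob_algebra ?R" and cK: "is_cond_law M (?R \<Otimes>\<^sub>M ?R) (\<lambda>w. (x w, y w)) ?R z (\<lambda>(a, b). K b)"
    unfolding markov_triple_def by blast
  have xy: "(\<lambda>w. (x w, y w)) \<in> M \<rightarrow>\<^sub>M ?R \<Otimes>\<^sub>M ?R" and yz: "(\<lambda>w. (y w, z w)) \<in> M \<rightarrow>\<^sub>M ?R \<Otimes>\<^sub>M ?R" by simp_all
  have r[measurable]: "?r \<in> ?R \<rightarrow>\<^sub>M ?T" using t by (intro restrict_measurable) auto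
  have rz: "(\<lambda>w. ?r (z w)) \<in> M \<rightarrow>\<^sub>M ?T" by simp
  have "pair_law N M y z \<in> space (prob_algebra (?R \<Otimes>\<^sub>M ?R))"
    using prob_space.prob_space_distr[OF p yz] by (simp add: space_prob_algebra)
  from causal_past[OF this c t] obtain k where k[measurable]: "k \<in> ?T \<rightarrow>\<^sub>M prob_algebra ?T"
    and "is_cond_law (pair_law N M y z) ?R fst ?T (\<lambda>w. ?r (snd w)) (\<lambda>a. k (?r a))" by blast
  then have 1: "is_cond_law M ?R y ?T (\<lambda>w. ?r (z w)) (\<lambda>a. k (?r a))"
    by (subst (asm) is_cond_law_distr[OF yz]) simp_all
  have "is_cond_law M ?R (\<lambda>w. snd (x w, y w)) ?R z K"
    by (rule is_cond_law_coarsen[OF p xy z]) (use cK in \<open>simp_all add: split_beta'\<close>)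
  then have "is_cond_law M ?R y ?R z K" by simp
  from is_cond_law_push[OF p y z r this]
  have 2: "is_cond_law M ?R y ?T (\<lambda>w. ?r (z w)) (\<lambda>a. distr (K a) ?T ?r)" .
  have "countably_generated ?T" by (rule countably_generated_Rsp) simp
  from AE_distrD[OF y is_cond_law_unique[OF p y rz this 2 1]]
  have ae: "AE w in M. distr (K (y w)) ?T ?r = k (?r (y w))" .
  have "is_cond_law M (?R \<Otimes>\<^sub>M ?R) (\<lambda>w. (x w, y w)) ?T (\<lambda>w. ?r (z w)) (\<lambda>(a, b). k (?r b))"
  proof (rule is_cond_law_AE_cong[OF p xy rz is_cond_law_push[OF p xy z r cK]])
    show "(\<lambda>(a, b). k (?r b)) \<in> ?R \<Otimes>\<^sub>M ?R \<rightarrow>\<^sub>M prob_algebra ?T" by measurable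
  qed (use ae in simp)
  then show ?thesis using k by blast
qed

text \<open>
  Adding the past of \<open>z\<close> to that of \<open>(x, y)\<close> does not change the law of a function of \<open>(x, y)\<close> given that
  past: by \<open>markov_triple_past\<close>, the past of \<open>z\<close> given all of \<open>(x, y)\<close> depends on the past of \<open>y\<close> alone,
  and \<open>is_cond_law_exchange\<close> turns this around.
\<close>

lemma markov_triple_step:
  assumes mt: "markov_triple N M x y z" and c: "causal N \<nu> (pair_law N M y z)" and t: "t \<le> N"
    and h: "h \<in> Rsp2 {1..N} \<rightarrow>\<^sub>M T"
    and L: "is_cond_law (pair_law N M x y) (Rsp2 {1..t}) (seg {1..t}) T h L"
  shows "is_cond_law M ((Rsp2 {1..t}) \<Otimes>\<^sub>M Rsp {1..t})
     (\<lambda>w. (seg {1..t} (x w, y w), restrict (z w) {1..t})) T (\<lambda>w. h (x w, y w)) (\<lambda>(a, c). L a)"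
proof -
  let ?R = "Rsp {1..N}" and ?T = "Rsp {1..t}" and ?r = "\<lambda>x::nat \<Rightarrow> real. restrict x {1..t}"
  have p: "prob_space M" and [measurable]: "x \<in> M \<rightarrow>\<^sub>M ?R" "y \<in> M \<rightarrow>\<^sub>M ?R" "z \<in> M \<rightarrow>\<^sub>M ?R"
    using mt unfolding markov_triple_def by auto
  have xy: "(\<lambda>w. (x w, y w)) \<in> M \<rightarrow>\<^sub>M ?R \<Otimes>\<^sub>M ?R" by simp
  have [measurable]: "?r \<in> ?R \<rightarrow>\<^sub>M ?T" using t by (intro restrict_measurable) auto
  have seg: "seg {1..t} \<in> ?R \<Otimes>\<^sub>M ?R \<rightarrow>\<^sub>M ?T \<Otimes>\<^sub>M ?T" using t by (intro seg_measurable) auto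
  have X: "(\<lambda>w. seg {1..t} (x w, y w)) \<in> M \<rightarrow>\<^sub>M ?T \<Otimes>\<^sub>M ?T" by (rule measurable_compose[OF xy seg])
  have H: "(\<lambda>w. h (x w, y w)) \<in> M \<rightarrow>\<^sub>M T" by (rule measurable_compose[OF xy h])
  have Z: "(\<lambda>w. ?r (z w)) \<in> M \<rightarrow>\<^sub>M ?T" by simp
  obtain k where k[measurable]: "k \<in> ?T \<rightarrow>\<^sub>M prob_algebra ?T"
    and A: "is_cond_law M (?R \<Otimes>\<^sub>M ?R) (\<lambda>w. (x w, y w)) ?T (\<lambda>w. ?r (z w)) (\<lambda>(a, b). k (?r b))"
    using markov_triple_past[OF mt c t] by blast
  have L': "is_cond_law M (?T \<Otimes>\<^sub>M ?T) (\<lambda>w. seg {1..t} (x w, y w)) T (\<lambda>w. h (x w, y w)) L"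
    using L is_cond_law_distr[OF xy seg h] by simp
  have sh: "(\<lambda>v. (seg {1..t} v, h v)) \<in> ?R \<Otimes>\<^sub>M ?R \<rightarrow>\<^sub>M (?T \<Otimes>\<^sub>M ?T) \<Otimes>\<^sub>M T"
    by (intro measurable_Pair seg h)
  have kk: "(\<lambda>(a, b). k b) \<in> ?T \<Otimes>\<^sub>M ?T \<rightarrow>\<^sub>M prob_algebra ?T" by measurable
  have "is_cond_law M ((?T \<Otimes>\<^sub>M ?T) \<Otimes>\<^sub>M T) (\<lambda>w. (\<lambda>v. (seg {1..t} v, h v)) (x w, y w)) ?T (\<lambda>w. ?r (z w))
     (\<lambda>(a, c). (\<lambda>(a, b). k b) a)"
  proof (rule is_cond_law_coarsen[OF p xy Z sh])
    show "(\<lambda>(a, c). (\<lambda>(a, b). k b) a) \<in> (?T \<Otimes>\<^sub>M ?T) \<Otimes>\<^sub>M T \<rightarrow>\<^sub>M prob_algebra ?T" by measurable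
    have "(\<lambda>v. (\<lambda>(a, c). (\<lambda>(a, b). k b) a) (seg {1..t} v, h v)) = (\<lambda>(a, b). k (?r b))"
      by (auto simp: seg_def fun_eq_iff)
    with A show "is_cond_law M (?R \<Otimes>\<^sub>M ?R) (\<lambda>w. (x w, y w)) ?T (\<lambda>w. ?r (z w))
       (\<lambda>v. (\<lambda>(a, c). (\<lambda>(a, b). k b) a) (seg {1..t} v, h v))" by simp
  qed
  then show ?thesis by (intro is_cond_law_exchange[OF p X Z H L' kk]) simp
qed

lemma markov_triple_causal:
  assumes mt: "markov_triple N M x y z" and c: "causal N \<nu> (pair_law N M y z)" and c1: "causal N \<mu> (pair_law N M x y)"
  shows "causal N \<mu> (pair_law N M x z)"
  unfolding causal_def
proof (intro allI impI)
  fix t assume t: "t < N"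
  let ?R = "Rsp {1..N}" and ?T = "Rsp {1..t}" and ?r = "\<lambda>x::nat \<Rightarrow> real. restrict x {1..t}"
  have p: "prob_space M" and [measurable]: "x \<in> M \<rightarrow>\<^sub>M ?R" "y \<in> M \<rightarrow>\<^sub>M ?R" "z \<in> M \<rightarrow>\<^sub>M ?R"
    using mt unfolding markov_triple_def by auto
  have [measurable]: "?r \<in> ?R \<rightarrow>\<^sub>M ?T" using t by (intro restrict_measurable) auto
  have xz: "(\<lambda>w. (x w, z w)) \<in> M \<rightarrow>\<^sub>M ?R \<Otimes>\<^sub>M ?R" by simp
  have seg: "seg {1..t} \<in> ?R \<Otimes>\<^sub>M ?R \<rightarrow>\<^sub>M ?T \<Otimes>\<^sub>M ?T" using t by (intro seg_measurable) auto
  have h: "(\<lambda>w. fst w (t + 1)) \<in> ?R \<Otimes>\<^sub>M ?R \<rightarrow>\<^sub>M borel"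
    using t by (intro measurable_compose[OF measurable_fst coord_measurable]) auto
  have H: "(\<lambda>w. x w (t + 1)) \<in> M \<rightarrow>\<^sub>M borel"
    using measurable_compose[OF xz h] by simp
  note [measurable] = causal_kernel[OF c1 t]
  let ?X = "\<lambda>w. (seg {1..t} (x w, y w), ?r (z w))"
  have X: "?X \<in> M \<rightarrow>\<^sub>M (?T \<Otimes>\<^sub>M ?T) \<Otimes>\<^sub>M ?T" unfolding seg_def by simp
  have "is_cond_law M ((?T \<Otimes>\<^sub>M ?T) \<Otimes>\<^sub>M ?T) ?X borel (\<lambda>w. fst (x w, y w) (t + 1)) (\<lambda>(a, c). (\<lambda>(x, y). next_law \<mu> t x) a)"
    using t c1 by (intro markov_triple_step[OF mt c _ h]) (auto simp: causal_def)
  then have *: "is_cond_law M ((?T \<Otimes>\<^sub>M ?T) \<Otimes>\<^sub>M ?T) ?X borel (\<lambda>w. x w (t + 1)) (\<lambda>v. (\<lambda>(x, y). next_law \<mu> t x) ((\<lambda>(a, c). (fst a, c)) v))"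
    by (simp only: split_beta' fst_conv)
  have f: "(\<lambda>(a, c). (fst a, c)) \<in> (?T \<Otimes>\<^sub>M ?T) \<Otimes>\<^sub>M ?T \<rightarrow>\<^sub>M ?T \<Otimes>\<^sub>M ?T" by measurable
  have n: "(\<lambda>(x, y). next_law \<mu> t x) \<in> ?T \<Otimes>\<^sub>M ?T \<rightarrow>\<^sub>M prob_algebra borel" by measurable
  have "is_cond_law M (?T \<Otimes>\<^sub>M ?T) (\<lambda>w. (\<lambda>(a, c). (fst a, c)) (?X w)) borel (\<lambda>w. x w (t + 1)) (\<lambda>(x, y). next_law \<mu> t x)"
    by (rule is_cond_law_coarsen[OF p X H f n *])
  then have "is_cond_law M (?T \<Otimes>\<^sub>M ?T) (\<lambda>w. seg {1..t} (x w, z w)) borel (\<lambda>w. x w (t + 1)) (\<lambda>(x, y). next_law \<mu> t x)"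
    by (simp add: seg_def)
  then show "is_cond_law (pair_law N M x z) (?T \<Otimes>\<^sub>M ?T) (seg {1..t}) borel (\<lambda>w. fst w (t + 1)) (\<lambda>(x, y). next_law \<mu> t x)"
    using is_cond_law_distr[OF xz seg h] by simp
qed

text \<open>
  A conditional cost bound for \<open>(x, y)\<close> survives replacing the past of \<open>y\<close> by that of \<open>z\<close>: the past of \<open>z\<close> is first
  added, which changes no conditional law, and the past of \<open>y\<close> is then forgotten.
\<close>

lemma markov_triple_cond_mean_le:
  assumes mt: "markov_triple N M x y z" and c: "causal N \<nu> (pair_law N M y z)" and t: "t < N" and C: "C < \<infinity>"
    and m: "cond_mean_le (pair_law N M x y) (Rsp2 {1..t}) (seg {1..t}) (\<lambda>w. gap p (pair_at (t + 1) w)) C"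
  shows "cond_mean_le M (Rsp2 {1..t}) (\<lambda>w. seg {1..t} (x w, z w)) (\<lambda>w. gap p (pair_at (t + 1) (x w, y w))) C"
proof -
  let ?R = "Rsp {1..N}" and ?T = "Rsp {1..t}" and ?r = "\<lambda>x::nat \<Rightarrow> real. restrict x {1..t}"
  let ?B = "borel \<Otimes>\<^sub>M borel :: (real \<times> real) measure"
  have p: "prob_space M" and [measurable]: "x \<in> M \<rightarrow>\<^sub>M ?R" "y \<in> M \<rightarrow>\<^sub>M ?R" "z \<in> M \<rightarrow>\<^sub>M ?R"
    using mt unfolding markov_triple_def by auto
  have [measurable]: "?r \<in> ?R \<rightarrow>\<^sub>M ?T" using t by (intro restrict_measurable) auto
  have xy: "(\<lambda>w. (x w, y w)) \<in> M \<rightarrow>\<^sub>M ?R \<Otimes>\<^sub>M ?R" by simp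
  have seg: "seg {1..t} \<in> ?R \<Otimes>\<^sub>M ?R \<rightarrow>\<^sub>M ?T \<Otimes>\<^sub>M ?T" using t by (intro seg_measurable) auto
  have h: "pair_at (t + 1) \<in> ?R \<Otimes>\<^sub>M ?R \<rightarrow>\<^sub>M ?B" using t by (intro pair_at_measurable) auto
  let ?P = "pair_law N M x y"
  have pP: "prob_space ?P" and gP: "?P \<in> space (prob_algebra (?R \<Otimes>\<^sub>M ?R))"
    using prob_space.prob_space_distr[OF p xy] by (simp_all add: space_prob_algebra)
  have segP: "seg {1..t} \<in> ?P \<rightarrow>\<^sub>M ?T \<Otimes>\<^sub>M ?T" and hP: "pair_at (t + 1) \<in> ?P \<rightarrow>\<^sub>M ?B"
    using seg h by simp_all
  let ?L = "next_pair_law ?P t"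
  note L = next_pair_law_is_cond_law[OF gP t]
  let ?X = "\<lambda>w. (seg {1..t} (x w, y w), ?r (z w))"
  have X: "?X \<in> M \<rightarrow>\<^sub>M (?T \<Otimes>\<^sub>M ?T) \<Otimes>\<^sub>M ?T" unfolding seg_def by simp
  have H: "(\<lambda>w. pair_at (t + 1) (x w, y w)) \<in> M \<rightarrow>\<^sub>M ?B" by (rule measurable_compose[OF xy h])
  have S: "is_cond_law M ((?T \<Otimes>\<^sub>M ?T) \<Otimes>\<^sub>M ?T) ?X ?B (\<lambda>w. pair_at (t + 1) (x w, y w)) (\<lambda>(a, c). ?L a)"
    using t by (intro markov_triple_step[OF mt c _ h L]) auto
  have [measurable]: "(\<lambda>a. \<integral>\<^sup>+b. gap p b \<partial>?L a) \<in> borel_measurable (?T \<Otimes>\<^sub>M ?T)"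
    using kernel_nn_integral_measurable[OF is_cond_law_kernel[OF L], of "\<lambda>z. gap p (snd z)"] by simp
  have "AE a in distr ?P (?T \<Otimes>\<^sub>M ?T) (seg {1..t}). (\<integral>\<^sup>+b. gap p b \<partial>?L a) \<le> C"
    using cond_mean_le_iff_AE[OF pP segP hP L gap_measurable C] m by blast
  then have "AE w in M. (\<integral>\<^sup>+b. gap p b \<partial>?L (seg {1..t} (x w, y w))) \<le> C"
    using AE_distrD[OF xy] AE_distrD[OF segP] by blast
  then have "AE a in distr M ((?T \<Otimes>\<^sub>M ?T) \<Otimes>\<^sub>M ?T) ?X. (\<integral>\<^sup>+b. gap p b \<partial>(\<lambda>(a, c). ?L a) a) \<le> C"
    by (subst AE_distr_iff[OF X]) (simp_all add: split_beta')
  then have "cond_mean_le M ((?T \<Otimes>\<^sub>M ?T) \<Otimes>\<^sub>M ?T) ?X (\<lambda>w. gap p (pair_at (t + 1) (x w, y w))) C"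
    using cond_mean_le_iff_AE[OF p X H S gap_measurable C] by blast
  then show ?thesis
    by (rule cond_mean_le_coarsen[OF X, where g="\<lambda>(a, c). (fst a, c)", rotated])
       (simp_all add: seg_def)
qed

text \<open>
  Draw \<open>(x, y)\<close> from the first coupling and then \<open>z\<close> from the conditional law under the second coupling,
  given \<open>y\<close>.
\<close>

lemma ex_markov_triple:
  assumes g1: "\<gamma>1 \<in> space (prob_algebra (Rsp2 {1..N}))"
    and g2: "\<gamma>2 \<in> space (prob_algebra (Rsp2 {1..N}))"
    and eq: "distr \<gamma>1 (Rsp {1..N}) snd = distr \<gamma>2 (Rsp {1..N}) fst"
  shows "\<exists>(M :: (((nat \<Rightarrow> real) \<times> (nat \<Rightarrow> real)) \<times> (nat \<Rightarrow> real)) measure) x y z. markov_triple N M x y z \<and>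
    pair_law N M x y = \<gamma>1 \<and> pair_law N M y z = \<gamma>2"
proof -
  let ?R = "Rsp {1..N}"
  let ?RR = "?R \<Otimes>\<^sub>M ?R"
  have s1: "sets \<gamma>1 = sets ?RR" and p1: "prob_space \<gamma>1" using g1 by (auto simp: space_prob_algebra)
  have s2: "sets \<gamma>2 = sets ?RR" and p2: "prob_space \<gamma>2" using g2 by (auto simp: space_prob_algebra)
  have f2: "fst \<in> \<gamma>2 \<rightarrow>\<^sub>M ?R" "snd \<in> \<gamma>2 \<rightarrow>\<^sub>M ?R" by (auto simp: measurable_cong_sets[OF s2 refl])
  obtain K where K: "is_cond_law \<gamma>2 ?R fst ?R snd K"
    using ex_cond_law_Rsp[OF _ p2 f2] by blast
  note Km[measurable] = is_cond_law_kernel[OF K]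
  let ?K = "\<lambda>(a, b). K b"
  have KK: "?K \<in> ?RR \<rightarrow>\<^sub>M prob_algebra ?R" by measurable
  let ?k = "\<lambda>a. distr (?K a) (?RR \<Otimes>\<^sub>M ?R) (\<lambda>b. (a, b))"
  have k: "?k \<in> ?RR \<rightarrow>\<^sub>M prob_algebra (?RR \<Otimes>\<^sub>M ?R)" by (rule measurable_pair_kernel[OF KK])
  define M where "M = \<gamma>1 \<bind> ?k"
  have sM: "sets M = sets (?RR \<Otimes>\<^sub>M ?R)" and pM: "prob_space M"
    unfolding M_def using sets_bind'[OF g1 k] prob_space_bind'[OF g1 k] by auto
  have fM: "fst \<in> M \<rightarrow>\<^sub>M ?RR" "snd \<in> M \<rightarrow>\<^sub>M ?R" by (auto simp: measurable_cong_sets[OF sM refl])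
  have k1: "?k \<in> \<gamma>1 \<rightarrow>\<^sub>M subprob_algebra (?RR \<Otimes>\<^sub>M ?R)"
    using measurable_prob_algebraD[OF k] by (simp add: measurable_cong_sets[OF s1 refl])
  have "distr M ?RR fst = \<gamma>1 \<bind> (\<lambda>a. distr (?k a) ?RR fst)"
    unfolding M_def by (rule distr_bind[OF k1 prob_space.not_empty[OF p1] measurable_fst])
  also have "\<dots> = \<gamma>1 \<bind> return ?RR"
  proof (rule bind_cong_All, intro ballI)
    fix a assume "a \<in> space \<gamma>1"
    then have a: "a \<in> space ?RR" using sets_eq_imp_space_eq[OF s1] by simp
    have pa: "Pair a \<in> ?K a \<rightarrow>\<^sub>M ?RR \<Otimes>\<^sub>M ?R"
      using a by (simp add: measurable_cong_sets[OF kernel_at(2)[OF KK a] refl])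
    have "distr (?k a) ?RR fst = distr (?K a) ?RR (\<lambda>_. a)"
      using pa by (simp add: distr_distr comp_def)
    also have "\<dots> = return ?RR a"
      by (rule prob_space.distr_const[OF kernel_at(1)[OF KK a] a])
    finally show "distr (?k a) ?RR fst = return ?RR a" .
  qed
  also have "\<dots> = \<gamma>1" by (rule bind_return''[OF s1])
  finally have d1: "distr M ?RR fst = \<gamma>1" .
  have c: "is_cond_law M ?RR fst ?R snd ?K"
    unfolding is_cond_law_def
  proof (intro conjI KK)
    have "distr M (?RR \<Otimes>\<^sub>M ?R) (\<lambda>w. (fst w, snd w)) = M" using distr_id2[OF sM[symmetric]] by (simp add: id_def)
    then show "distr M (?RR \<Otimes>\<^sub>M ?R) (\<lambda>w. (fst w, snd w)) = distr M ?RR fst \<bind> ?k"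
      unfolding d1 by (simp add: M_def)
  qed
  have "is_cond_law M ?R (\<lambda>w. snd (fst w)) ?R snd K"
    by (rule is_cond_law_coarsen[OF pM fM]) (use c in \<open>simp_all add: split_beta'\<close>)
  then have "distr M ?RR (\<lambda>w. (snd (fst w), snd w)) = distr M ?R (\<lambda>w. snd (fst w)) \<bind> (\<lambda>a. distr (K a) ?RR (\<lambda>b. (a, b)))"
    by (simp add: is_cond_law_def)
  also have "distr M ?R (\<lambda>w. snd (fst w)) = distr \<gamma>1 ?R snd"
    unfolding d1[symmetric] using fM by (simp add: distr_distr comp_def)
  also have "\<dots> = distr \<gamma>2 ?R fst" by (rule eq)
  also have "\<dots> \<bind> (\<lambda>a. distr (K a) ?RR (\<lambda>b. (a, b))) = distr \<gamma>2 ?RR (\<lambda>w. (fst w, snd w))"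
    using K by (simp add: is_cond_law_def)
  also have "\<dots> = \<gamma>2" using distr_id2[OF s2[symmetric]] by (simp add: id_def)
  finally have d2: "pair_law N M (\<lambda>w. snd (fst w)) snd = \<gamma>2" .
  have "markov_triple N M (\<lambda>w. fst (fst w)) (\<lambda>w. snd (fst w)) snd"
    unfolding markov_triple_def using pM fM Km c
    by (auto intro!: measurable_compose[OF fM(1) measurable_fst] measurable_compose[OF fM(1) measurable_snd])
  then show ?thesis using d1 d2 by fastforce
qed

section \<open>The metric properties\<close>

text \<open>
  Convexity of the power function applied to the mean of \<open>a / l\<close> and \<open>b / (1 - l)\<close> with weights \<open>l\<close> and
  \<open>1 - l\<close>. Integrated and optimised over \<open>l\<close>, this pointwise bound becomes Minkowski's inequality.
\<close>

lemma powr_add_le_weighted: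
  fixes a b l p :: real
  assumes p: "1 \<le> p" and l: "0 < l" "l < 1" and ab: "0 \<le> a" "0 \<le> b"
  shows "(a + b) powr p \<le> l powr (1 - p) * a powr p + (1 - l) powr (1 - p) * b powr p"
proof -
  have one_le: "1 \<le> q powr (1 - p)" if "0 < q" "q < 1" for q :: real
  proof -
    have "q powr (p - 1) \<le> 1" using that p by (intro powr_le1) auto
    moreover have "q powr (1 - p) = 1 / q powr (p - 1)" using powr_minus_divide[of q "p - 1"] by simp
    ultimately show ?thesis using that by simp
  qed
  consider "a = 0" | "b = 0" | "0 < a" "0 < b" using ab by linarith
  then show ?thesis
  proof cases
    case 1
    then show ?thesis using one_le[of "1 - l"] l p mult_right_mono[of 1 "(1 - l) powr (1 - p)" "b powr p"] by simp
  next
    case 2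
    then show ?thesis using one_le[of l] l p mult_right_mono[of 1 "l powr (1 - p)" "a powr p"] by simp
  next
    case 3
    have e: "q * (c / q) powr p = q powr (1 - p) * c powr p" if "0 < q" "0 < c" for q c :: real
      using that by (simp add: powr_divide powr_diff)
    have "(l * (a / l) + (1 - l) * (b / (1 - l))) powr p \<le> l * (a / l) powr p + (1 - l) * (b / (1 - l)) powr p"
      using convex_onD[OF powr_convex[OF p], of "1 - l" "a / l" "b / (1 - l)"] l 3 by simp
    then show ?thesis using l 3 by (simp add: e)
  qed
qed

lemma gap_triangle:
  assumes p: "1 \<le> p" and l: "0 < l" "l < 1"
  shows "gap p (a, c) \<le> ennreal (l powr (1 - p)) * gap p (a, b) + ennreal ((1 - l) powr (1 - p)) * gap p (b, c)"
proof -
  have "\<bar>a - c\<bar> powr p \<le> (\<bar>a - b\<bar> + \<bar>b - c\<bar>) powr p" using p by (intro powr_mono2) auto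
  also have "\<dots> \<le> l powr (1 - p) * \<bar>a - b\<bar> powr p + (1 - l) powr (1 - p) * \<bar>b - c\<bar> powr p"
    by (rule powr_add_le_weighted[OF p l]) auto
  finally show ?thesis
    by (simp add: gap_def ennreal_mult'[symmetric] ennreal_plus[symmetric] ennreal_leI del: ennreal_plus)
qed

lemma gap_commute: "gap p (a, b) = gap p (b, a)"
  by (simp add: gap_def abs_minus_commute)

text \<open>
  Minkowski's inequality for conditional means.
\<close>

lemma cond_mean_le_add:
  assumes p: "1 \<le> p" and c: "0 < c1" "0 < c2" and X: "X \<in> M \<rightarrow>\<^sub>M S"
    and f: "f1 \<in> borel_measurable M" "f2 \<in> borel_measurable M"
    and le: "\<And>l w. w \<in> space M \<Longrightarrow> 0 < l \<Longrightarrow> l < 1 \<Longrightarrow>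
      f w \<le> ennreal (l powr (1 - p)) * f1 w + ennreal ((1 - l) powr (1 - p)) * f2 w"
    and 1: "cond_mean_le M S X f1 (ennreal (c1 powr p))" and 2: "cond_mean_le M S X f2 (ennreal (c2 powr p))"
  shows "cond_mean_le M S X f (ennreal ((c1 + c2) powr p))"
  unfolding cond_mean_le_def
proof
  fix A assume A[measurable]: "A \<in> sets S"
  note [measurable] = X f
  \<comment> \<open>The weight for which the two bounds add up to the power of the sum.\<close>
  define l where "l = c1 / (c1 + c2)"
  have l: "0 < l" "l < 1" and l': "1 - l = c2 / (c1 + c2)" using c by (auto simp: l_def field_simps)
  let ?l1 = "l powr (1 - p)" and ?l2 = "(1 - l) powr (1 - p)"
  let ?I = "\<integral>\<^sup>+w. indicator A (X w) \<partial>M"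
  have e: "(c / (c1 + c2)) powr (1 - p) * c powr p = (c1 + c2) powr (p - 1) * c" if "0 < c" for c
  proof -
    have "(c / (c1 + c2)) powr (1 - p) * c powr p = c powr (1 - p) * c powr p / (c1 + c2) powr (1 - p)"
      using c that by (simp add: powr_divide)
    also have "c powr (1 - p) * c powr p = c" using that by (simp add: powr_add[symmetric])
    also have "c / (c1 + c2) powr (1 - p) = (c1 + c2) powr (p - 1) * c"
      using powr_minus_divide[of "c1 + c2" "p - 1"] by simp
    finally show ?thesis .
  qed
  have "?l1 * c1 powr p + ?l2 * c2 powr p = (c1 + c2) powr (p - 1) * (c1 + c2)"
    using e[OF c(1)] e[OF c(2)] unfolding l' by (simp add: l_def ring_distribs)
  also have "\<dots> = (c1 + c2) powr p" using c by (simp add: powr_diff)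
  finally have sum: "?l1 * c1 powr p + ?l2 * c2 powr p = (c1 + c2) powr p" .
  have "(\<integral>\<^sup>+w. indicator A (X w) * f w \<partial>M) \<le>
     (\<integral>\<^sup>+w. ennreal ?l1 * (indicator A (X w) * f1 w) + ennreal ?l2 * (indicator A (X w) * f2 w) \<partial>M)"
    using le[OF _ l] by (intro nn_integral_mono) (auto simp: indicator_def)
  also have "\<dots> = ennreal ?l1 * (\<integral>\<^sup>+w. indicator A (X w) * f1 w \<partial>M) + ennreal ?l2 * (\<integral>\<^sup>+w. indicator A (X w) * f2 w \<partial>M)"
    by (simp add: nn_integral_add nn_integral_cmult)
  also have "\<dots> \<le> ennreal ?l1 * (ennreal (c1 powr p) * ?I) + ennreal ?l2 * (ennreal (c2 powr p) * ?I)"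
    using 1 2 A by (intro add_mono mult_left_mono) (auto simp: cond_mean_le_def)
  also have "\<dots> = ennreal (?l1 * c1 powr p + ?l2 * c2 powr p) * ?I"
    by (simp add: ennreal_mult' ring_distribs mult.assoc)
  finally show "(\<integral>\<^sup>+w. indicator A (X w) * f w \<partial>M) \<le> ennreal ((c1 + c2) powr p) * ?I" unfolding sum .
qed

lemma Ft_zero_le_iff:
  assumes "0 < p" "0 \<le> c" and g: "\<gamma> \<in> space (prob_algebra (Rsp2 {1..N}))"
  shows "Ft p N 0 \<gamma> \<le> ennreal c \<longleftrightarrow>
    (\<forall>t<N. cond_mean_le \<gamma> (Rsp2 {1..t}) (seg {1..t}) (\<lambda>w. gap p (pair_at (t + 1) w)) (ennreal (c powr p)))"
  using Ft_le_iff[OF assms(1,2), of 0 N \<gamma>] g by auto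

lemma pair_law_swap:
  assumes [measurable]: "x \<in> M \<rightarrow>\<^sub>M Rsp {1..N}" "y \<in> M \<rightarrow>\<^sub>M Rsp {1..N}"
  shows "swap_law N (pair_law N M x y) = pair_law N M y x"
  by (subst distr_distr) (simp_all add: swap_measurable comp_def)

lemma Ft_swap_law_le:
  assumes p: "0 < p" and g: "\<gamma> \<in> space (prob_algebra (Rsp2 {1..N}))"
    and c: "0 \<le> c" and le: "Ft p N 0 \<gamma> \<le> ennreal c"
  shows "Ft p N 0 (swap_law N \<gamma>) \<le> ennreal c"
  unfolding Ft_zero_le_iff[OF p c swap_law_prob(1)[OF g]]
proof (intro allI impI)
  fix t assume t: "t < N"
  let ?R = "Rsp {1..N}" and ?S = "Rsp2 {1..t}"
  have s: "sets \<gamma> = sets (?R \<Otimes>\<^sub>M ?R)" using g by (auto simp: space_prob_algebra)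
  have sw: "prod.swap \<in> \<gamma> \<rightarrow>\<^sub>M ?R \<Otimes>\<^sub>M ?R"
    by (subst measurable_cong_sets[OF s refl]) (rule swap_measurable)
  have seg: "seg {1..t} \<in> ?R \<Otimes>\<^sub>M ?R \<rightarrow>\<^sub>M ?S" using t by (intro seg_measurable) auto
  have seg1: "seg {1..t} \<in> \<gamma> \<rightarrow>\<^sub>M ?S" using seg by (subst measurable_cong_sets[OF s refl])
  have h: "(\<lambda>w. gap p (pair_at (t + 1) w)) \<in> borel_measurable (?R \<Otimes>\<^sub>M ?R)"
    using t by (intro measurable_compose[OF pair_at_measurable gap_measurable]) auto
  have "cond_mean_le \<gamma> ?S (seg {1..t}) (\<lambda>w. gap p (pair_at (t + 1) w)) (ennreal (c powr p))"
    using le t unfolding Ft_zero_le_iff[OF p c g] by blast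
  then have "cond_mean_le \<gamma> ?S (\<lambda>w. seg {1..t} (prod.swap w)) (\<lambda>w. gap p (pair_at (t + 1) w)) (ennreal (c powr p))"
    by (rule cond_mean_le_coarsen[OF seg1 swap_measurable]) (simp add: seg_def split: prod.split)
  also have "(\<lambda>w. gap p (pair_at (t + 1) w)) = (\<lambda>w. gap p (pair_at (t + 1) (prod.swap w)))"
    by (auto simp: pair_at_def gap_commute split: prod.split)
  finally show "cond_mean_le (swap_law N \<gamma>) ?S (seg {1..t}) (\<lambda>w. gap p (pair_at (t + 1) w)) (ennreal (c powr p))"
    by (simp only: cond_mean_le_distr[OF sw seg h])
qed

text \<open>
  Causality of the outer pairs as seen from the middle path is needed in both directions: the bound for \<open>(x, y)\<close>
  uses that of \<open>(y, z)\<close>, and the bound for \<open>(z, y)\<close> uses that of \<open>(y, x)\<close> in the reversed triple.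
\<close>

lemma markov_triple_Ft_le:
  assumes p: "1 \<le> p" and mt: "markov_triple N M x y z"
    and cyz: "causal N \<nu> (pair_law N M y z)" and cyx: "causal N \<nu> (pair_law N M y x)"
    and c: "0 < c1" "0 < c2"
    and F1: "Ft p N 0 (pair_law N M x y) \<le> ennreal c1" and F2: "Ft p N 0 (pair_law N M y z) \<le> ennreal c2"
  shows "Ft p N 0 (pair_law N M x z) \<le> ennreal (c1 + c2)"
proof -
  let ?R = "Rsp {1..N}"
  have pM: "prob_space M" and x[measurable]: "x \<in> M \<rightarrow>\<^sub>M ?R" and y[measurable]: "y \<in> M \<rightarrow>\<^sub>M ?R" and z[measurable]: "z \<in> M \<rightarrow>\<^sub>M ?R"
    using mt unfolding markov_triple_def by auto
  have p0: "0 < p" using p by simp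
  have m: "(\<lambda>w. (u w, v w)) \<in> M \<rightarrow>\<^sub>M ?R \<Otimes>\<^sub>M ?R" if "u \<in> M \<rightarrow>\<^sub>M ?R" "v \<in> M \<rightarrow>\<^sub>M ?R" for u v
    using that by simp
  have g: "pair_law N M u v \<in> space (prob_algebra (?R \<Otimes>\<^sub>M ?R))" if "u \<in> M \<rightarrow>\<^sub>M ?R" "v \<in> M \<rightarrow>\<^sub>M ?R" for u v
    using prob_space.prob_space_distr[OF pM m[OF that]] by (simp add: space_prob_algebra)
  have F2': "Ft p N 0 (pair_law N M z y) \<le> ennreal c2"
    using Ft_swap_law_le[OF p0 g[OF y z] _ F2] c by (simp add: pair_law_swap)
  show ?thesis
    unfolding Ft_zero_le_iff[OF p0 add_nonneg_nonneg[OF less_imp_le[OF c(1)] less_imp_le[OF c(2)]] g[OF x z]]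
  proof (intro allI impI)
    fix t assume t: "t < N"
    let ?S = "Rsp2 {1..t}"
    have seg: "seg {1..t} \<in> ?R \<Otimes>\<^sub>M ?R \<rightarrow>\<^sub>M ?S" using t by (intro seg_measurable) auto
    have h: "(\<lambda>w. gap p (pair_at (t + 1) w)) \<in> borel_measurable (?R \<Otimes>\<^sub>M ?R)"
      using t by (intro measurable_compose[OF pair_at_measurable gap_measurable]) auto
    have 1: "cond_mean_le M ?S (\<lambda>w. seg {1..t} (x w, z w)) (\<lambda>w. gap p (pair_at (t + 1) (x w, y w))) (ennreal (c1 powr p))"
      using F1 t c unfolding Ft_zero_le_iff[OF p0 less_imp_le[OF c(1)] g[OF x y]]
      by (intro markov_triple_cond_mean_le[OF mt cyz t]) auto
    have "cond_mean_le M ?S (\<lambda>w. seg {1..t} (z w, x w)) (\<lambda>w. gap p (pair_at (t + 1) (z w, y w))) (ennreal (c2 powr p))"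
      using F2' t c unfolding Ft_zero_le_iff[OF p0 less_imp_le[OF c(2)] g[OF z y]]
      by (intro markov_triple_cond_mean_le[OF markov_triple_sym[OF mt] cyx t]) auto
    then have 2: "cond_mean_le M ?S (\<lambda>w. seg {1..t} (x w, z w)) (\<lambda>w. gap p (pair_at (t + 1) (z w, y w))) (ennreal (c2 powr p))"
      by (rule cond_mean_le_coarsen[OF measurable_compose[OF m[OF z x] seg] swap_measurable]) (simp add: seg_def)
    have "cond_mean_le M ?S (\<lambda>w. seg {1..t} (x w, z w)) (\<lambda>w. gap p (pair_at (t + 1) (x w, z w))) (ennreal ((c1 + c2) powr p))"
    proof (rule cond_mean_le_add[OF p c measurable_compose[OF m[OF x z] seg] measurable_compose[OF m[OF x y] h] measurable_compose[OF m[OF z y] h] _ 1 2])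
      fix l :: real and w assume "0 < l" "l < 1"
      then show "gap p (pair_at (t + 1) (x w, z w)) \<le> ennreal (l powr (1 - p)) * gap p (pair_at (t + 1) (x w, y w)) +
          ennreal ((1 - l) powr (1 - p)) * gap p (pair_at (t + 1) (z w, y w))"
        using gap_triangle[OF p, of l "x w (t + 1)" "z w (t + 1)" "y w (t + 1)"] gap_commute[of p "y w (t + 1)"]
        by (simp add: pair_at_def)
    qed
    then show "cond_mean_le (pair_law N M x z) ?S (seg {1..t}) (\<lambda>w. gap p (pair_at (t + 1) w)) (ennreal ((c1 + c2) powr p))"
      by (simp only: cond_mean_le_distr[OF m[OF x z] seg h])
  qed
qed

lemma AWinf_le_of_less:
  assumes "AWinf p N \<mu> \<nu> < ennreal c"
  obtains \<gamma> where "\<gamma> \<in> bicausal_couplings N \<mu> \<nu>" "Ft p N 0 \<gamma> \<le> ennreal c"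
  using assms unfolding AWinf_def INF_less_iff by (auto intro: less_imp_le)

lemma AWinf_triangle:
  assumes p: "1 \<le> p" and N: "1 \<le> N"
    and \<mu>: "\<mu> \<in> space (prob_algebra (Rsp {1..N}))" and \<nu>: "\<nu> \<in> space (prob_algebra (Rsp {1..N}))"
    and \<eta>: "\<eta> \<in> space (prob_algebra (Rsp {1..N}))"
  shows "AWinf p N \<mu> \<eta> \<le> AWinf p N \<mu> \<nu> + AWinf p N \<nu> \<eta>"
proof (rule ennreal_le_epsilon)
  let ?R = "Rsp {1..N}"
  fix e :: real assume fin: "AWinf p N \<mu> \<nu> + AWinf p N \<nu> \<eta> < top" and e: "0 < e"
  define a b where "a = enn2real (AWinf p N \<mu> \<nu>)" and "b = enn2real (AWinf p N \<nu> \<eta>)"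
  have a: "AWinf p N \<mu> \<nu> = ennreal a" "0 \<le> a" and b: "AWinf p N \<nu> \<eta> = ennreal b" "0 \<le> b"
    using fin by (auto simp: a_def b_def)
  define c1 c2 where "c1 = a + e / 2" and "c2 = b + e / 2"
  have c: "0 < c1" "0 < c2" using a b e by (auto simp: c1_def c2_def)
  have "AWinf p N \<mu> \<nu> < ennreal c1" "AWinf p N \<nu> \<eta> < ennreal c2"
    unfolding a(1) b(1) using a b e by (auto simp: c1_def c2_def ennreal_less_iff)
  then obtain \<gamma>1 \<gamma>2 where g1: "\<gamma>1 \<in> bicausal_couplings N \<mu> \<nu>" "Ft p N 0 \<gamma>1 \<le> ennreal c1"
    and g2: "\<gamma>2 \<in> bicausal_couplings N \<nu> \<eta>" "Ft p N 0 \<gamma>2 \<le> ennreal c2"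
    by (elim AWinf_le_of_less)
  note b1 = g1(1)[unfolded bicausal_iff[OF \<mu> \<nu> N]] and b2 = g2(1)[unfolded bicausal_iff[OF \<nu> \<eta> N]]
  obtain M :: "(((nat \<Rightarrow> real) \<times> (nat \<Rightarrow> real)) \<times> (nat \<Rightarrow> real)) measure" and x y z
    where mt: "markov_triple N M x y z" and xy: "pair_law N M x y = \<gamma>1" and yz: "pair_law N M y z = \<gamma>2"
  proof -
    have "\<gamma>1 \<in> space (prob_algebra (?R \<Otimes>\<^sub>M ?R))" "\<gamma>2 \<in> space (prob_algebra (?R \<Otimes>\<^sub>M ?R))"
      "distr \<gamma>1 ?R snd = distr \<gamma>2 ?R fst"
      using b1 b2 by (blast, blast, simp)
    from ex_markov_triple[OF this] show ?thesis by (elim exE conjE) (rule that)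
  qed
  have pM: "prob_space M" and x[measurable]: "x \<in> M \<rightarrow>\<^sub>M ?R" and y[measurable]: "y \<in> M \<rightarrow>\<^sub>M ?R" and z[measurable]: "z \<in> M \<rightarrow>\<^sub>M ?R"
    using mt unfolding markov_triple_def by auto
  have yx: "pair_law N M y x = swap_law N \<gamma>1" and zy: "pair_law N M z y = swap_law N \<gamma>2"
    by (simp_all add: pair_law_swap flip: xy yz)
  have xz: "(\<lambda>w. (x w, z w)) \<in> M \<rightarrow>\<^sub>M ?R \<Otimes>\<^sub>M ?R" by simp
  let ?g = "pair_law N M x z"
  have g: "?g \<in> space (prob_algebra (?R \<Otimes>\<^sub>M ?R))"
    using prob_space.prob_space_distr[OF pM xz] by (simp add: space_prob_algebra)
  have d: "distr ?g ?R fst = \<mu>" "distr ?g ?R snd = \<eta>"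
  proof -
    have "distr ?g ?R fst = distr (pair_law N M x y) ?R fst" by (simp add: distr_distr comp_def)
    then show "distr ?g ?R fst = \<mu>" using b1 by (simp add: xy)
    have "distr ?g ?R snd = distr (pair_law N M y z) ?R snd" by (simp add: distr_distr comp_def)
    then show "distr ?g ?R snd = \<eta>" using b2 by (simp add: yz)
  qed
  have c1: "causal N \<mu> ?g"
    by (rule markov_triple_causal[OF mt]) (use b1 b2 xy yz in auto)
  have c2: "causal N \<eta> (swap_law N ?g)"
    using markov_triple_causal[OF markov_triple_sym[OF mt], of \<nu> \<eta>] b1 b2 by (simp add: pair_law_swap yx zy)
  have "?g \<in> bicausal_couplings N \<mu> \<eta>"
    unfolding bicausal_iff[OF \<mu> \<eta> N] using g d c1 c2 by blast
  moreover have "Ft p N 0 ?g \<le> ennreal (c1 + c2)"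
    by (rule markov_triple_Ft_le[OF p mt _ _ c, of \<nu>]) (use b1 b2 g1 g2 xy yz yx in auto)
  ultimately have "AWinf p N \<mu> \<eta> \<le> ennreal (c1 + c2)"
    unfolding AWinf_def by (rule INF_lower2)
  also have "\<dots> = ennreal a + ennreal b + ennreal e"
    using a b e by (simp add: c1_def c2_def flip: ennreal_plus)
  finally show "AWinf p N \<mu> \<eta> \<le> AWinf p N \<mu> \<nu> + AWinf p N \<nu> \<eta> + ennreal e"
    by (simp add: a(1) b(1))
qed

lemma AWinf_commute:
  assumes p: "1 \<le> p" and N: "1 \<le> N"
    and \<mu>: "\<mu> \<in> space (prob_algebra (Rsp {1..N}))" and \<nu>: "\<nu> \<in> space (prob_algebra (Rsp {1..N}))"
  shows "AWinf p N \<mu> \<nu> = AWinf p N \<nu> \<mu>"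
proof -
  have "AWinf p N \<nu> \<mu> \<le> AWinf p N \<mu> \<nu>"
    if \<mu>: "\<mu> \<in> space (prob_algebra (Rsp {1..N}))" and \<nu>: "\<nu> \<in> space (prob_algebra (Rsp {1..N}))" for \<mu> \<nu>
    unfolding AWinf_def[of p N \<mu> \<nu>]
  proof (rule INF_greatest)
    fix \<gamma> assume "\<gamma> \<in> bicausal_couplings N \<mu> \<nu>"
    note b = this[unfolded bicausal_iff[OF \<mu> \<nu> N]]
    then have g: "\<gamma> \<in> space (prob_algebra (Rsp2 {1..N}))" by blast
    have "swap_law N \<gamma> \<in> bicausal_couplings N \<nu> \<mu>"
      unfolding bicausal_iff[OF \<nu> \<mu> N] using b swap_law_prob[OF g] by simp
    then have le: "AWinf p N \<nu> \<mu> \<le> Ft p N 0 (swap_law N \<gamma>)" unfolding AWinf_def by (rule INF_lower)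
    show "AWinf p N \<nu> \<mu> \<le> Ft p N 0 \<gamma>"
    proof (cases "Ft p N 0 \<gamma>")
      case (real c)
      have "Ft p N 0 (swap_law N \<gamma>) \<le> ennreal c"
        by (rule Ft_swap_law_le[OF _ g]) (use p real in auto)
      with le real show ?thesis by simp
    qed simp
  qed
  from this[OF \<mu> \<nu>] this[OF \<nu> \<mu>] show ?thesis by (rule antisym[rotated])
qed

lemma diagonal_bicausal:
  assumes \<mu>: "\<mu> \<in> space (prob_algebra (Rsp {1..N}))" and N: "1 \<le> N"
  shows "pair_law N \<mu> (\<lambda>x. x) (\<lambda>x. x) \<in> bicausal_couplings N \<mu> \<mu>"
proof -
  let ?R = "Rsp {1..N}" and ?g = "pair_law N \<mu> (\<lambda>x. x) (\<lambda>x. x)"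
  have s: "sets \<mu> = sets ?R" and p: "prob_space \<mu>" using \<mu> by (auto simp: space_prob_algebra)
  have i: "(\<lambda>x. x) \<in> \<mu> \<rightarrow>\<^sub>M ?R" by (simp add: measurable_cong_sets[OF s refl])
  have d: "(\<lambda>x. (x, x)) \<in> \<mu> \<rightarrow>\<^sub>M ?R \<Otimes>\<^sub>M ?R" using i by (intro measurable_Pair)
  have g: "?g \<in> space (prob_algebra (?R \<Otimes>\<^sub>M ?R))"
    using prob_space.prob_space_distr[OF p d] by (simp add: space_prob_algebra)
  have m: "distr ?g ?R fst = \<mu>" "distr ?g ?R snd = \<mu>"
    using d distr_id2[OF s[symmetric]] by (simp_all add: distr_distr comp_def)
  have "causal N \<mu> ?g"
    unfolding causal_def
  proof (intro allI impI)
    fix t assume t: "t < N"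
    let ?T = "Rsp {1..t}" and ?r = "\<lambda>x::nat \<Rightarrow> real. restrict x {1..t}"
    have r: "?r \<in> \<mu> \<rightarrow>\<^sub>M ?T" and c: "(\<lambda>x. x (t + 1)) \<in> \<mu> \<rightarrow>\<^sub>M borel"
      using t by (auto simp: measurable_cong_sets[OF s refl] intro!: restrict_measurable coord_measurable)
    note n = next_law_is_cond_law[OF \<mu> t]
    note [measurable] = is_cond_law_kernel[OF n]
    have seg: "seg {1..t} \<in> ?R \<Otimes>\<^sub>M ?R \<rightarrow>\<^sub>M ?T \<Otimes>\<^sub>M ?T" using t by (intro seg_measurable) auto
    have h: "(\<lambda>w. fst w (t + 1)) \<in> ?R \<Otimes>\<^sub>M ?R \<rightarrow>\<^sub>M borel"
      using t by (intro measurable_compose[OF measurable_fst coord_measurable]) auto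
    have f: "(\<lambda>a. (a, a)) \<in> ?T \<rightarrow>\<^sub>M ?T \<Otimes>\<^sub>M ?T" by simp
    have n2: "(\<lambda>(x, y). next_law \<mu> t x) \<in> ?T \<Otimes>\<^sub>M ?T \<rightarrow>\<^sub>M prob_algebra borel" by measurable
    have "is_cond_law \<mu> (?T \<Otimes>\<^sub>M ?T) (\<lambda>x. (?r x, ?r x)) borel (\<lambda>x. x (t + 1)) (\<lambda>(x, y). next_law \<mu> t x)"
      by (rule is_cond_law_coarsen[where f="\<lambda>a. (a, a)", OF p r c f n2]) (simp only: case_prod_conv n)
    then have "is_cond_law \<mu> (?T \<Otimes>\<^sub>M ?T) (\<lambda>x. seg {1..t} (x, x)) borel (\<lambda>x. fst (x, x) (t + 1)) (\<lambda>(x, y). next_law \<mu> t x)"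
      by (simp only: seg_def case_prod_conv fst_conv)
    then show "is_cond_law ?g (?T \<Otimes>\<^sub>M ?T) (seg {1..t}) borel (\<lambda>w. fst w (t + 1)) (\<lambda>(x, y). next_law \<mu> t x)"
      using is_cond_law_distr[OF d seg h] by blast
  qed
  moreover have "swap_law N ?g = ?g" by (rule pair_law_swap[OF i i])
  ultimately show ?thesis
    unfolding bicausal_iff[OF \<mu> \<mu> N] using g m by simp
qed

lemma AWinf_self:
  assumes p: "1 \<le> p" and \<mu>: "\<mu> \<in> space (prob_algebra (Rsp {1..N}))" and N: "1 \<le> N"
  shows "AWinf p N \<mu> \<mu> = 0"
proof -
  let ?R = "Rsp {1..N}" and ?g = "pair_law N \<mu> (\<lambda>x. x) (\<lambda>x. x)"
  have s: "sets \<mu> = sets ?R" and pr: "prob_space \<mu>" using \<mu> by (auto simp: space_prob_algebra)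
  have d: "(\<lambda>x. (x, x)) \<in> \<mu> \<rightarrow>\<^sub>M ?R \<Otimes>\<^sub>M ?R" by (intro measurable_Pair) (simp_all add: measurable_cong_sets[OF s refl])
  have g: "?g \<in> space (prob_algebra (?R \<Otimes>\<^sub>M ?R))"
    using prob_space.prob_space_distr[OF pr d] by (simp add: space_prob_algebra)
  have p0: "0 < p" using p by simp
  have "Ft p N 0 ?g \<le> ennreal 0"
    unfolding Ft_zero_le_iff[OF p0 order_refl g]
  proof (intro allI impI)
    fix t assume t: "t < N"
    let ?S = "Rsp2 {1..t}"
    have seg: "seg {1..t} \<in> ?R \<Otimes>\<^sub>M ?R \<rightarrow>\<^sub>M ?S" using t by (intro seg_measurable) auto
    have h: "(\<lambda>w. gap p (pair_at (t + 1) w)) \<in> borel_measurable (?R \<Otimes>\<^sub>M ?R)"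
      using t by (intro measurable_compose[OF pair_at_measurable gap_measurable]) auto
    have 0: "gap p (pair_at (t + 1) (x, x)) = 0" for x
      using p by (simp add: pair_at_def gap_def)
    show "cond_mean_le ?g ?S (seg {1..t}) (\<lambda>w. gap p (pair_at (t + 1) w)) (ennreal (0 powr p))"
      unfolding cond_mean_le_distr[OF d seg h] 0 by (simp add: cond_mean_le_def)
  qed
  then have "Ft p N 0 ?g = 0" by simp
  moreover have "AWinf p N \<mu> \<mu> \<le> Ft p N 0 ?g"
    unfolding AWinf_def by (rule INF_lower[OF diagonal_bicausal[OF \<mu> N]])
  ultimately show ?thesis by simp
qed

lemma Ft_gap_le:
  assumes p: "0 < p" and c: "0 \<le> c" and g: "\<gamma> \<in> space (prob_algebra (Rsp2 {1..N}))"
    and le: "Ft p N 0 \<gamma> \<le> ennreal c" and t: "t \<in> {1..N}"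
  shows "(\<integral>\<^sup>+w. gap p (pair_at t w) \<partial>\<gamma>) \<le> ennreal (c powr p)"
proof -
  let ?R = "Rsp {1..N}"
  have s: "sets \<gamma> = sets (?R \<Otimes>\<^sub>M ?R)" and pr: "prob_space \<gamma>" using g by (auto simp: space_prob_algebra)
  interpret prob_space \<gamma> by fact
  obtain r where r: "t = r + 1" "r < N" using t by (intro that[of "t - 1"]) auto
  let ?S = "Rsp2 {1..r}"
  have seg: "seg {1..r} \<in> \<gamma> \<rightarrow>\<^sub>M ?S" using r by (subst measurable_cong_sets[OF s refl]) (auto intro!: seg_measurable)
  have "cond_mean_le \<gamma> ?S (seg {1..r}) (\<lambda>w. gap p (pair_at t w)) (ennreal (c powr p))"
    using le r unfolding Ft_zero_le_iff[OF p c g] by blast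
  then have *: "(\<integral>\<^sup>+w. indicator (space ?S) (seg {1..r} w) * gap p (pair_at t w) \<partial>\<gamma>) \<le>
     ennreal (c powr p) * (\<integral>\<^sup>+w. indicator (space ?S) (seg {1..r} w) \<partial>\<gamma>)"
    unfolding cond_mean_le_def by blast
  have i: "indicator (space ?S) (seg {1..r} w) = (1::ennreal)" if "w \<in> space \<gamma>" for w
    using measurable_space[OF seg that] by simp
  have "(\<integral>\<^sup>+w. gap p (pair_at t w) \<partial>\<gamma>) = (\<integral>\<^sup>+w. indicator (space ?S) (seg {1..r} w) * gap p (pair_at t w) \<partial>\<gamma>)"
    by (intro nn_integral_cong) (simp add: i)
  also note *
  also have "(\<integral>\<^sup>+w. indicator (space ?S) (seg {1..r} w) \<partial>\<gamma>) = (\<integral>\<^sup>+w. 1 \<partial>\<gamma>)"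
    by (intro nn_integral_cong) (simp add: i)
  finally show ?thesis by (simp add: emeasure_space_1)
qed

text \<open>
  The \<open>p\<close>-th power of the norm is the sum of the step costs, each of mean at most \<open>c\<^sup>p\<close>.
\<close>

lemma AW_le_Ft:
  assumes p: "1 \<le> p" and N: "1 \<le> N"
    and g: "\<gamma> \<in> space (prob_algebra (Rsp2 {1..N}))"
    and c: "0 \<le> c" and le: "Ft p N 0 \<gamma> \<le> ennreal c"
  shows "enn_root p (\<integral>\<^sup>+(x, y). ennreal (pnorm p {1..N} (\<lambda>t. x t - y t) powr p) \<partial>\<gamma>) \<le> ennreal (real N powr (1 / p) * c)"
proof -
  let ?R = "Rsp {1..N}"
  have p0: "0 < p" using p by simp
  have s: "sets \<gamma> = sets (?R \<Otimes>\<^sub>M ?R)" using g by (auto simp: space_prob_algebra)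
  have m: "(\<lambda>w. gap p (pair_at t w)) \<in> borel_measurable \<gamma>" if "t \<in> {1..N}" for t
    using that by (subst measurable_cong_sets[OF s refl]) (intro measurable_compose[OF pair_at_measurable gap_measurable])
  have *: "(case w of (x, y) \<Rightarrow> ennreal (pnorm p {1..N} (\<lambda>t. x t - y t) powr p)) = (\<Sum>t\<in>{1..N}. gap p (pair_at t w))" for w
  proof -
    obtain x y where w: "w = (x, y)" by (cases w)
    have "pnorm p {1..N} (\<lambda>t. x t - y t) powr p = (\<Sum>t\<in>{1..N}. \<bar>x t - y t\<bar> powr p)"
      using p0 by (simp add: pnorm_def powr_powr sum_nonneg)
    then show ?thesis by (simp add: w gap_def pair_at_def sum_ennreal)
  qed
  have "(\<integral>\<^sup>+(x, y). ennreal (pnorm p {1..N} (\<lambda>t. x t - y t) powr p) \<partial>\<gamma>) = (\<integral>\<^sup>+w. (\<Sum>t\<in>{1..N}. gap p (pair_at t w)) \<partial>\<gamma>)"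
    by (rule nn_integral_cong) (rule *)
  also have "\<dots> = (\<Sum>t\<in>{1..N}. \<integral>\<^sup>+w. gap p (pair_at t w) \<partial>\<gamma>)"
    by (rule nn_integral_sum[OF m])
  also have "\<dots> \<le> (\<Sum>t\<in>{1..N}. ennreal (c powr p))"
    by (intro sum_mono Ft_gap_le[OF p0 c g le])
  also have "\<dots> = ennreal (real N * c powr p)"
    by (simp add: ennreal_mult' ennreal_of_nat_eq_real_of_nat)
  also have "real N * c powr p = (real N powr (1 / p) * c) powr p"
    using c p0 by (simp add: powr_mult powr_powr)
  finally show ?thesis
    using c by (subst enn_root_le_iff[OF p0]) auto
qed

lemma enn_root_mono:
  assumes "0 < p" "a \<le> b" shows "enn_root p a \<le> enn_root p b"
proof (cases "b = \<infinity>")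
  case False
  then have "a \<noteq> \<infinity>" using assms(2) by (auto simp: top_unique)
  with False assms show ?thesis
    by (auto simp: enn_root_def intro!: ennreal_leI powr_mono2 enn2real_mono simp: less_top)
qed (simp add: enn_root_def)

lemma AW_le_AWinf:
  assumes p: "1 \<le> p" and N: "1 \<le> N"
    and \<mu>: "\<mu> \<in> space (prob_algebra (Rsp {1..N}))" and \<nu>: "\<nu> \<in> space (prob_algebra (Rsp {1..N}))"
  shows "AW p N \<mu> \<nu> \<le> ennreal (real N powr (1 / p)) * AWinf p N \<mu> \<nu>"
proof (cases "AWinf p N \<mu> \<nu>")
  case top
  then show ?thesis using N by (simp add: ennreal_mult_top)
next
  case (real a)
  let ?k = "real N powr (1 / p)"
  have k: "0 < ?k" using N by simp
  show ?thesis
  proof (rule ennreal_le_epsilon)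
    fix e :: real assume e: "0 < e"
    define c where "c = a + e / ?k"
    have c: "0 \<le> c" using real e k by (simp add: c_def)
    have "AWinf p N \<mu> \<nu> < ennreal c" using real e k by (simp add: c_def ennreal_less_iff)
    then obtain \<gamma> where b: "\<gamma> \<in> bicausal_couplings N \<mu> \<nu>" and le: "Ft p N 0 \<gamma> \<le> ennreal c"
      by (rule AWinf_le_of_less)
    have g: "\<gamma> \<in> space (prob_algebra (Rsp2 {1..N}))"
      using b unfolding bicausal_iff[OF \<mu> \<nu> N] by blast
    have "AW p N \<mu> \<nu> \<le> enn_root p (\<integral>\<^sup>+(x, y). ennreal (pnorm p {1..N} (\<lambda>t. x t - y t) powr p) \<partial>\<gamma>)"
      unfolding AW_def using p by (intro enn_root_mono INF_lower b) auto
    also have "\<dots> \<le> ennreal (?k * c)" by (rule AW_le_Ft[OF p N g c le])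
    also have "?k * c = ?k * a + e" using k by (simp add: c_def distrib_left)
    also have "ennreal (?k * a + e) = ennreal ?k * AWinf p N \<mu> \<nu> + ennreal e"
      using real e by (simp add: ennreal_mult')
    finally show "AW p N \<mu> \<nu> \<le> ennreal ?k * AWinf p N \<mu> \<nu> + ennreal e" .
  qed
qed

lemma lower_box_measurable:
  assumes J: "J \<subseteq> {1..N::nat}"
  shows "{x \<in> space (Rsp {1..N}). \<forall>t\<in>J. x t \<le> r t} \<in> sets (Rsp {1..N})"
proof -
  have "finite J" using J by (rule finite_subset) simp
  moreover have "Measurable.pred (Rsp {1..N}) (\<lambda>x. x t \<le> r t)" if "t \<in> J" for t
  proof -
    have [measurable]: "(\<lambda>x. x t) \<in> Rsp {1..N} \<rightarrow>\<^sub>M borel" using that J by (intro coord_measurable) auto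
    show ?thesis by measurable
  qed
  ultimately have "Measurable.pred (Rsp {1..N}) (\<lambda>x. \<forall>t\<in>J. x t \<le> r t)"
    by (intro pred_intros_finite) auto
  then show ?thesis by (simp add: pred_def)
qed

section \<open>Separation of points\<close>

text \<open>
  If \<open>x\<close> lies in the box and \<open>y\<close> is outside the enlarged one, then some coordinate of \<open>x\<close> and \<open>y\<close> differs by at least \<open>\<delta>\<close>.
  By Markov's inequality the probability of this under a coupling of cost \<open>c\<close> is at most \<open>N (c / \<delta>)\<^sup>p\<close>.
  Boxes restrict only the coordinates in \<open>J\<close>, since the whole line has to belong to the generator of the
  Borel sets of each coordinate.
\<close>

lemma lower_box_le:
  assumes p: "1 \<le> p" and N: "1 \<le> N"
    and \<mu>: "\<mu> \<in> space (prob_algebra (Rsp {1..N}))" and \<nu>: "\<nu> \<in> space (prob_algebra (Rsp {1..N}))"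
    and zero: "AWinf p N \<mu> \<nu> = 0" and J: "J \<subseteq> {1..N}" and \<delta>: "0 < \<delta>"
  shows "emeasure \<mu> {x \<in> space (Rsp {1..N}). \<forall>t\<in>J. x t \<le> a t}
    \<le> emeasure \<nu> {x \<in> space (Rsp {1..N}). \<forall>t\<in>J. x t \<le> a t + \<delta>}"
proof (rule ennreal_le_epsilon)
  let ?R = "Rsp {1..N}"
  let ?A = "{x \<in> space ?R. \<forall>t\<in>J. x t \<le> a t}" and ?B = "{x \<in> space ?R. \<forall>t\<in>J. x t \<le> a t + \<delta>}"
  fix e :: real assume e: "0 < e"
  have p0: "0 < p" using p by simp
  \<comment> \<open>With this cost the error term of the Markov inequality is exactly e.\<close>
  define c where "c = \<delta> * (e / real N) powr (1 / p)"
  have c: "0 < c" using \<delta> e N by (simp add: c_def)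
  then have "AWinf p N \<mu> \<nu> < ennreal c" by (simp add: zero)
  then obtain \<gamma> where b: "\<gamma> \<in> bicausal_couplings N \<mu> \<nu>" and le: "Ft p N 0 \<gamma> \<le> ennreal c"
    by (rule AWinf_le_of_less)
  have g: "\<gamma> \<in> space (prob_algebra (?R \<Otimes>\<^sub>M ?R))" and d: "distr \<gamma> ?R fst = \<mu>" "distr \<gamma> ?R snd = \<nu>"
    using b unfolding bicausal_iff[OF \<mu> \<nu> N] by blast+
  have s: "sets \<gamma> = sets (?R \<Otimes>\<^sub>M ?R)" using g by (auto simp: space_prob_algebra)
  have f: "fst \<in> \<gamma> \<rightarrow>\<^sub>M ?R" "snd \<in> \<gamma> \<rightarrow>\<^sub>M ?R" by (auto simp: measurable_cong_sets[OF s refl])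
  note [measurable] = f
  have fJ: "finite J" using J by (rule finite_subset) simp
  have A[measurable]: "?A \<in> sets ?R" and B[measurable]: "?B \<in> sets ?R" using J by (auto intro: lower_box_measurable)
  have m[measurable]: "(\<lambda>w. gap p (pair_at t w)) \<in> borel_measurable \<gamma>" if "t \<in> J" for t
    using that J by (subst measurable_cong_sets[OF s refl]) (intro measurable_compose[OF pair_at_measurable gap_measurable], auto)
  let ?S = "\<lambda>w. \<Sum>t\<in>J. ennreal (\<delta> powr (- p)) * gap p (pair_at t w)"
  have point: "indicator ?A (fst w) \<le> indicator ?B (snd w) + ?S w" if "w \<in> space \<gamma>" for w
  proof (cases "fst w \<in> ?A \<and> snd w \<notin> ?B")
    case True
    moreover have "snd w \<in> space ?R" using f(2) that by (rule measurable_space)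
    ultimately obtain t where t: "t \<in> J" "a t + \<delta> < snd w t" "fst w t \<le> a t" by (auto simp: not_le)
    then have "\<delta> powr p \<le> \<bar>fst w t - snd w t\<bar> powr p" using \<delta> p by (intro powr_mono2) auto
    then have "\<delta> powr (- p) * \<delta> powr p \<le> \<delta> powr (- p) * \<bar>fst w t - snd w t\<bar> powr p" by (intro mult_left_mono) auto
    then have "1 \<le> \<delta> powr (- p) * \<bar>fst w t - snd w t\<bar> powr p" using \<delta> by (simp add: powr_add[symmetric])
    then have "1 \<le> ennreal (\<delta> powr (- p)) * gap p (pair_at t w)"
      by (simp add: gap_def pair_at_def split_beta' ennreal_mult'[symmetric])
    also have "\<dots> \<le> ?S w" using fJ t by (intro member_le_sum) auto
    finally show ?thesis using True by simp
  next
    case False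
    then show ?thesis by (auto simp: indicator_def)
  qed
  have "emeasure \<mu> ?A = (\<integral>\<^sup>+w. indicator ?A (fst w) \<partial>\<gamma>)"
    unfolding d(1)[symmetric] using nn_integral_distr[OF f(1), of "indicator ?A"] by simp
  also have "\<dots> \<le> (\<integral>\<^sup>+w. indicator ?B (snd w) + ?S w \<partial>\<gamma>)"
    by (intro nn_integral_mono point)
  also have "\<dots> = (\<integral>\<^sup>+w. indicator ?B (snd w) \<partial>\<gamma>) + (\<Sum>t\<in>J. ennreal (\<delta> powr (- p)) * (\<integral>\<^sup>+w. gap p (pair_at t w) \<partial>\<gamma>))"
    by (subst nn_integral_add) (auto simp: nn_integral_sum nn_integral_cmult)
  also have "(\<integral>\<^sup>+w. indicator ?B (snd w) \<partial>\<gamma>) = emeasure \<nu> ?B"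
    unfolding d(2)[symmetric] using nn_integral_distr[OF f(2), of "indicator ?B"] by simp
  also have "(\<Sum>t\<in>J. ennreal (\<delta> powr (- p)) * (\<integral>\<^sup>+w. gap p (pair_at t w) \<partial>\<gamma>)) \<le> (\<Sum>t\<in>J. ennreal (e / real N))"
  proof (rule sum_mono)
    fix t assume "t \<in> J"
    then have "ennreal (\<delta> powr (- p)) * (\<integral>\<^sup>+w. gap p (pair_at t w) \<partial>\<gamma>) \<le> ennreal (\<delta> powr (- p)) * ennreal (c powr p)"
      using J c by (intro mult_left_mono Ft_gap_le[OF p0 _ g le]) auto
    also have "\<dots> = ennreal (\<delta> powr (- p) * c powr p)" by (simp add: ennreal_mult')
    also have "\<delta> powr (- p) * c powr p = e / real N"
    proof -
      have "c powr p = \<delta> powr p * (e / real N)"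
        using \<delta> e p0 N by (simp add: c_def powr_mult powr_powr)
      moreover have "\<delta> powr (- p) * \<delta> powr p = 1" using \<delta> by (simp add: powr_add[symmetric])
      ultimately show ?thesis by (simp add: mult.assoc[symmetric])
    qed
    finally show "ennreal (\<delta> powr (- p)) * (\<integral>\<^sup>+w. gap p (pair_at t w) \<partial>\<gamma>) \<le> ennreal (e / real N)" .
  qed
  also have "(\<Sum>t\<in>J. ennreal (e / real N)) \<le> (\<Sum>t\<in>{1..N}. ennreal (e / real N))"
    by (rule sum_mono2) (use J in auto)
  also have "\<dots> = ennreal e"
    using e N by (simp add: ennreal_of_nat_eq_real_of_nat ennreal_mult'[symmetric])
  finally show "emeasure \<mu> ?A \<le> emeasure \<nu> ?B + ennreal e" by (simp add: add_mono)
qed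

lemma lower_box_le_lower_box:
  assumes p: "1 \<le> p" and N: "1 \<le> N"
    and \<mu>: "\<mu> \<in> space (prob_algebra (Rsp {1..N}))" and \<nu>: "\<nu> \<in> space (prob_algebra (Rsp {1..N}))"
    and zero: "AWinf p N \<mu> \<nu> = 0" and J: "J \<subseteq> {1..N}"
  shows "emeasure \<mu> {x \<in> space (Rsp {1..N}). \<forall>t\<in>J. x t \<le> a t}
    \<le> emeasure \<nu> {x \<in> space (Rsp {1..N}). \<forall>t\<in>J. x t \<le> a t}"
proof -
  let ?R = "Rsp {1..N}"
  let ?B = "\<lambda>n. {x \<in> space ?R. \<forall>t\<in>J. x t \<le> a t + 1 / real (Suc n)}"
  have s: "sets \<nu> = sets ?R" and pr: "prob_space \<nu>" using \<nu> by (auto simp: space_prob_algebra)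
  interpret prob_space \<nu> by fact
  have B: "?B n \<in> sets \<nu>" for n unfolding s by (rule lower_box_measurable[OF J])
  have "decseq ?B"
  proof (rule decseq_SucI)
    fix n
    have "1 / real (Suc (Suc n)) \<le> 1 / real (Suc n)" by (simp add: frac_le)
    then show "?B (Suc n) \<subseteq> ?B n" by (fastforce intro: order_trans)
  qed
  have "emeasure \<mu> {x \<in> space ?R. \<forall>t\<in>J. x t \<le> a t} \<le> (INF n. emeasure \<nu> (?B n))"
    by (intro INF_greatest lower_box_le[OF p N \<mu> \<nu> zero J]) simp
  also have "\<dots> = emeasure \<nu> (\<Inter>n. ?B n)"
  proof (rule INF_emeasure_decseq)
    show "range ?B \<subseteq> sets \<nu>" by (intro image_subsetI B)
    show "emeasure \<nu> (?B n) \<noteq> \<infinity>" for n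
      unfolding infinity_ennreal_def by (rule emeasure_finite)
  qed fact
  also have "(\<Inter>n. ?B n) = {x \<in> space ?R. \<forall>t\<in>J. x t \<le> a t}"
  proof -
    have "u \<le> v" if "\<And>n. u \<le> v + 1 / real (Suc n)" for u v :: real
    proof (rule field_le_epsilon)
      fix e :: real assume "0 < e"
      then obtain n where "1 / real (Suc n) < e" using nat_approx_posE by blast
      with that[of n] show "u \<le> v + e" by linarith
    qed
    note limit = this
    show ?thesis
    proof (intro subset_antisym subsetI)
      fix x assume "x \<in> (\<Inter>n. ?B n)"
      have x: "x \<in> ?B n" for n
        using \<open>x \<in> (\<Inter>n. ?B n)\<close> by (rule INT_D) (rule UNIV_I)
      have "x t \<le> a t" if "t \<in> J" for t
      proof (rule limit)
        show "x t \<le> a t + 1 / real (Suc n)" for n using x[of n] that by blast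
      qed
      moreover have "x \<in> space ?R" using x[of 0] by blast
      ultimately show "x \<in> {x \<in> space ?R. \<forall>t\<in>J. x t \<le> a t}" by blast
    next
      fix x assume x: "x \<in> {x \<in> space ?R. \<forall>t\<in>J. x t \<le> a t}"
      show "x \<in> (\<Inter>n. ?B n)"
      proof (rule INT_I)
        fix n
        have "x t \<le> a t + 1 / real (Suc n)" if "t \<in> J" for t
          using x that by (intro add_increasing2) simp_all
        then show "x \<in> ?B n" using x by simp
      qed
    qed
  qed
  finally show ?thesis .
qed

lemma AWinf_zero_imp_eq:
  assumes p: "1 \<le> p" and N: "1 \<le> N"
    and \<mu>: "\<mu> \<in> space (prob_algebra (Rsp {1..N}))" and \<nu>: "\<nu> \<in> space (prob_algebra (Rsp {1..N}))"
    and zero: "AWinf p N \<mu> \<nu> = 0"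
  shows "\<mu> = \<nu>"
proof -
  let ?R = "Rsp {1..N}" and ?I = "{1..N}"
  let ?E = "insert UNIV (range atMost) :: real set set"
  let ?P = "{Pi\<^sub>E ?I F | F. \<forall>i\<in>?I. F i \<in> ?E}"
  have s: "sets \<mu> = sets ?R" "sets \<nu> = sets ?R" and pr: "prob_space \<mu>" using \<mu> \<nu> by (auto simp: space_prob_algebra)
  have zero': "AWinf p N \<nu> \<mu> = 0" using AWinf_commute[OF p N \<mu> \<nu>] zero by simp
  have gen: "sets ?R = sigma_sets (space ?R) ?P"
    by (rule sets_PiM_generated) (simp_all add: sets_borel_atMost)
  show ?thesis
  proof (rule measure_eqI_generator_eq_countable[where E="?P" and \<Omega>="space ?R" and A="{space ?R}"])
    show "Int_stable ?P" by (rule Int_stable_PiE) (rule Int_stable_atMost)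
    show "?P \<subseteq> Pow (space ?R)" unfolding space_PiM by (rule PiE_generators_Pow) simp
    show "sets \<mu> = sigma_sets (space ?R) ?P" "sets \<nu> = sigma_sets (space ?R) ?P" using s gen by simp_all
    show "{space ?R} \<subseteq> ?P" by (auto simp: space_PiM)
    show "emeasure \<mu> b \<noteq> \<infinity>" for b using finite_measure.emeasure_finite[OF prob_space.finite_measure[OF pr]] by simp
    fix X assume "X \<in> ?P"
    then obtain F where X: "X = Pi\<^sub>E ?I F" and F: "\<And>i. i \<in> ?I \<Longrightarrow> F i \<in> ?E" by blast
    define J where "J = {t \<in> ?I. F t \<noteq> UNIV}"
    have "\<forall>t\<in>J. \<exists>r. F t = {..r}" using F by (auto simp: J_def)
    then obtain a where a: "\<And>t. t \<in> J \<Longrightarrow> F t = {..a t}" by metis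
    have J: "J \<subseteq> ?I" by (auto simp: J_def)
    have "X = {x \<in> space ?R. \<forall>t\<in>J. x t \<le> a t}"
    proof -
      have "x t \<in> F t \<longleftrightarrow> (t \<in> J \<longrightarrow> x t \<le> a t)" if "t \<in> ?I" for t and x :: "nat \<Rightarrow> real"
        using a[of t] that by (cases "t \<in> J") (auto simp: J_def)
      then show ?thesis using J unfolding X by (auto simp: space_PiM PiE_def Pi_def)
    qed
    then show "emeasure \<mu> X = emeasure \<nu> X"
      using lower_box_le_lower_box[OF p N \<mu> \<nu> zero J] lower_box_le_lower_box[OF p N \<nu> \<mu> zero' J]
      by (simp add: antisym)
  qed simp_all
qed

theorem lemma3p4:
  fixes p :: real and N :: nat
  assumes "1 \<le> p" and "1 \<le> N"
  shows "ext_metric_on (Pp p N) (AWinf p N) \<and>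
    (\<forall>\<mu>\<in>Pp p N. \<forall>\<nu>\<in>Pp p N. AW p N \<mu> \<nu> \<le> ennreal (real N powr (1 / p)) * AWinf p N \<mu> \<nu>)"
proof -
  have P: "\<mu> \<in> space (prob_algebra (Rsp {1..N}))" if "\<mu> \<in> Pp p N" for \<mu>
    using that by (simp add: Pp_def)
  show ?thesis
    unfolding ext_metric_on_def
    using AWinf_zero_imp_eq[OF assms P P] AWinf_self[OF assms(1) P assms(2)]
      AWinf_commute[OF assms P P] AWinf_triangle[OF assms P P P] AW_le_AWinf[OF assms P P]
    by (intro conjI ballI iffI) auto
qed

end
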